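(* Let $\Pi=\mathbb{R}/\mathbb{Z}$ be the circle. Let $a\in C^2(\Pi)$ with $a>0$, $b\in C^1(\Pi)$ and $c\in C^0(\Pi)$. Assume that $b$ changes sign on $\Pi$ (it takes both positive and negative values), that $b$ vanishes at only finitely many points $x_1,\dots,x_n$, and that each zero $x_i$ of $b$ is either of finite order $m_i\ge 1$ or flat. For $\epsilon>0$ let $\lambda_\epsilon$ be the principal eigenvalue of the operator $L_\epsilon u=\epsilon\,a\,u''+b\,u'+c\,u$ on $\Pi$. Then $$\lim_{\epsilon\to 0}\lambda_\epsilon=\max_{x:\,b(x)=0}\bigl(-\max(0,b'(x))+c(x)\bigr).$$
   Context: The principal eigenvalue of $L_\epsilon$ is the eigenvalue with maximal real part (it is real, and admits a positive eigenfunction in $C^2(\Pi)$). A zero $x_i$ of $b$ is of finite order $m_i\ge1$ if $b$ is $C^{m_i}$ in a neighborhood of $x_i$, $b(x_i)=b'(x_i)=\dots=b^{(m_i-1)}(x_i)=0$ and $b^{(m_i)}(x_i)\ne0$. It is flat if $b$ is $C^\infty$ in a neighborhood of $x_i$ and $b^{(k)}(x_i)=0$ for all $k\in\mathbb{N}$. *)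

theory Defs
  imports "HOL-Analysis.Analysis" "HOL-Library.Periodic_Fun"
begin

text \<open>
  Functions on the circle \<open>\<real>/\<int>\<close> are represented by functions on \<open>\<real>\<close> of period 1.
  Derivatives are taken by \<^const>\<open>vector_derivative\<close>, so that the same notions apply to
  the real coefficients and to the complex-valued eigenfunctions.
\<close>

definition nth_derivative :: "nat \<Rightarrow> (real \<Rightarrow> 'a::real_normed_vector) \<Rightarrow> real \<Rightarrow> 'a" where
  "nth_derivative k f = ((\<lambda>g x. vector_derivative g (at x)) ^^ k) f"

text \<open>Only meaningful for open \<open>S\<close>, since the derivatives are two-sided.\<close>

definition C_k_on :: "nat \<Rightarrow> (real \<Rightarrow> 'a::real_normed_vector) \<Rightarrow> real set \<Rightarrow> bool" where
  "C_k_on k f S \<longleftrightarrow>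
     (\<forall>j<k. \<forall>x\<in>S. nth_derivative j f differentiable (at x)) \<and>
     continuous_on S (nth_derivative k f)"

definition C_k_circle :: "nat \<Rightarrow> (real \<Rightarrow> 'a::real_normed_vector) \<Rightarrow> bool" where
  "C_k_circle k f \<longleftrightarrow> periodic_fun_simple' f \<and> C_k_on k f UNIV"

definition finite_order_zero :: "(real \<Rightarrow> real) \<Rightarrow> real \<Rightarrow> nat \<Rightarrow> bool" where
  "finite_order_zero b x m \<longleftrightarrow>
     m \<ge> 1 \<and> (\<exists>U. open U \<and> x \<in> U \<and> C_k_on m b U) \<and>
     (\<forall>k<m. nth_derivative k b x = 0) \<and> nth_derivative m b x \<noteq> 0"

definition flat_zero :: "(real \<Rightarrow> real) \<Rightarrow> real \<Rightarrow> bool" where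
  "flat_zero b x \<longleftrightarrow>
     (\<exists>U. open U \<and> x \<in> U \<and> (\<forall>k. C_k_on k b U)) \<and> (\<forall>k. nth_derivative k b x = 0)"

definition L_op ::
  "(real \<Rightarrow> real) \<Rightarrow> (real \<Rightarrow> real) \<Rightarrow> (real \<Rightarrow> real) \<Rightarrow> real \<Rightarrow> (real \<Rightarrow> complex) \<Rightarrow> real \<Rightarrow> complex"
where
  "L_op a b c \<epsilon> u x =
     (\<epsilon> * a x) *\<^sub>R nth_derivative 2 u x + b x *\<^sub>R nth_derivative 1 u x + c x *\<^sub>R u x"

definition is_eigenvalue ::
  "(real \<Rightarrow> real) \<Rightarrow> (real \<Rightarrow> real) \<Rightarrow> (real \<Rightarrow> real) \<Rightarrow> real \<Rightarrow> complex \<Rightarrow> bool"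
where
  "is_eigenvalue a b c \<epsilon> \<mu> \<longleftrightarrow>
     (\<exists>u. C_k_circle 2 u \<and> (\<exists>x. u x \<noteq> 0) \<and> (\<forall>x. L_op a b c \<epsilon> u x = \<mu> * u x))"

text \<open>
  The eigenvalue with maximal real part among all complex eigenvalues. Its existence,
  uniqueness and realness are not part of the definition.
\<close>

definition principal_eigenvalue ::
  "(real \<Rightarrow> real) \<Rightarrow> (real \<Rightarrow> real) \<Rightarrow> (real \<Rightarrow> real) \<Rightarrow> real \<Rightarrow> complex"
where
  "principal_eigenvalue a b c \<epsilon> =
     (THE \<mu>. is_eigenvalue a b c \<epsilon> \<mu> \<and> (\<forall>\<nu>. is_eigenvalue a b c \<epsilon> \<nu> \<longrightarrow> Re \<nu> \<le> Re \<mu>))"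

text \<open>The points of the circle where \<open>b\<close> vanishes, each represented once, in \<open>[0, 1)\<close>.\<close>

definition circle_zeros :: "(real \<Rightarrow> real) \<Rightarrow> real set" where
  "circle_zeros b = {x \<in> {0..<1}. b x = 0}"

end

(*
The proof compares the positive eigenfunction of L_eps with explicit sub- and supersolutions.

Near a zero z of b the operator lives at the scale sqrt eps, where it looks like
a(z) u'' + b'(z) y u' + c(z) u. A bump supported in a ball of radius of order sqrt eps
(multiplied by a Gaussian if b'(z) > 0) is a subsolution, and bounds the eigenvalue below by
c(z) - max(0, b'(z)) up to a small error.

For the upper bound take exp h with h = -kappa ln(kappa eps + Q) - K H. Here Q >= 0 vanishes exactly
at the zeros with b' > 0 and Q'' = b'/a there, so that the first term is an almost optimal
supersolution near these zeros once kappa is large; and b H' > 0 off the zeros of b, so that a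
large K makes exp h a supersolution away from the zeros. That H can be taken periodic is
where the sign change of b enters.

The eigenpair with positive eigenfunction comes from Hill's equation y'' = (q0 + lambda w) y, to which
the eigenvalue equation is reduced by the Liouville substitution: beyond the last
lambda for which the solution vanishing at 0 has a zero in (0,1], the trace of the period
map grows from a negative value to infinity, hence the required Floquet multiplier occurs.
*)
theory Submission
  imports Defs
begin

section \<open>The equation \<open>y'' = q y\<close>\<close>

text \<open>The number \<open>- max 0 \<beta>\<close> comes from the model operator a u'' + \<beta>
  y u' with constant a and \<beta>. Its relevant positive function is the constant 1 for \<beta>
  \<le> 0, with value 0, and the Gaussian exp (- \<beta> y^2 / (2 a)) for \<beta> > 0, with value -
  \<beta>. The supersolution is not this Gaussian, in the form exp (- Q / \<epsilon>), because off
  the wells its logarithmic derivative has size 1 / \<epsilon>, and no correction independent of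
  \<epsilon> can compensate that. The function (\<kappa> \<epsilon> + Q)^(- \<kappa>) is
  proportional to (1 + Q / (\<kappa> \<epsilon>))^(- \<kappa>), which tends to the Gaussian as
  \<kappa> grows. For fixed \<kappa> its logarithmic derivative stays bounded as \<epsilon> tends to
  0 on compact sets where Q > 0, so there a single K works for all small \<epsilon>. The constants
  are therefore fixed in the order \<kappa>, K, \<epsilon>.\<close>

definition hill_sol :: "(real \<Rightarrow> real) \<Rightarrow> (real \<Rightarrow> real) \<Rightarrow> (real \<Rightarrow> real) \<Rightarrow> bool" where
  "hill_sol q y y' \<longleftrightarrow> (\<forall>x. (y has_real_derivative y' x) (at x) \<and>
     (y' has_real_derivative q x * y x) (at x))"

lemma solD:
  assumes "hill_sol q y y'"
  shows "(y has_real_derivative y' x) (at x)" "(y' has_real_derivative q x * y x) (at x)"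
  using assms by (auto simp: hill_sol_def)

lemma hill_sol_lincomb:
  assumes "hill_sol q y y'" "hill_sol q z z'"
  shows "hill_sol q (\<lambda>x. \<alpha> * y x + \<beta> * z x) (\<lambda>x. \<alpha> * y' x + \<beta> * z' x)"
  unfolding hill_sol_def
  by (auto intro!: derivative_eq_intros solD[OF assms(1)] solD[OF assms(2)] simp: algebra_simps)

section \<open>Existence, uniqueness and dependence on the potential\<close>

lemma exists_antiderivative:
  fixes f :: "real \<Rightarrow> real"
  assumes "continuous_on UNIV f"
  shows "\<exists>F. F 0 = 0 \<and> (\<forall>x. (F has_real_derivative f x) (at x))"
proof -
  have "\<exists>F. \<forall>x. -\<infinity> < ereal x \<longrightarrow> ereal x < \<infinity> \<longrightarrow> (F has_vector_derivative f x) (at x)"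
    by (rule einterval_antiderivative) (use assms in \<open>auto simp: continuous_on_eq_continuous_at\<close>)
  then obtain F where F: "\<And>x. (F has_real_derivative f x) (at x)"
    by (auto simp: has_real_derivative_iff_has_vector_derivative)
  show ?thesis
    by (rule exI[of _ "\<lambda>x. F x - F 0"]) (auto intro!: derivative_eq_intros F)
qed

text \<open>In the weight exp (N |x|), one integration from 0 gains a factor 1 / N. A large N thus
  makes the Picard iteration contract on the whole line at once, without gluing local
  solutions.\<close>

lemma exp_growth_integrate:
  fixes f f' :: "real \<Rightarrow> real"
  assumes D: "\<And>x. (f has_real_derivative f' x) (at x)" and "f 0 = 0" and "N > 0"
    and bd: "\<And>x. \<bar>f' x\<bar> \<le> C * exp (N * \<bar>x\<bar>)"
  shows "\<bar>f x\<bar> \<le> C / N * exp (N * \<bar>x\<bar>)"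
proof -
  have C: "C \<ge> 0" using bd[of 0] by simp
  have main: "\<bar>g x\<bar> \<le> C / N * exp (N * x)"
    if D: "\<And>x. (g has_real_derivative g' x) (at x)" and "g 0 = 0"
    and bd: "\<And>x. \<bar>g' x\<bar> \<le> C * exp (N * \<bar>x\<bar>)" and "x \<ge> 0" for g g' x
  proof -
    have "g x \<le> C / N * exp (N * x)"
    proof -
      have "(\<lambda>x. g x - C / N * exp (N * x)) x \<le> (\<lambda>x. g x - C / N * exp (N * x)) 0"
        apply (rule DERIV_nonpos_imp_nonincreasing[OF \<open>x \<ge> 0\<close>])
        subgoal for u
          apply (rule exI[of _ "g' u - C * exp (N * u)"])
          using bd[of u] \<open>N > 0\<close> by (auto intro!: derivative_eq_intros D)
        done
      moreover have "C / N \<ge> 0" using C \<open>N > 0\<close> by simp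
      ultimately show ?thesis using \<open>g 0 = 0\<close> by simp
    qed
    moreover have "- g x \<le> C / N * exp (N * x)"
    proof -
      have "(\<lambda>x. - g x - C / N * exp (N * x)) x \<le> (\<lambda>x. - g x - C / N * exp (N * x)) 0"
        apply (rule DERIV_nonpos_imp_nonincreasing[OF \<open>x \<ge> 0\<close>])
        subgoal for u
          apply (rule exI[of _ "- g' u - C * exp (N * u)"])
          using bd[of u] \<open>N > 0\<close> by (auto intro!: derivative_eq_intros D)
        done
      moreover have "C / N \<ge> 0" using C \<open>N > 0\<close> by simp
      ultimately show ?thesis using \<open>g 0 = 0\<close> by simp
    qed
    ultimately show ?thesis by linarith
  qed
  show ?thesis
  proof (cases "x \<ge> 0")
    case True
    with main[OF D \<open>f 0 = 0\<close> bd True] show ?thesis by simp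
  next
    case False
    have D': "((\<lambda>x. f (- x)) has_real_derivative - f' (- x)) (at x)" for x
      using DERIV_chain2[OF D DERIV_minus[OF DERIV_ident], of x UNIV] by simp
    have "\<bar>f (- (- x))\<bar> \<le> C / N * exp (N * (- x))"
      by (rule main[OF D']) (use \<open>f 0 = 0\<close> bd[of "- _"] False in auto)
    with False show ?thesis by simp
  qed
qed

lemma hill_sol_exists:
  fixes q :: "real \<Rightarrow> real"
  assumes q: "continuous_on UNIV q" and Q: "\<And>x. \<bar>q x\<bar> \<le> Q"
  shows "\<exists>y y'. hill_sol q y y' \<and> y 0 = \<alpha> \<and> y' 0 = \<beta>"
proof -
  define AD where "AD f = (SOME F. F 0 = 0 \<and> (\<forall>x. (F has_real_derivative f x) (at x)))"
    for f :: "real \<Rightarrow> real"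
  have AD0: "AD f 0 = 0" and AD: "\<And>x. (AD f has_real_derivative f x) (at x)"
    if "continuous_on UNIV f" for f
    using someI_ex[OF exists_antiderivative[OF that], folded AD_def] by auto
  \<comment> \<open>Picard series: \<open>d n\<close> is the n-th increment of the iteration, so
    that the second derivative of \<open>d (Suc n)\<close> is \<open>q * d n\<close>. The functions
    \<open>e n\<close> and \<open>g n\<close> are the first and second derivatives of
    \<open>d n\<close>.\<close>
  define d where "d = rec_nat (\<lambda>x. \<alpha> + \<beta> * x) (\<lambda>_ f. AD (AD (\<lambda>x. q x * f x)))"
  define e where "e n = (case n of 0 \<Rightarrow> (\<lambda>x. \<beta>) | Suc m \<Rightarrow> AD (\<lambda>x. q x * d m x))" for n
  define g where "g n = (case n of 0 \<Rightarrow> (\<lambda>x. 0) | Suc m \<Rightarrow> (\<lambda>x. q x * d m x))" for n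
  have cont: "continuous_on UNIV f" if "\<And>x. (f has_real_derivative f' x) (at x)" for f f' :: "real \<Rightarrow> real"
    using that by (meson DERIV_isCont continuous_at_imp_continuous_on)
  have d_cont: "continuous_on UNIV (d n)" for n
  proof (induction n)
    case 0
    show ?case by (auto simp: d_def intro!: continuous_intros)
  next
    case (Suc n)
    have 1: "continuous_on UNIV (\<lambda>x. q x * d n x)" by (intro continuous_intros q Suc)
    have 2: "continuous_on UNIV (AD (\<lambda>x. q x * d n x))" using cont[OF AD[OF 1]] .
    have "continuous_on UNIV (AD (AD (\<lambda>x. q x * d n x)))" using cont[OF AD[OF 2]] .
    then show ?case by (simp add: d_def)
  qed
  have qd_cont: "continuous_on UNIV (\<lambda>x. q x * d n x)" for n by (intro continuous_intros q d_cont)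
  have De: "(e n has_real_derivative g n x) (at x)" for n x
    by (cases n) (auto simp: e_def g_def intro!: AD qd_cont)
  have Dd: "(d n has_real_derivative e n x) (at x)" for n x
  proof (cases n)
    case 0 then show ?thesis by (auto simp: d_def e_def intro!: derivative_eq_intros)
  next
    case (Suc m)
    have "continuous_on UNIV (AD (\<lambda>x. q x * d m x))" using cont[OF AD[OF qd_cont]] .
    from AD[OF this] Suc show ?thesis by (simp add: d_def e_def)
  qed
  have d0: "d (Suc n) 0 = 0" and e0: "e (Suc n) 0 = 0" for n
  proof -
    show "e (Suc n) 0 = 0" by (simp add: e_def AD0 qd_cont)
    have "continuous_on UNIV (AD (\<lambda>x. q x * d n x))" using cont[OF AD[OF qd_cont]] .
    from AD0[OF this] show "d (Suc n) 0 = 0" by (simp add: d_def)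
  qed
  have Q0: "Q \<ge> 0" using Q[of 0] by linarith
  \<comment> \<open>Passing from \<open>d n\<close> to \<open>d (Suc n)\<close> costs Q / N^2, which
    has to be at most 1/2; the bound on the first derivatives uses Q / N \<le> 1.\<close>
  define N where "N = 1 + 2 * Q"
  have N: "N \<ge> 1" "N > 0" and N2: "2 * Q \<le> N * N" "2 * Q \<le> N" using Q0 by (auto simp: N_def algebra_simps)
  define A where "A = \<bar>\<alpha>\<bar> + \<bar>\<beta>\<bar>"
  have A0: "A \<ge> 0" by (simp add: A_def)
  have step: "\<bar>e (Suc n) x\<bar> \<le> (Q * C / N) * exp (N * \<bar>x\<bar>)"
    if "\<And>x. \<bar>d n x\<bar> \<le> C * exp (N * \<bar>x\<bar>)" for n C x
  proof (rule exp_growth_integrate[OF De e0 \<open>N > 0\<close>])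
    fix x
    have "\<bar>q x\<bar> * \<bar>d n x\<bar> \<le> Q * (C * exp (N * \<bar>x\<bar>))"
      by (rule mult_mono) (use Q that Q0 in auto)
    then show "\<bar>g (Suc n) x\<bar> \<le> (Q * C) * exp (N * \<bar>x\<bar>)" by (simp add: g_def abs_mult mult.assoc)
  qed
  have dbd: "\<bar>d n x\<bar> \<le> (A * (1/2)^n) * exp (N * \<bar>x\<bar>)" for n x
  proof (induction n arbitrary: x)
    case 0
    have "\<bar>x\<bar> \<le> exp (N * \<bar>x\<bar>)"
    proof -
      have "\<bar>x\<bar> \<le> N * \<bar>x\<bar>" using N mult_right_mono[of 1 N "\<bar>x\<bar>"] by simp
      also have "\<dots> \<le> exp (N * \<bar>x\<bar>)" using exp_ge_add_one_self[of "N * \<bar>x\<bar>"] by linarith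
      finally show ?thesis .
    qed
    moreover have "1 \<le> exp (N * \<bar>x\<bar>)" using N by simp
    ultimately have "\<bar>\<alpha>\<bar> * 1 + \<bar>\<beta>\<bar> * \<bar>x\<bar> \<le> \<bar>\<alpha>\<bar> * exp (N * \<bar>x\<bar>) + \<bar>\<beta>\<bar> * exp (N * \<bar>x\<bar>)"
      by (intro add_mono mult_left_mono) auto
    moreover have "\<bar>\<alpha> + \<beta> * x\<bar> \<le> \<bar>\<alpha>\<bar> * 1 + \<bar>\<beta>\<bar> * \<bar>x\<bar>" by (metis abs_mult abs_triangle_ineq mult_1_right)
    ultimately show ?case by (simp add: d_def A_def algebra_simps)
  next
    case (Suc n)
    let ?C = "A * (1/2)^n"
    have "\<bar>d (Suc n) x\<bar> \<le> (Q * ?C / N) / N * exp (N * \<bar>x\<bar>)"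
      by (rule exp_growth_integrate[OF Dd d0 \<open>N > 0\<close> step[OF Suc]])
    also have "(Q * ?C / N) / N = (Q / (N * N)) * ?C" by simp
    also have "\<dots> * exp (N * \<bar>x\<bar>) \<le> (1/2 * ?C) * exp (N * \<bar>x\<bar>)"
      using N2 \<open>N > 0\<close> A0 by (intro mult_right_mono) (auto simp: field_simps)
    finally show ?case by simp
  qed
  have ebd: "\<bar>e n x\<bar> \<le> (2 * A * (1/2)^n) * exp (N * \<bar>x\<bar>)" for n x
  proof (cases n)
    case 0
    have "1 \<le> exp (N * \<bar>x\<bar>)" using N by simp
    then have "(2 * A) * 1 \<le> (2 * A) * exp (N * \<bar>x\<bar>)" using A0 by (intro mult_left_mono) auto
    moreover have "\<bar>\<beta>\<bar> \<le> 2 * A" unfolding A_def by simp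
    ultimately show ?thesis using 0 by (simp add: e_def)
  next
    case (Suc m)
    have "\<bar>e (Suc m) x\<bar> \<le> (Q * (A * (1/2)^m) / N) * exp (N * \<bar>x\<bar>)" by (rule step[OF dbd])
    also have "\<dots> = (Q / N) * (A * (1/2)^m) * exp (N * \<bar>x\<bar>)" by simp
    also have "\<dots> \<le> 1 * (A * (1/2)^m) * exp (N * \<bar>x\<bar>)"
      using N2 \<open>N > 0\<close> A0 Q0 by (intro mult_right_mono) (auto simp: field_simps)
    finally show ?thesis using Suc by simp
  qed
  have gbd: "\<bar>g n x\<bar> \<le> (2 * Q * A * (1/2)^n) * exp (N * \<bar>x\<bar>)" for n x
  proof (cases n)
    case 0 then show ?thesis using Q0 A0 by (simp add: g_def)
  next
    case (Suc m)
    have "\<bar>q x\<bar> * \<bar>d m x\<bar> \<le> Q * ((A * (1/2)^m) * exp (N * \<bar>x\<bar>))"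
      by (rule mult_mono) (use Q dbd Q0 in auto)
    then show ?thesis using Suc by (simp add: g_def abs_mult algebra_simps)
  qed
  have geo: "summable (\<lambda>n. (K * (1/2)^n) * L)" for K L :: real
    by (intro summable_mult2 summable_mult summable_geometric) auto
  have sums_d: "summable (\<lambda>n. d n x)" for x
    by (rule summable_comparison_test'[OF geo[of A "exp (N * \<bar>x\<bar>)"], of 0]) (use dbd in auto)
  have sums_e: "summable (\<lambda>n. e n x)" for x
    by (rule summable_comparison_test'[OF geo[of "2 * A" "exp (N * \<bar>x\<bar>)"], of 0]) (use ebd in auto)
  have unif: "uniformly_convergent_on (ball 0 R) (\<lambda>n x. \<Sum>i<n. f i x)"
    if f: "\<And>n x. \<bar>f n x\<bar> \<le> (K * (1/2)^n) * exp (N * \<bar>x\<bar>)" and "K \<ge> 0"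
    for f :: "nat \<Rightarrow> real \<Rightarrow> real" and K R
  proof (rule Weierstrass_m_test'[OF _ geo[of K "exp (N * R)"]])
    fix n and x :: real assume "x \<in> ball 0 R"
    then have "\<bar>x\<bar> \<le> R" by (simp add: dist_real_def)
    then have "exp (N * \<bar>x\<bar>) \<le> exp (N * R)" using N by simp
    then have "(K * (1/2)^n) * exp (N * \<bar>x\<bar>) \<le> (K * (1/2)^n) * exp (N * R)"
      by (rule mult_left_mono) (use \<open>K \<ge> 0\<close> in auto)
    with f[of n x] show "norm (f n x) \<le> K * (1/2)^n * exp (N * R)" by simp
  qed
  define y where "y x = (\<Sum>n. d n x)" for x
  define y' where "y' x = (\<Sum>n. e n x)" for x
  have Dy: "(y has_real_derivative y' x) (at x)" for x
  proof -
    let ?S = "ball (0::real) (\<bar>x\<bar> + 1)"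
    have "((\<lambda>x. \<Sum>n. d n x) has_field_derivative (\<Sum>n. e n x)) (at x)"
      by (rule has_field_derivative_series'(2)[of ?S d e 0])
        (use unif[OF ebd] A0 sums_d in \<open>auto intro: has_field_derivative_at_within Dd\<close>)
    then show ?thesis by (simp add: y_def[abs_def] y'_def)
  qed
  have Dy': "(y' has_real_derivative q x * y x) (at x)" for x
  proof -
    let ?S = "ball (0::real) (\<bar>x\<bar> + 1)"
    have "((\<lambda>x. \<Sum>n. e n x) has_field_derivative (\<Sum>n. g n x)) (at x)"
      by (rule has_field_derivative_series'(2)[of ?S e g 0])
        (use unif[OF gbd] A0 Q0 sums_e in \<open>auto intro: has_field_derivative_at_within De\<close>)
    moreover have "(\<lambda>n. g n x) sums (q x * y x)"
    proof -
      have "(\<lambda>n. g (Suc n) x) sums (q x * y x)"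
        using sums_mult[OF summable_sums[OF sums_d[of x]], of "q x"] by (simp add: g_def y_def)
      then show ?thesis by (subst (asm) sums_Suc_iff) (simp add: g_def)
    qed
    ultimately show ?thesis by (simp add: y'_def[abs_def] sums_iff)
  qed
  have "y 0 = \<alpha>" "y' 0 = \<beta>"
  proof -
    have "(\<lambda>n. d n 0) sums d 0 0" using sums_single[of 0 "\<lambda>n. d n 0"]
      by (rule sums_cong[THEN iffD1, rotated]) (metis d0 not0_implies_Suc)
    then show "y 0 = \<alpha>" by (simp add: y_def sums_iff d_def)
    have "(\<lambda>n. e n 0) sums e 0 0" using sums_single[of 0 "\<lambda>n. e n 0"]
      by (rule sums_cong[THEN iffD1, rotated]) (metis e0 not0_implies_Suc)
    then show "y' 0 = \<beta>" by (simp add: y'_def sums_iff e_def)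
  qed
  with Dy Dy' show ?thesis unfolding hill_sol_def by blast
qed

text \<open>Gronwall for the energy E = y^2 + y'^2, which satisfies |E'| \<le> (1 + Q) E: once zero,
  it stays zero in both directions.\<close>

lemma hill_sol_zero_unique:
  assumes "hill_sol q y y'" and Q: "\<And>x. \<bar>q x\<bar> \<le> Q" and "y x0 = 0" "y' x0 = 0"
  shows "y x = 0"
proof -
  define E where "E x = (y x)\<^sup>2 + (y' x)\<^sup>2" for x
  have DE: "(E has_real_derivative (2 * y x * y' x * (1 + q x))) (at x)" for x
    unfolding E_def
    by (auto intro!: derivative_eq_intros solD[OF assms(1)] simp: algebra_simps)
  have Q0: "Q \<ge> 0" using Q[of 0] by linarith
  have bd: "\<bar>2 * y x * y' x * (1 + q x)\<bar> \<le> (1 + Q) * E x" for x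
  proof -
    have "\<bar>2 * y x * y' x\<bar> \<le> E x"
      using zero_le_power2[of "y x - y' x"] zero_le_power2[of "y x + y' x"]
      unfolding E_def power2_eq_square by (simp add: algebra_simps abs_le_iff)
    moreover have "\<bar>1 + q x\<bar> \<le> 1 + Q" using Q[of x] by linarith
    ultimately have "\<bar>2 * y x * y' x\<bar> * \<bar>1 + q x\<bar> \<le> E x * (1 + Q)"
      by (intro mult_mono) (auto simp: E_def)
    then show ?thesis by (simp add: abs_mult mult.commute)
  qed
  have "E x \<le> 0"
  proof (cases "x \<ge> x0")
    case True
    have "(\<lambda>t. E t * exp (- (1 + Q) * t)) x \<le> (\<lambda>t. E t * exp (- (1 + Q) * t)) x0"
      apply (rule DERIV_nonpos_imp_nonincreasing[OF True])
      subgoal for u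
        apply (rule exI[of _ "(2 * y u * y' u * (1 + q u) - (1 + Q) * E u) * exp (- (1 + Q) * u)"])
        using bd[of u] by (auto intro!: derivative_eq_intros DE simp: mult_le_0_iff) (simp add: algebra_simps)
      done
    then have "E x * exp (- (1 + Q) * x) \<le> 0" by (simp add: E_def assms)
    then show ?thesis by (simp add: mult_le_0_iff)
  next
    case False
    then have "x \<le> x0" by simp
    have "(\<lambda>t. E t * exp ((1 + Q) * t)) x \<le> (\<lambda>t. E t * exp ((1 + Q) * t)) x0"
      apply (rule DERIV_nonneg_imp_nondecreasing[OF \<open>x \<le> x0\<close>])
      subgoal for u
        apply (rule exI[of _ "(2 * y u * y' u * (1 + q u) + (1 + Q) * E u) * exp ((1 + Q) * u)"])
        using bd[of u] by (auto intro!: derivative_eq_intros DE mult_nonneg_nonneg) (simp add: algebra_simps)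
      done
    then have "E x * exp ((1 + Q) * x) \<le> 0" by (simp add: E_def assms)
    then show ?thesis by (simp add: mult_le_0_iff)
  qed
  then show ?thesis unfolding E_def by (simp add: sum_power2_le_zero_iff)
qed

text \<open>Energy estimate for D = z - y, which solves D'' = p D + (p - q) y with zero initial
  data. It serves to make solutions locally Lipschitz in the spectral parameter.\<close>

lemma hill_sol_perturb:
  assumes "hill_sol q y y'" "hill_sol p z z'" and P: "\<And>x. \<bar>p x\<bar> \<le> P"
    and \<eta>: "\<And>x. \<bar>p x - q x\<bar> \<le> \<eta>" and Y: "\<And>x. x \<in> {0..1} \<Longrightarrow> \<bar>y x\<bar> \<le> Y"
    and "y 0 = z 0" "y' 0 = z' 0" and "x \<in> {0..1}"
  shows "\<bar>z x - y x\<bar> \<le> \<eta> * Y * exp (2 + P)" "\<bar>z' x - y' x\<bar> \<le> \<eta> * Y * exp (2 + P)"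
proof -
  define D where "D x = z x - y x" for x
  define D' where "D' x = z' x - y' x" for x
  define G where "G x = (D x)\<^sup>2 + (D' x)\<^sup>2" for x
  define m where "m = (\<eta> * Y)\<^sup>2"
  define k where "k = 2 + P"
  have P0: "P \<ge> 0" using P[of 0] by linarith
  have \<eta>0: "\<eta> \<ge> 0" using \<eta>[of 0] by linarith
  have Y0: "Y \<ge> 0" using Y[of 0] by auto
  have k: "k \<ge> 0" using P0 by (simp add: k_def)
  define G' where "G' x = 2 * D x * D' x * (1 + p x) + 2 * ((p x - q x) * y x) * D' x" for x
  have DG: "(G has_real_derivative G' x) (at x)" for x
    unfolding G_def D_def D'_def G'_def
    by (auto intro!: derivative_eq_intros solD[OF assms(1)] solD[OF assms(2)] simp: algebra_simps)
  have bd: "G' x \<le> k * G x + m" if "x \<in> {0..1}" for x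
  proof -
    have "\<bar>2 * D x * D' x\<bar> \<le> G x"
      using zero_le_power2[of "D x - D' x"] zero_le_power2[of "D x + D' x"]
      unfolding G_def power2_eq_square by (simp add: algebra_simps abs_le_iff)
    moreover have "\<bar>1 + p x\<bar> \<le> 1 + P" using P[of x] by linarith
    ultimately have "\<bar>2 * D x * D' x\<bar> * \<bar>1 + p x\<bar> \<le> G x * (1 + P)"
      by (intro mult_mono) (auto simp: G_def)
    then have 1: "2 * D x * D' x * (1 + p x) \<le> G x * (1 + P)"
      unfolding abs_mult[symmetric] by linarith
    let ?r = "(p x - q x) * y x"
    have "\<bar>?r\<bar> \<le> \<eta> * Y" unfolding abs_mult by (rule mult_mono) (use \<eta> Y that \<eta>0 in auto)
    then have "?r\<^sup>2 \<le> m" using power_mono[of "\<bar>?r\<bar>" "\<eta> * Y" 2] by (simp add: m_def)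
    moreover have "2 * ?r * D' x \<le> ?r\<^sup>2 + (D' x)\<^sup>2" using zero_le_power2[of "?r - D' x"]
      unfolding power2_eq_square by (simp add: algebra_simps)
    ultimately have "2 * ?r * D' x \<le> m + G x" unfolding G_def by (smt (verit) zero_le_power2)
    with 1 show ?thesis unfolding G'_def k_def by (simp add: algebra_simps)
  qed
  have "(\<lambda>t. G t * exp (- k * t) - m * t) x \<le> (\<lambda>t. G t * exp (- k * t) - m * t) 0"
  proof (rule DERIV_nonpos_imp_nonincreasing[where f = "\<lambda>t. G t * exp (- k * t) - m * t"])
    fix u assume u: "0 \<le> u" "u \<le> x"
    then have u': "u \<in> {0..1}" using assms by auto
    have "(G' u - k * G u) * exp (- k * u) \<le> m * 1"
    proof -
      have "(G' u - k * G u) * exp (- k * u) \<le> m * exp (- k * u)"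
        using bd[OF u'] by (intro mult_right_mono) auto
      also have "\<dots> \<le> m * 1" using k u by (intro mult_left_mono) (auto simp: m_def)
      finally show ?thesis .
    qed
    then show "\<exists>w. ((\<lambda>t. G t * exp (- k * t) - m * t) has_real_derivative w) (at u) \<and> w \<le> 0"
      by (intro exI[of _ "(G' u - k * G u) * exp (- k * u) - m"])
        (auto intro!: derivative_eq_intros DG simp: algebra_simps)
  qed (use assms in auto)
  then have "G x * exp (- k * x) \<le> m * x" using assms by (simp add: G_def D_def D'_def)
  also have "\<dots> \<le> m * 1" using assms by (intro mult_left_mono) (auto simp: m_def)
  finally have "G x \<le> m * exp (k * x)" by (simp add: exp_minus field_simps)
  \<comment> \<open>Deliberately generous: with exp (2 k) in place of exp (k x) the bound is a
    perfect square with root \<open>\<eta> * Y * exp k\<close>.\<close>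
  also have "\<dots> \<le> m * (exp k * exp k)"
    using mult_left_le[of x k] k assms by (intro mult_left_mono) (auto simp: m_def simp flip: exp_add)
  also have "\<dots> = (\<eta> * Y * exp k)\<^sup>2" by (simp add: m_def power2_eq_square)
  finally have *: "G x \<le> (\<eta> * Y * exp k)\<^sup>2" .
  have nn: "\<eta> * Y * exp k \<ge> 0" using \<eta>0 Y0 by simp
  have "(D x)\<^sup>2 \<le> (\<eta> * Y * exp k)\<^sup>2" "(D' x)\<^sup>2 \<le> (\<eta> * Y * exp k)\<^sup>2"
    using * zero_le_power2[of "D x"] zero_le_power2[of "D' x"] unfolding G_def by linarith+
  then show "\<bar>z x - y x\<bar> \<le> \<eta> * Y * exp (2 + P)" "\<bar>z' x - y' x\<bar> \<le> \<eta> * Y * exp (2 + P)"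
    unfolding power2_le_iff_abs_le[OF nn] by (simp_all add: D_def D'_def k_def)
qed

lemma hill_sol_continuous:
  assumes "hill_sol q y y'" shows "continuous_on S y" "continuous_on S y'"
  using solD[OF assms] by (meson DERIV_isCont continuous_at_imp_continuous_on)+

section \<open>Wronskian and Sturm-type comparison\<close>

lemma wronskian_const:
  assumes "hill_sol q y y'" "hill_sol q z z'"
  shows "z x * y' x - z' x * y x = z 0 * y' 0 - z' 0 * y 0"
proof -
  have "((\<lambda>x. z x * y' x - z' x * y x) has_real_derivative 0) (at x)" for x
    by (auto intro!: derivative_eq_intros solD[OF assms(1)] solD[OF assms(2)] simp: algebra_simps)
  from DERIV_isconst_all[OF allI[OF this], of x 0] show ?thesis by simp
qed

text \<open>This describes large \<lambda>. As z z' is nondecreasing, z^2 \<ge> 1, so z never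
  vanishes; then (y / z)' = 1 / z^2 makes y positive. The bounds on z and y' force the trace of the
  period map to infinity.\<close>

lemma hill_sol_nonneg_potential:
  assumes z: "hill_sol q z z'" "z 0 = 1" "z' 0 = 0" and y: "hill_sol q y y'" "y 0 = 0" "y' 0 = 1"
    and q: "\<And>x. q x \<ge> \<kappa>" and "\<kappa> \<ge> 0" and "x \<ge> 0"
  shows "z x \<ge> 1 + \<kappa> * x\<^sup>2 / 2" "x > 0 \<Longrightarrow> y x > 0" "y' x \<ge> 1"
proof -
  have q0: "q x \<ge> 0" for x using q[of x] \<open>\<kappa> \<ge> 0\<close> by linarith
  have zz': "z x * z' x \<ge> 0" if "x \<ge> 0" for x
  proof -
    have "(\<lambda>x. z x * z' x) 0 \<le> (\<lambda>x. z x * z' x) x"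
      apply (rule DERIV_nonneg_imp_nondecreasing[OF that])
      subgoal for u
        apply (rule exI[of _ "(z' u)\<^sup>2 + q u * (z u)\<^sup>2"])
        using q0[of u] by (auto intro!: derivative_eq_intros solD[OF z(1)] simp: power2_eq_square)
      done
    then show ?thesis using z by simp
  qed
  have z2: "(z x)\<^sup>2 \<ge> 1" if "x \<ge> 0" for x
  proof -
    have "(\<lambda>x. (z x)\<^sup>2) 0 \<le> (\<lambda>x. (z x)\<^sup>2) x"
      apply (rule DERIV_nonneg_imp_nondecreasing[OF that])
      subgoal for u
        apply (rule exI[of _ "2 * (z u * z' u)"])
        using zz'[of u] by (auto intro!: derivative_eq_intros solD[OF z(1)])
      done
    then show ?thesis using z by simp
  qed
  have z1: "z x \<ge> 1" if "x \<ge> 0" for x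
  proof (rule ccontr)
    assume "\<not> z x \<ge> 1"
    then have "z x < 0" using z2[OF that] abs_square_less_1[of "z x"] by linarith
    then have "\<exists>t\<ge>0. t \<le> x \<and> z t = 0"
      by (intro IVT2' that hill_sol_continuous(1)[OF z(1)]) (use z in auto)
    then obtain t where "t \<ge> 0" "z t = 0" by blast
    then show False using z2[of t] by simp
  qed
  have z': "z' x \<ge> \<kappa> * x" if "x \<ge> 0" for x
  proof -
    have "(\<lambda>x. z' x - \<kappa> * x) 0 \<le> (\<lambda>x. z' x - \<kappa> * x) x"
    proof (rule DERIV_nonneg_imp_nondecreasing[where f = "\<lambda>x. z' x - \<kappa> * x", OF that])
      fix u :: real assume "0 \<le> u"
      have "\<kappa> * 1 \<le> q u * z u" by (rule mult_mono) (use q q0 z1[OF \<open>0 \<le> u\<close>] in auto)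
      then show "\<exists>w. ((\<lambda>x. z' x - \<kappa> * x) has_real_derivative w) (at u) \<and> 0 \<le> w"
        by (intro exI[of _ "q u * z u - \<kappa>"]) (auto intro!: derivative_eq_intros solD[OF z(1)])
    qed
    then show ?thesis using z by simp
  qed
  have "(\<lambda>x. z x - \<kappa> * x\<^sup>2 / 2) 0 \<le> (\<lambda>x. z x - \<kappa> * x\<^sup>2 / 2) x"
    apply (rule DERIV_nonneg_imp_nondecreasing[OF \<open>x \<ge> 0\<close>])
    subgoal for u
      apply (rule exI[of _ "z' u - \<kappa> * u"])
      using z'[of u] by (auto intro!: derivative_eq_intros solD[OF z(1)])
    done
  then show "z x \<ge> 1 + \<kappa> * x\<^sup>2 / 2" using z by simp
  have W: "z x * y' x - z' x * y x = 1" for x using wronskian_const[OF y(1) z(1), of x] z y by simp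
  have ypos: "y x > 0" if "x > 0" for x
  proof -
    have "(\<lambda>x. y x / z x) 0 < (\<lambda>x. y x / z x) x"
    proof (rule DERIV_pos_imp_increasing[where f = "\<lambda>x. y x / z x", OF that])
      fix u :: real assume "0 \<le> u"
      have "z u > 0" using z1[OF \<open>0 \<le> u\<close>] by linarith
      then show "\<exists>w. ((\<lambda>x. y x / z x) has_real_derivative w) (at u) \<and> 0 < w"
        using W[of u]
        by (intro exI[of _ "1 / (z u * z u)"])
          (auto intro!: derivative_eq_intros solD[OF z(1)] solD[OF y(1)] simp: algebra_simps)
    qed
    then show ?thesis using z1[of x] that y by (simp add: zero_less_divide_iff)
  qed
  then show "x > 0 \<Longrightarrow> y x > 0" .
  have "y' 0 \<le> y' x"
  proof (rule DERIV_nonneg_imp_nondecreasing[where f = y', OF \<open>x \<ge> 0\<close>])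
    fix u :: real assume "0 \<le> u"
    then have "y u \<ge> 0" using ypos[of u] y by (cases "u = 0") auto
    then show "\<exists>w. (y' has_real_derivative w) (at u) \<and> 0 \<le> w"
      using q0[of u] by (intro exI[of _ "q u * y u"]) (auto intro!: solD[OF y(1)])
  qed
  then show "y' x \<ge> 1" using y by simp
qed

text \<open>Sturm comparison with sin (pi x), which solves v'' = - pi^2 v. If y were positive on (0,
  1], the Wronskian \<open>W\<close> would decrease strictly from 0, yet
  \<open>W 1 = y 1 * pi\<close> would be positive.\<close>

lemma sturm_zero:
  assumes y: "hill_sol q y y'" "y 0 = 0" and q: "\<And>x. q x < - (pi\<^sup>2)"
  shows "\<exists>x\<in>{0<..1}. y x \<le> 0"
proof (rule ccontr)
  assume "\<not> ?thesis"
  then have pos: "y x > 0" if "0 < x" "x \<le> 1" for x using that by force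
  define W where "W x = y' x * sin (pi * x) - y x * (pi * cos (pi * x))" for x
  have "W 1 < W 0"
  proof (rule DERIV_neg_imp_decreasing_open[where f = W])
    fix x :: real assume x: "0 < x" "x < 1"
    have "sin (pi * x) > 0" by (rule sin_gt_zero) (use x in auto)
    then have "(q x + pi\<^sup>2) * y x * sin (pi * x) < 0"
      using q[of x] pos[of x] x by (intro mult_neg_pos) auto
    then show "\<exists>w. (W has_real_derivative w) (at x) \<and> w < 0" unfolding W_def
      by (intro exI[of _ "(q x + pi\<^sup>2) * y x * sin (pi * x)"])
        (auto intro!: derivative_eq_intros solD[OF y(1)] simp: algebra_simps power2_eq_square)
  next
    show "continuous_on {0..1} W" unfolding W_def by (intro continuous_intros hill_sol_continuous[OF y(1)])
  qed auto
  moreover have "W 0 = 0" using y by (simp add: W_def)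
  moreover have "W 1 = y 1 * pi" by (simp add: W_def)
  ultimately show False using pos[of 1] by (simp add: mult_less_0_iff)
qed

section \<open>Positive Floquet solutions\<close>

text \<open>The period map has rows (Z 1, Y 1) and (Z' 1, Y' 1) and determinant 1, so \<rho> is a
  multiplier exactly when the trace is \<rho> + 1 / \<rho>. The intermediate value theorem is
  applied above \<open>L\<close> because there Y is positive on (0, 1], and this positivity passes
  to the Floquet solution.\<close>

lemma hill_positive_solution:
  fixes q0 w :: "real \<Rightarrow> real"
  assumes q0: "continuous_on UNIV q0" "\<And>x. \<bar>q0 x\<bar> \<le> Q" "\<And>x. q0 (x + 1) = q0 x"
    and w: "continuous_on UNIV w" "\<And>x. w x \<le> W" "\<And>x. w x \<ge> w0" "w0 > 0" "\<And>x. w (x + 1) = w x"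
    and "\<rho> > 0"
  shows "\<exists>l y y'. hill_sol (\<lambda>x. q0 x + l * w x) y y' \<and> (\<forall>x. y x > 0) \<and> (\<forall>x. y (x + 1) = \<rho> * y x)"
proof -
  define q where "q l x = q0 x + l * w x" for l x
  have Q0: "Q \<ge> 0" using q0(2)[of 0] by linarith
  have W0: "W > 0" using w(2)[of 0] w(3)[of 0] w(4) by linarith
  have wW: "\<bar>w x\<bar> \<le> W" for x using w(2)[of x] w(3)[of x] w(4) by linarith
  have q_cont: "continuous_on UNIV (q l)" for l unfolding q_def by (intro continuous_intros q0 w)
  have q_bd: "\<bar>q l x\<bar> \<le> Q + \<bar>l\<bar> * W" for l x
  proof -
    have "\<bar>l * w x\<bar> \<le> \<bar>l\<bar> * W" unfolding abs_mult by (intro mult_left_mono wW) auto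
    then show ?thesis unfolding q_def using q0(2)[of x] by linarith
  qed
  have "\<forall>\<alpha> \<beta> l. \<exists>y y'. hill_sol (q l) y y' \<and> y 0 = \<alpha> \<and> y' 0 = \<beta>"
    by (intro allI hill_sol_exists[OF q_cont q_bd])
  then obtain S S' where "\<forall>\<alpha> \<beta> l. hill_sol (q l) (S \<alpha> \<beta> l) (S' \<alpha> \<beta> l) \<and>
      S \<alpha> \<beta> l 0 = \<alpha> \<and> S' \<alpha> \<beta> l 0 = \<beta>"
    unfolding choice_iff by blast
  then have S: "\<And>l \<alpha> \<beta>. hill_sol (q l) (S \<alpha> \<beta> l) (S' \<alpha> \<beta> l)"
    and Si: "\<And>l \<alpha> \<beta>. S \<alpha> \<beta> l 0 = \<alpha>" "\<And>l \<alpha> \<beta>. S' \<alpha> \<beta> l 0 = \<beta>" by blast+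
  define Y where "Y = S 0 1"
  define Y' where "Y' = S' 0 1"
  define Z where "Z = S 1 0"
  define Z' where "Z' = S' 1 0"
  note YZ_def = Y_def Y'_def Z_def Z'_def
  have Y: "hill_sol (q l) (Y l) (Y' l)" and Yi: "Y l 0 = 0" "Y' l 0 = 1" for l by (simp_all add: YZ_def S Si)
  have Z: "hill_sol (q l) (Z l) (Z' l)" and Zi: "Z l 0 = 1" "Z' l 0 = 0" for l by (simp_all add: YZ_def S Si)
  \<comment> \<open>The constant is uniform in x, as the openness argument at \<open>L\<close>
    requires. Restricting to |m - l| \<le> 1 gives one bound for all the potentials
    \<open>q m\<close> involved.\<close>
  have lip: "\<exists>C\<ge>0. \<forall>m. \<bar>m - l\<bar> \<le> 1 \<longrightarrow> (\<forall>x\<in>{0..1}. \<bar>S \<alpha> \<beta> m x - S \<alpha> \<beta> l x\<bar> \<le> C * \<bar>m - l\<bar> \<and>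
      \<bar>S' \<alpha> \<beta> m x - S' \<alpha> \<beta> l x\<bar> \<le> C * \<bar>m - l\<bar>)" for l \<alpha> \<beta>
  proof -
    have "compact (S \<alpha> \<beta> l ` {0..1})"
      by (intro compact_continuous_image hill_sol_continuous(1)[OF S]) auto
    then obtain K where K: "\<And>x. x \<in> {0..1} \<Longrightarrow> \<bar>S \<alpha> \<beta> l x\<bar> \<le> K"
      by (metis bounded_iff compact_imp_bounded imageI real_norm_def)
    have K0: "K \<ge> 0" using K[of 0] by force
    define P where "P = Q + (\<bar>l\<bar> + 1) * W"
    show ?thesis
    proof (intro exI[of _ "W * K * exp (2 + P)"] conjI allI impI ballI)
      fix m x assume m: "\<bar>m - l\<bar> \<le> 1" and x: "x \<in> {0..1::real}"
      have P: "\<bar>q m x\<bar> \<le> P" for x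
      proof -
        have "\<bar>m\<bar> * W \<le> (\<bar>l\<bar> + 1) * W" using m W0 by (intro mult_right_mono) auto
        with q_bd[of m x] show ?thesis unfolding P_def by linarith
      qed
      have e: "\<bar>q m x - q l x\<bar> \<le> \<bar>m - l\<bar> * W" for x
      proof -
        have "q m x - q l x = (m - l) * w x" by (simp add: q_def algebra_simps)
        then show ?thesis by (simp add: abs_mult wW mult_left_mono)
      qed
      show "\<bar>S \<alpha> \<beta> m x - S \<alpha> \<beta> l x\<bar> \<le> W * K * exp (2 + P) * \<bar>m - l\<bar>"
        using hill_sol_perturb(1)[OF S S P e K _ _ x] by (simp add: Si mult_ac)
      show "\<bar>S' \<alpha> \<beta> m x - S' \<alpha> \<beta> l x\<bar> \<le> W * K * exp (2 + P) * \<bar>m - l\<bar>"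
        using hill_sol_perturb(2)[OF S S P e K _ _ x] by (simp add: Si mult_ac)
    qed (use W0 K0 in auto)
  qed
  have isCont_lip: "isCont f l" if "C \<ge> 0" and C: "\<And>m. \<bar>m - l\<bar> \<le> 1 \<Longrightarrow> \<bar>f m - f l\<bar> \<le> C * \<bar>m - l\<bar>"
    for f :: "real \<Rightarrow> real" and l C
  proof -
    have "((\<lambda>m. C * \<bar>m - l\<bar>) \<longlongrightarrow> C * \<bar>l - l\<bar>) (at l)" by (intro tendsto_intros)
    then have 0: "((\<lambda>m. C * \<bar>m - l\<bar>) \<longlongrightarrow> 0) (at l)" by simp
    have "eventually (\<lambda>m. \<bar>m - l\<bar> \<le> 1) (at l)"
      unfolding eventually_at by (intro exI[of _ 1]) (auto simp: dist_real_def)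
    then have "eventually (\<lambda>m. norm (f m - f l) \<le> C * \<bar>m - l\<bar>) (at l)"
      by eventually_elim (simp add: C)
    from Lim_null_comparison[OF this 0] show ?thesis
      unfolding isCont_def by (simp add: LIM_zero_iff)
  qed
  have cont_S: "isCont (\<lambda>l. S \<alpha> \<beta> l x) l" and cont_S': "isCont (\<lambda>l. S' \<alpha> \<beta> l x) l"
    if "x \<in> {0..1}" for \<alpha> \<beta> x l
  proof -
    from lip[of l \<alpha> \<beta>] obtain C where "C \<ge> 0" and "\<And>m. \<bar>m - l\<bar> \<le> 1 \<Longrightarrow>
       \<bar>S \<alpha> \<beta> m x - S \<alpha> \<beta> l x\<bar> \<le> C * \<bar>m - l\<bar> \<and> \<bar>S' \<alpha> \<beta> m x - S' \<alpha> \<beta> l x\<bar> \<le> C * \<bar>m - l\<bar>"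
      using \<open>x \<in> {0..1}\<close> by blast
    then show "isCont (\<lambda>l. S \<alpha> \<beta> l x) l" "isCont (\<lambda>l. S' \<alpha> \<beta> l x) l"
      by (auto intro!: isCont_lip[of C])
  qed
  have Wr: "Z l x * Y' l x - Z' l x * Y l x = 1" for l x
    using wronskian_const[OF Y Z, of l x] by (simp add: Yi Zi)
  define G where "G l \<longleftrightarrow> (\<forall>x\<in>{0<..1}. Y l x > 0)" for l
  have large: "G l" "Y' l 1 + Z l 1 \<ge> \<kappa> / 2" if l: "l \<ge> (Q + \<kappa>) / w0" and "\<kappa> \<ge> 0" for l \<kappa>
  proof -
    have qk: "q l x \<ge> \<kappa>" for x
    proof -
      have "l \<ge> 0" using l \<open>\<kappa> \<ge> 0\<close> Q0 w(4) by (meson add_nonneg_nonneg divide_nonneg_pos order_trans)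
      have "Q + \<kappa> \<le> l * w0" using l w(4) by (simp add: field_simps)
      also have "\<dots> \<le> l * w x" using \<open>l \<ge> 0\<close> w(3) by (intro mult_left_mono) auto
      finally show ?thesis using q0(2)[of x] by (simp add: q_def abs_le_iff)
    qed
    note * = hill_sol_nonneg_potential[OF Z Zi Y Yi qk \<open>\<kappa> \<ge> 0\<close>]
    show "G l" unfolding G_def using *(2) by auto
    show "Y' l 1 + Z l 1 \<ge> \<kappa> / 2" using *(1)[of 1] *(3)[of 1] by simp
  qed
  define N where "N = {l. \<not> G l}"
  define L where "L = Sup N"
  have "N \<noteq> {}"
  proof -
    define l where "l = - (Q + pi\<^sup>2 + 1) / w0"
    have "q l x < - (pi\<^sup>2)" for x
    proof -
      have "l \<le> 0" unfolding l_def using Q0 w(4) zero_le_power2[of pi] by (intro divide_nonpos_pos) linarith+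
      then have "l * w x \<le> l * w0" using w(3) by (intro mult_left_mono_neg) auto
      also have "\<dots> = - (Q + pi\<^sup>2 + 1)" using w(4) by (simp add: l_def)
      finally show ?thesis using q0(2)[of x] unfolding q_def by linarith
    qed
    from sturm_zero[OF Y Yi(1) this] obtain x where "x \<in> {0<..1}" "Y l x \<le> 0" by blast
    then have "\<not> G l" unfolding G_def by (meson not_le)
    then show ?thesis by (auto simp: N_def)
  qed
  have N_le: "l \<le> (Q + 0) / w0" if "l \<in> N" for l
    using large(1)[of 0 l] that by (force simp: N_def)
  then have bdd: "bdd_above N" by (rule bdd_aboveI)
  have G_above: "G l" if "l > L" for l
  proof (rule ccontr)
    assume "\<not> G l"
    then have "l \<le> L" unfolding L_def by (intro cSup_upper bdd) (simp add: N_def)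
    with that show False by simp
  qed
  have YL_nonneg: "Y L x \<ge> 0" if x: "x \<in> {0..1}" for x
  proof (rule ccontr)
    assume "\<not> ?thesis"
    then have neg: "Y L x < 0" by simp
    then have "x > 0" using Yi[of L] x by (cases "x = 0") auto
    have "((\<lambda>l. Y l x) \<longlongrightarrow> Y L x) (at_right L)"
      using cont_S[OF x, where \<alpha> = 0 and \<beta> = 1 and l = L] unfolding Y_def isCont_def
      by (rule filterlim_mono[OF _ order_refl at_le]) simp
    then have "eventually (\<lambda>l. Y l x < 0) (at_right L)" by (rule order_tendstoD) (rule neg)
    moreover have "eventually (\<lambda>l. l > L) (at_right L)" by (rule eventually_at_right_less)
    ultimately have "eventually (\<lambda>l. l > L \<and> Y l x < 0) (at_right L)" by eventually_elim simp
    then obtain l where "l > L" "Y l x < 0" using eventually_happens' trivial_limit_at_right_real by blast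
    with G_above[of l] \<open>x > 0\<close> x show False unfolding G_def by (metis atLeastAtMost_iff greaterThanAtMost_iff less_asym)
  qed
  \<comment> \<open>Positivity on (0, 1] is an open condition on the parameter although Y vanishes
    at 0: near 0 the derivative stays positive under small changes, and on the rest of the period Y
    has a positive minimum. So \<open>G L\<close> would imply \<open>G m\<close> for some
    \<open>m\<close> in \<open>N\<close> close to \<open>L\<close>.\<close>
  have "\<not> G L"
  proof
    assume GL: "G L"
    obtain C where "C \<ge> 0" and C: "\<And>m x. \<bar>m - L\<bar> \<le> 1 \<Longrightarrow> x \<in> {0..1} \<Longrightarrow>
       \<bar>Y m x - Y L x\<bar> \<le> C * \<bar>m - L\<bar> \<and> \<bar>Y' m x - Y' L x\<bar> \<le> C * \<bar>m - L\<bar>"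
      using lip[of L 0 1] unfolding YZ_def by blast
    have "isCont (Y' L) 0" using hill_sol_continuous(2)[OF Y, of UNIV] by (simp add: continuous_on_eq_continuous_at)
    then have "eventually (\<lambda>x. Y' L x > 1/2) (nhds 0)"
      using Yi[of L] by (intro order_tendstoD) (auto simp: continuous_at tendsto_nhds_iff isCont_def)
    then obtain d0 where "d0 > 0" and d0: "\<And>x. \<bar>x\<bar> < d0 \<Longrightarrow> Y' L x > 1/2"
      unfolding eventually_nhds_metric by (auto simp: dist_real_def)
    define d where "d = min 1 (d0 / 2)"
    have d: "0 < d" "d \<le> 1" "d < d0" using \<open>d0 > 0\<close> by (auto simp: d_def)
    have "\<exists>t\<in>{d..1}. \<forall>x\<in>{d..1}. Y L t \<le> Y L x"
      by (rule continuous_attains_inf) (use d hill_sol_continuous(1)[OF Y] in auto)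
    then obtain t where t: "t \<in> {d..1}" "\<And>x. x \<in> {d..1} \<Longrightarrow> Y L t \<le> Y L x" by blast
    define e where "e = Y L t"
    have e: "e > 0" using GL t d unfolding e_def G_def by auto
    define \<delta> where "\<delta> = min 1 (min (1/2) e / (C + 1))"
    have \<delta>: "\<delta> > 0" using e \<open>C \<ge> 0\<close> by (auto simp: \<delta>_def)
    have "L - \<delta> < Sup N" using \<delta> by (simp add: L_def)
    then obtain m where m: "m \<in> N" "L - \<delta> < m" using less_cSup_iff[OF \<open>N \<noteq> {}\<close> bdd] by blast
    moreover have "m \<le> L" using m(1) cSup_upper[OF _ bdd] by (simp add: L_def)
    ultimately have mL: "\<bar>m - L\<bar> < \<delta>" by simp
    have small: "C * \<bar>m - L\<bar> < min (1/2) e"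
    proof -
      have "\<bar>m - L\<bar> < min (1/2) e / (C + 1)" using mL by (simp add: \<delta>_def)
      then have "(C + 1) * \<bar>m - L\<bar> < min (1/2) e" using \<open>C \<ge> 0\<close> by (simp add: field_simps)
      moreover have "C * \<bar>m - L\<bar> \<le> (C + 1) * \<bar>m - L\<bar>" by (simp add: distrib_right)
      ultimately show ?thesis by linarith
    qed
    have m1: "\<bar>m - L\<bar> \<le> 1" using mL by (simp add: \<delta>_def)
    have "Y m x > 0" if x: "x \<in> {0<..1}" for x
    proof (cases "x \<ge> d")
      case True
      then have "Y L x \<ge> e" using t x by (simp add: e_def)
      with C[OF m1, of x] x small show ?thesis by (simp add: abs_le_iff)
    next
      case False
      have "Y m 0 < Y m x"
      proof (rule DERIV_pos_imp_increasing[where f = "Y m"])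
        fix u assume u: "0 \<le> u" "u \<le> x"
        then have "Y' m u > 0" using C[OF m1, of u] d0[of u] small x False d by (simp add: abs_le_iff)
        then show "\<exists>y. (Y m has_real_derivative y) (at u) \<and> 0 < y" using solD(1)[OF Y] by blast
      qed (use x in auto)
      then show ?thesis by (simp add: Yi)
    qed
    then have "G m" by (simp add: G_def)
    with m(1) show False by (simp add: N_def)
  qed
  then obtain x0 where x0: "x0 \<in> {0<..1}" "Y L x0 \<le> 0" unfolding G_def by force
  then have Yx0: "Y L x0 = 0" using YL_nonneg[of x0] by simp
  \<comment> \<open>An interior zero of the nonnegative function \<open>Y L\<close> is a minimum,
    hence a double zero, and uniqueness makes \<open>Y L\<close> vanish identically.\<close>
  have "x0 = 1"
  proof (rule ccontr)
    assume "x0 \<noteq> 1"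
    define d where "d = min x0 (1 - x0)"
    have "Y' L x0 = 0"
    proof (rule DERIV_local_min[OF solD(1)[OF Y]])
      show "0 < d" using x0 \<open>x0 \<noteq> 1\<close> by (auto simp: d_def)
      show "\<forall>y. \<bar>x0 - y\<bar> < d \<longrightarrow> Y L x0 \<le> Y L y"
        using YL_nonneg x0 unfolding Yx0 d_def by (auto simp: abs_less_iff)
    qed
    then have "Y L x = 0" for x using hill_sol_zero_unique[OF Y q_bd Yx0] by blast
    then have "Y L = (\<lambda>x. 0)" by blast
    then have "Y' L 0 = 0" using solD(1)[OF Y, of L 0] DERIV_const[of 0] DERIV_unique by metis
    then show False by (simp add: Yi)
  qed
  then have YL1: "Y L 1 = 0" using Yx0 by simp
  have "Y' L 1 \<le> 0"
  proof (rule ccontr)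
    assume "\<not> ?thesis"
    then obtain d where "d > 0" and d: "\<And>h. 0 < h \<Longrightarrow> h < d \<Longrightarrow> Y L (1 - h) < Y L 1"
      using DERIV_pos_inc_left[OF solD(1)[OF Y, of L 1]] by auto
    define h where "h = min 1 (d / 2)"
    have "0 < h" "h < d" "h \<le> 1" using \<open>d > 0\<close> by (auto simp: h_def)
    then show False using d[of h] YL_nonneg[of "1 - h"] YL1 by simp
  qed
  \<comment> \<open>Since \<open>Y L 1 = 0\<close>, the determinant is this product. Both diagonal
    entries then have the sign of \<open>Y' L 1\<close>, and the trace is negative.\<close>
  moreover have "Z L 1 * Y' L 1 = 1" using Wr[of L 1] YL1 by simp
  ultimately have TL: "Y' L 1 + Z L 1 < 0"
    using zero_less_mult_iff[of "Z L 1" "Y' L 1"] by linarith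
  define r where "r = \<rho> + 1 / \<rho>"
  have r: "r > 0" using \<open>\<rho> > 0\<close> by (simp add: r_def add_pos_pos)
  \<comment> \<open>Beyond \<open>(Q + 2 * r) / w0\<close> the potential is at least
    \<open>2 * r\<close>, and \<open>large\<close> bounds the trace below by
    \<open>r\<close>.\<close>
  define M where "M = max L ((Q + 2 * r) / w0)"
  have "\<exists>l\<ge>L. l \<le> M \<and> (\<lambda>l. Y' l 1 + Z l 1) l = r"
  proof (rule IVT)
    show "Y' M 1 + Z M 1 \<ge> r" using large(2)[of "2 * r" M] r by (simp add: M_def)
    show "\<forall>x. L \<le> x \<and> x \<le> M \<longrightarrow> isCont (\<lambda>l. Y' l 1 + Z l 1) x"
      unfolding YZ_def by (auto intro!: continuous_intros cont_S cont_S')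
  qed (use TL r in \<open>auto simp: M_def\<close>)
  then obtain l where l: "l \<ge> L" "Y' l 1 + Z l 1 = r" by blast
  then have "l > L" using TL r by (cases "l = L") auto
  then have Ypos: "Y l x > 0" if "0 < x" "x \<le> 1" for x using G_above that by (simp add: G_def)
  \<comment> \<open>The value of \<open>s\<close> gives u 1 = \<rho> * u 0. The matching relation u'
    1 = \<rho> * u' 0 then is the characteristic equation \<rho>^2 - r \<rho> + 1 = 0.\<close>
  define s where "s = (\<rho> - Z l 1) / Y l 1"
  define u where "u x = 1 * Z l x + s * Y l x" for x
  define u' where "u' x = 1 * Z' l x + s * Y' l x" for x
  have u: "hill_sol (q l) u u'" unfolding u_def u'_def by (rule hill_sol_lincomb[OF Z Y])
  have ui: "u 0 = 1" "u' 0 = s" by (simp_all add: u_def u'_def Yi Zi)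
  have Y1: "Y l 1 > 0" using Ypos by simp
  have u1: "u 1 = \<rho>" using Y1 by (simp add: u_def s_def)
  have u'1: "u' 1 = \<rho> * s"
  proof -
    have "\<rho> * (Y' l 1 + Z l 1) = \<rho>\<^sup>2 + 1" unfolding l(2) r_def using \<open>\<rho> > 0\<close>
      by (simp add: field_simps power2_eq_square)
    then have "Z' l 1 * Y l 1 + (\<rho> - Z l 1) * Y' l 1 = \<rho> * (\<rho> - Z l 1)"
      using Wr[of l 1] by (simp add: algebra_simps power2_eq_square)
    then show ?thesis using Y1 unfolding u'_def s_def by (simp add: field_simps)
  qed
  have per: "u (x + 1) = \<rho> * u x" for x
  proof -
    have "hill_sol (q l) (\<lambda>x. u (x + 1) - \<rho> * u x) (\<lambda>x. u' (x + 1) - \<rho> * u' x)"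
    proof -
      have q1: "q l (x + 1) = q l x" for x by (simp add: q_def q0 w)
      have 1: "((\<lambda>x. u (x + 1)) has_real_derivative u' (x + 1)) (at x)" for x
        using solD(1)[OF u, of "x + 1"] by (simp add: DERIV_shift)
      have 2: "((\<lambda>x. u' (x + 1)) has_real_derivative q l x * u (x + 1)) (at x)" for x
        using solD(2)[OF u, of "x + 1"] by (simp add: DERIV_shift q1)
      show ?thesis unfolding hill_sol_def
        by (auto intro!: derivative_eq_intros 1 2 solD[OF u] simp: algebra_simps)
    qed
    from hill_sol_zero_unique[OF this q_bd, of 0 x] show ?thesis by (simp add: ui u1 u'1)
  qed
  have pos01: "u x > 0" if "0 \<le> x" "x \<le> 1" for x
  proof (cases "x = 0")
    case False
    then have "x > 0" using that by simp
    \<comment> \<open>The Wronskian of u and Y is 1, so (u / Y)' = - 1 / Y^2, and the quotient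
      decreases towards its positive value \<rho> / Y at the end of the period.\<close>
    have "u 1 / Y l 1 \<le> u x / Y l x"
    proof (rule DERIV_nonpos_imp_nonincreasing[where f = "\<lambda>x. u x / Y l x", OF that(2)])
      fix t assume t: "x \<le> t" "t \<le> 1"
      have Yt: "Y l t > 0" using t \<open>x > 0\<close> by (intro Ypos) auto
      have W': "u t * Y' l t - u' t * Y l t = 1"
        using wronskian_const[OF Y u, of t] by (simp add: ui Yi)
      show "\<exists>y. ((\<lambda>x. u x / Y l x) has_real_derivative y) (at t) \<and> y \<le> 0"
        using Yt W'
        by (intro exI[of _ "- 1 / (Y l t * Y l t)"])
          (auto intro!: derivative_eq_intros solD[OF u] solD[OF Y] simp: algebra_simps)
    qed
    moreover have "u 1 / Y l 1 > 0" using Y1 \<open>\<rho> > 0\<close> by (simp add: u1)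
    ultimately have "u x / Y l x > 0" by linarith
    then show ?thesis using Ypos[of x] \<open>x > 0\<close> that by (simp add: zero_less_divide_iff)
  qed (simp add: ui)
  have pern: "u (x + real n) = \<rho> ^ n * u x" for x n
  proof (induction n)
    case (Suc n)
    then show ?case using per[of "x + real n"] by (simp add: add_ac mult_ac)
  qed simp
  have "u x > 0" for x
  proof (cases "x \<ge> 0")
    case True
    have "u (frac x + real (nat \<lfloor>x\<rfloor>)) > 0"
      unfolding pern using \<open>\<rho> > 0\<close> frac_ge_0[of x] frac_lt_1[of x] by (intro mult_pos_pos pos01) auto
    moreover have "frac x + real (nat \<lfloor>x\<rfloor>) = x" using True by (simp add: frac_def)
    ultimately show ?thesis by simp
  next
    case False
    have "u (frac x) > 0" using frac_ge_0[of x] frac_lt_1[of x] by (intro pos01) auto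
    moreover have "frac x = x + real (nat (- \<lfloor>x\<rfloor>))" using False by (simp add: frac_def)
    ultimately have "\<rho> ^ nat (- \<lfloor>x\<rfloor>) * u x > 0" by (simp only: pern)
    then show ?thesis using \<open>\<rho> > 0\<close> by (simp add: zero_less_mult_iff)
  qed
  with u per show ?thesis unfolding q_def by blast
qed

section \<open>Positive eigenfunctions\<close>

lemma antiderivative_periodic_increment:
  fixes f F :: "real \<Rightarrow> real"
  assumes "F 0 = 0" "\<And>x. (F has_real_derivative f x) (at x)" "\<And>x. f (x + 1) = f x"
  shows "F (x + 1) = F x + F 1"
proof -
  have "((\<lambda>x. F (x + 1) - F x) has_real_derivative 0) (at x)" for x
  proof -
    have "((\<lambda>x. F (x + 1)) has_real_derivative f x) (at x)"
      using assms(2)[of "x + 1"] by (simp add: DERIV_shift assms(3))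
    from DERIV_diff[OF this assms(2)[of x]] show ?thesis by simp
  qed
  from DERIV_isconst_all[OF allI[OF this], of x 0] assms(1) show ?thesis by simp
qed

lemma periodic_frac:
  fixes f :: "real \<Rightarrow> 'a"
  assumes "\<And>x. f (x + 1) = f x"
  shows "f (frac x) = f x"
proof -
  interpret periodic_fun_simple' f by standard (rule assms)
  show ?thesis unfolding frac_def by (rule minus_of_int)
qed

lemma periodic_attains_max:
  fixes f :: "real \<Rightarrow> real"
  assumes "\<And>x. f (x + 1) = f x" "continuous_on UNIV f"
  obtains x0 where "\<And>x. f x \<le> f x0"
proof -
  have "\<exists>x0\<in>{0..1}. \<forall>x\<in>{0..1}. f x \<le> f x0"
    by (rule continuous_attains_sup) (use assms in \<open>auto intro: continuous_on_subset\<close>)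
  then obtain x0 where x0: "\<And>x. x \<in> {0..1} \<Longrightarrow> f x \<le> f x0" by blast
  have "f x \<le> f x0" for x
    using x0[of "frac x"] frac_ge_0[of x] frac_lt_1[of x] by (simp add: periodic_frac[of f, OF assms(1)])
  then show ?thesis by (rule that)
qed

lemma periodic_bounded:
  fixes f :: "real \<Rightarrow> real"
  assumes "\<And>x. f (x + 1) = f x" "continuous_on UNIV f"
  obtains K where "K > 0" "\<And>x. \<bar>f x\<bar> \<le> K"
proof -
  obtain x0 where "\<And>x. \<bar>f x\<bar> \<le> \<bar>f x0\<bar>"
    using periodic_attains_max[of "\<lambda>x. \<bar>f x\<bar>"] assms by (auto intro: continuous_intros)
  then have "\<bar>f x\<bar> \<le> \<bar>f x0\<bar> + 1" for x by (meson add_increasing2 zero_le_one)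
  then show ?thesis by (intro that[of "\<bar>f x0\<bar> + 1"]) auto
qed

lemma periodic_deriv:
  fixes f :: "real \<Rightarrow> real"
  assumes "\<And>x. f (x + 1) = f x" "\<And>x. (f has_real_derivative f' x) (at x)"
  shows "f' (x + 1) = f' x"
proof -
  have "((\<lambda>x. f (x + 1)) has_real_derivative f' (x + 1)) (at x)"
    using assms(2)[of "x + 1"] by (simp add: DERIV_shift)
  then have "(f has_real_derivative f' (x + 1)) (at x)" by (simp add: assms(1))
  with assms(2)[of x] show ?thesis using DERIV_unique by blast
qed

lemma DERIV_continuous_on_UNIV:
  fixes f :: "real \<Rightarrow> real"
  assumes "\<And>x. (f has_real_derivative f' x) (at x)"
  shows "continuous_on UNIV f"
  using assms by (meson DERIV_isCont continuous_at_imp_continuous_on)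

lemma local_max_second_derivative:
  fixes f :: "real \<Rightarrow> real"
  assumes D: "\<And>x. (f has_real_derivative f' x) (at x)" and D2: "(f' has_real_derivative f'') (at x0)"
    and "d > 0" and le: "\<And>y. \<bar>x0 - y\<bar> < d \<Longrightarrow> f y \<le> f x0"
  shows "f' x0 = 0" "f'' \<le> 0"
proof -
  show 0: "f' x0 = 0" using DERIV_local_max[OF D \<open>d > 0\<close>] le by blast
  show "f'' \<le> 0"
  proof (rule ccontr)
    assume "\<not> f'' \<le> 0"
    then obtain e where "e > 0" and e: "\<And>h. 0 < h \<Longrightarrow> h < e \<Longrightarrow> f' x0 < f' (x0 + h)"
      using DERIV_pos_inc_right[OF D2] by auto
    define h where "h = min d e / 2"
    have h: "0 < h" "h < d" "h < e" using \<open>d > 0\<close> \<open>e > 0\<close> by (auto simp: h_def)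
    have "f x0 < f (x0 + h)"
    proof (rule DERIV_pos_imp_increasing_open[where f = f])
      fix x assume "x0 < x" "x < x0 + h"
      then show "\<exists>y. (f has_real_derivative y) (at x) \<and> 0 < y"
        using D[of x] e[of "x - x0"] 0 h by auto
    qed (use h DERIV_continuous_on_UNIV[OF D] in \<open>auto intro: continuous_on_subset\<close>)
    with le[of "x0 + h"] h show False by simp
  qed
qed

section \<open>Existence of a positive eigenfunction\<close>

text \<open>Maximality of \<open>l\<close> is not part of the notion: positivity of \<phi> implies
  it, as \<open>principal_eigenvalue_eq\<close> shows. All estimates below therefore work with such
  a pair and never with the definite description.\<close>

definition positive_eigenpair ::
  "(real \<Rightarrow> real) \<Rightarrow> (real \<Rightarrow> real) \<Rightarrow> (real \<Rightarrow> real) \<Rightarrow> real \<Rightarrow> real \<Rightarrow>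
   (real \<Rightarrow> real) \<Rightarrow> (real \<Rightarrow> real) \<Rightarrow> (real \<Rightarrow> real) \<Rightarrow> bool"
where
  "positive_eigenpair a b c \<epsilon> l \<phi> \<phi>' \<phi>'' \<longleftrightarrow>
     (\<forall>x. (\<phi> has_real_derivative \<phi>' x) (at x)) \<and> (\<forall>x. (\<phi>' has_real_derivative \<phi>'' x) (at x)) \<and>
     continuous_on UNIV \<phi>'' \<and> (\<forall>x. \<phi> (x + 1) = \<phi> x) \<and> (\<forall>x. \<phi> x > 0) \<and>
     (\<forall>x. \<epsilon> * a x * \<phi>'' x + b x * \<phi>' x + c x * \<phi> x = l * \<phi> x)"

lemma positive_eigenpair_exists:
  assumes Da: "\<And>x. (a has_real_derivative a' x) (at x)" and a': "continuous_on UNIV a'"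
    and Db: "\<And>x. (b has_real_derivative b' x) (at x)" and b': "continuous_on UNIV b'"
    and c: "continuous_on UNIV c"
    and per: "\<And>x. a (x + 1) = a x" "\<And>x. b (x + 1) = b x" "\<And>x. c (x + 1) = c x"
    and a: "\<And>x. a x > 0" and "\<epsilon> > 0"
  shows "\<exists>l \<phi> \<phi>' \<phi>''. positive_eigenpair a b c \<epsilon> l \<phi> \<phi>' \<phi>''"
proof -
  define \<beta> where "\<beta> x = b x / (\<epsilon> * a x)" for x
  define \<beta>' where "\<beta>' x = (b' x * a x - b x * a' x) / (\<epsilon> * (a x * a x))" for x
  define q0 where "q0 x = (\<beta> x)\<^sup>2 / 4 + \<beta>' x / 2 - c x / (\<epsilon> * a x)" for x
  define w where "w x = 1 / (\<epsilon> * a x)" for x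
  note ac = DERIV_continuous_on_UNIV[OF Da] and bc = DERIV_continuous_on_UNIV[OF Db]
  have a0: "a x \<noteq> 0" for x using a[of x] by simp
  have D\<beta>: "(\<beta> has_real_derivative \<beta>' x) (at x)" for x
    unfolding \<beta>_def[abs_def] \<beta>'_def using a0[of x] \<open>\<epsilon> > 0\<close>
    by (auto intro!: derivative_eq_intros Da Db simp: field_simps)
  note \<beta>c = DERIV_continuous_on_UNIV[OF D\<beta>]
  have \<beta>'c: "continuous_on UNIV \<beta>'" unfolding \<beta>'_def[abs_def]
    by (intro continuous_intros a' b' ac bc) (use a0 \<open>\<epsilon> > 0\<close> in auto)
  have q0c: "continuous_on UNIV q0" unfolding q0_def[abs_def]
    by (intro continuous_intros \<beta>c \<beta>'c c ac) (use a0 \<open>\<epsilon> > 0\<close> in auto)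
  have wc: "continuous_on UNIV w" unfolding w_def[abs_def]
    by (intro continuous_intros ac) (use a0 \<open>\<epsilon> > 0\<close> in auto)
  have q0p: "q0 (x + 1) = q0 x" and wp: "w (x + 1) = w x" and \<beta>p: "\<beta> (x + 1) = \<beta> x" for x
    unfolding q0_def w_def \<beta>_def \<beta>'_def
    by (simp_all add: per periodic_deriv[OF per(1) Da] periodic_deriv[OF per(2) Db])
  obtain Q where Q: "\<And>x. \<bar>q0 x\<bar> \<le> Q" using periodic_bounded[OF q0p q0c] by metis
  obtain W where W: "\<And>x. \<bar>w x\<bar> \<le> W" using periodic_bounded[OF wp wc] by metis
  then have W': "w x \<le> W" for x by (meson abs_le_D1)
  obtain A where A: "A > 0" "\<And>x. \<bar>a x\<bar> \<le> A" using periodic_bounded[OF per(1) ac] by metis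
  have w0: "1 / (\<epsilon> * A) \<le> w x" for x
    unfolding w_def using a[of x] A(2)[of x] \<open>\<epsilon> > 0\<close> by (intro divide_left_mono mult_left_mono) (auto simp: A(1))
  have w0': "1 / (\<epsilon> * A) > 0" using A \<open>\<epsilon> > 0\<close> by simp
  obtain B where B0: "B 0 = 0" and DB: "\<And>x. (B has_real_derivative \<beta> x) (at x)"
    using exists_antiderivative[OF \<beta>c] by blast
  have Bp: "B (x + 1) = B x + B 1" for x
    by (rule antiderivative_periodic_increment[OF B0 DB \<beta>p])
  obtain l y y' where y: "hill_sol (\<lambda>x. q0 x + l * w x) y y'" "\<And>x. y x > 0"
      "\<And>x. y (x + 1) = exp (B 1 / 2) * y x"
    using hill_positive_solution[OF q0c Q q0p wc W' w0 w0' wp, of "exp (B 1 / 2)"] by auto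
  define \<phi> where "\<phi> x = exp (- B x / 2) * y x" for x
  define \<phi>' where "\<phi>' x = exp (- B x / 2) * (y' x - \<beta> x / 2 * y x)" for x
  define \<phi>'' where "\<phi>'' x = exp (- B x / 2) *
     ((q0 x + l * w x) * y x - \<beta> x * y' x + ((\<beta> x)\<^sup>2 / 4 - \<beta>' x / 2) * y x)" for x
  have D1: "(\<phi> has_real_derivative \<phi>' x) (at x)" for x
    unfolding \<phi>_def[abs_def] \<phi>'_def
    by (auto intro!: derivative_eq_intros solD[OF y(1)] DB simp: algebra_simps)
  have D2: "(\<phi>' has_real_derivative \<phi>'' x) (at x)" for x
    unfolding \<phi>'_def[abs_def] \<phi>''_def
    by (auto intro!: derivative_eq_intros solD[OF y(1)] DB D\<beta> simp: field_simps power2_eq_square)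
  have C: "continuous_on UNIV \<phi>''"
    unfolding \<phi>''_def[abs_def]
    by (intro continuous_intros q0c wc \<beta>c \<beta>'c DERIV_continuous_on_UNIV[OF DB] hill_sol_continuous[OF y(1)])
      auto
  have P: "\<phi> (x + 1) = \<phi> x" for x
  proof -
    have "exp (- (B x + B 1) / 2) * exp (B 1 / 2) = exp (- B x / 2)" by (simp flip: exp_add add: field_simps)
    then show ?thesis unfolding \<phi>_def Bp y(3) by (simp add: mult.assoc[symmetric])
  qed
  have eq: "\<epsilon> * a x * \<phi>'' x + b x * \<phi>' x + c x * \<phi> x = l * \<phi> x" for x
  proof -
    have b: "b x = \<epsilon> * a x * \<beta> x" using a0[of x] \<open>\<epsilon> > 0\<close> by (simp add: \<beta>_def)
    have c: "c x = \<epsilon> * a x * ((\<beta> x)\<^sup>2 / 4 + \<beta>' x / 2 - q0 x)" using a0[of x] \<open>\<epsilon> > 0\<close> by (simp add: q0_def)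
    have l: "l = \<epsilon> * a x * (l * w x)" using a0[of x] \<open>\<epsilon> > 0\<close> by (simp add: w_def)
    have "\<epsilon> * a x * \<phi>'' x + b x * \<phi>' x + c x * \<phi> x = \<epsilon> * a x * (l * w x) * \<phi> x"
      unfolding b c unfolding \<phi>_def \<phi>'_def \<phi>''_def by (simp add: algebra_simps power2_eq_square)
    then show ?thesis using l by simp
  qed
  have "\<phi> x > 0" for x unfolding \<phi>_def using y(2) by simp
  with D1 D2 C P eq show ?thesis unfolding positive_eigenpair_def by blast
qed

section \<open>Dominance over all complex eigenvalues\<close>

lemma second_derivative_quotient:
  fixes P \<phi> :: "real \<Rightarrow> real"
  assumes "\<And>x. (P has_real_derivative P' x) (at x)" "\<And>x. (P' has_real_derivative P'' x) (at x)"
    and "\<And>x. (\<phi> has_real_derivative \<phi>' x) (at x)" "\<And>x. (\<phi>' has_real_derivative \<phi>'' x) (at x)"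
    and "\<And>x. \<phi> x \<noteq> 0"
  defines "p \<equiv> (\<lambda>x. P x / \<phi> x)" and "p' \<equiv> (\<lambda>x. (P' x - P x / \<phi> x * \<phi>' x) / \<phi> x)"
  shows "(p has_real_derivative p' x) (at x)"
    and "(p' has_real_derivative (P'' x - 2 * p' x * \<phi>' x - p x * \<phi>'' x) / \<phi> x) (at x)"
proof -
  show D: "(p has_real_derivative p' x) (at x)" for x
    unfolding p_def p'_def using assms(5)[of x]
    by (auto intro!: derivative_eq_intros assms(1-4) simp: field_simps)
  have "p' = (\<lambda>x. (P' x - p x * \<phi>' x) / \<phi> x)" by (simp add: p_def p'_def)
  moreover have "((\<lambda>x. (P' x - p x * \<phi>' x) / \<phi> x) has_real_derivative
     (P'' x - 2 * ((P' x - p x * \<phi>' x) / \<phi> x) * \<phi>' x - p x * \<phi>'' x) / \<phi> x) (at x)"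
    using assms(5)[of x]
    by (auto intro!: derivative_eq_intros assms(1-4) D simp: p'_def p_def field_simps)
  ultimately show "(p' has_real_derivative (P'' x - 2 * p' x * \<phi>' x - p x * \<phi>'' x) / \<phi> x) (at x)"
    by simp
qed

text \<open>P and R are the real and imaginary parts of an eigenfunction with eigenvalue \<mu> + i
  \<eta>. Division by \<phi> turns the zeroth order coefficient into the constant l, so the squared
  modulus m of the quotient satisfies \<epsilon> a m'' + B m' \<ge> 2 (\<mu> - l) m, and the maximum
  principle gives \<mu> \<le> l.\<close>

lemma positive_eigenpair_dominates:
  assumes ep: "positive_eigenpair a b c \<epsilon> l \<phi> \<phi>' \<phi>''"
    and ac: "continuous_on UNIV a" and bc: "continuous_on UNIV b"
    and a: "\<And>x. a x > 0" and "\<epsilon> > 0"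
    and P: "\<And>x. (P has_real_derivative P' x) (at x)" "\<And>x. (P' has_real_derivative P'' x) (at x)"
    and R: "\<And>x. (R has_real_derivative R' x) (at x)" "\<And>x. (R' has_real_derivative R'' x) (at x)"
    and per: "\<And>x. P (x + 1) = P x" "\<And>x. R (x + 1) = R x"
    and nz: "P z \<noteq> 0 \<or> R z \<noteq> 0"
    and eqP: "\<And>x. \<epsilon> * a x * P'' x + b x * P' x + c x * P x = \<mu> * P x - \<eta> * R x"
    and eqR: "\<And>x. \<epsilon> * a x * R'' x + b x * R' x + c x * R x = \<mu> * R x + \<eta> * P x"
  shows "\<mu> \<le> l" "\<mu> = l \<Longrightarrow> \<eta> = 0"
proof -
  have \<phi>: "\<And>x. (\<phi> has_real_derivative \<phi>' x) (at x)" "\<And>x. (\<phi>' has_real_derivative \<phi>'' x) (at x)"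
    and \<phi>per: "\<And>x. \<phi> (x + 1) = \<phi> x" and pos: "\<And>x. \<phi> x > 0"
    and eq: "\<And>x. \<epsilon> * a x * \<phi>'' x + b x * \<phi>' x + c x * \<phi> x = l * \<phi> x"
    using ep unfolding positive_eigenpair_def by auto
  have \<phi>0: "\<phi> x \<noteq> 0" for x using pos[of x] by simp
  define p where "p x = P x / \<phi> x" for x
  define r where "r x = R x / \<phi> x" for x
  define p' where "p' x = (P' x - P x / \<phi> x * \<phi>' x) / \<phi> x" for x
  define r' where "r' x = (R' x - R x / \<phi> x * \<phi>' x) / \<phi> x" for x
  define p'' where "p'' x = (P'' x - 2 * p' x * \<phi>' x - p x * \<phi>'' x) / \<phi> x" for x
  define r'' where "r'' x = (R'' x - 2 * r' x * \<phi>' x - r x * \<phi>'' x) / \<phi> x" for x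
  define B where "B x = b x + 2 * \<epsilon> * a x * \<phi>' x / \<phi> x" for x
  have p: "(p has_real_derivative p' x) (at x)" "(p' has_real_derivative p'' x) (at x)" for x
    using second_derivative_quotient[OF P \<phi> \<phi>0, of x] unfolding p_def[abs_def] p'_def[abs_def] p''_def by auto
  have r: "(r has_real_derivative r' x) (at x)" "(r' has_real_derivative r'' x) (at x)" for x
    using second_derivative_quotient[OF R \<phi> \<phi>0, of x] unfolding r_def[abs_def] r'_def[abs_def] r''_def by auto
  \<comment> \<open>Conjugation by \<phi>: if F = f \<phi>, then L F = \<phi> (\<epsilon> a f'' + B
    f' + l f). The pointwise form serves the real and the imaginary part alike.\<close>
  have aux: "\<epsilon> * a x * ((F'' - 2 * f' * \<phi>' x - f * \<phi>'' x) / \<phi> x) + B x * f' = h / \<phi> x - l * f"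
    if "F = f * \<phi> x" "F' = f' * \<phi> x + f * \<phi>' x" "\<epsilon> * a x * F'' + b x * F' + c x * F = h"
    for F F' F'' f f' h x
  proof -
    have "\<epsilon> * a x * (F'' - 2 * f' * \<phi>' x - f * \<phi>'' x) + (b x + 2 * \<epsilon> * a x * \<phi>' x / \<phi> x) * f' * \<phi> x
        = (\<epsilon> * a x * F'' + b x * F' + c x * F) - f * (\<epsilon> * a x * \<phi>'' x + b x * \<phi>' x + c x * \<phi> x)"
      unfolding that(1,2) using \<phi>0[of x] by (simp add: field_simps)
    moreover define K where "K = F'' - 2 * f' * \<phi>' x - f * \<phi>'' x"
    ultimately have "\<epsilon> * a x * K + B x * f' * \<phi> x = h - f * (l * \<phi> x)"
      unfolding that(3) eq B_def by simp
    then show ?thesis unfolding K_def[symmetric] using \<phi>0[of x] by (simp add: field_simps)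
  qed
  have P_eq: "P x = p x * \<phi> x" "P' x = p' x * \<phi> x + p x * \<phi>' x"
    and R_eq: "R x = r x * \<phi> x" "R' x = r' x * \<phi> x + r x * \<phi>' x" for x
    using \<phi>0[of x] by (auto simp: p_def p'_def r_def r'_def)
  have eqp: "\<epsilon> * a x * p'' x + B x * p' x = (\<mu> - l) * p x - \<eta> * r x" for x
    using aux[OF P_eq eqP, of x] unfolding p''_def
    by (simp add: p_def r_def diff_divide_distrib left_diff_distrib)
  have eqr: "\<epsilon> * a x * r'' x + B x * r' x = (\<mu> - l) * r x + \<eta> * p x" for x
    using aux[OF R_eq eqR, of x] unfolding r''_def
    by (simp add: p_def r_def add_divide_distrib diff_divide_distrib left_diff_distrib)
  define m where "m x = (p x)\<^sup>2 + (r x)\<^sup>2" for x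
  define m' where "m' x = 2 * (p x * p' x + r x * r' x)" for x
  define m'' where "m'' x = 2 * (p x * p'' x + r x * r'' x + (p' x)\<^sup>2 + (r' x)\<^sup>2)" for x
  have Dm: "(m has_real_derivative m' x) (at x)" for x
    unfolding m_def[abs_def] m'_def by (auto intro!: derivative_eq_intros p r simp: algebra_simps)
  have Dm': "(m' has_real_derivative m'' x) (at x)" for x
    unfolding m'_def[abs_def] m''_def
    by (auto intro!: derivative_eq_intros p r simp: algebra_simps power2_eq_square)
  have eqm: "\<epsilon> * a x * m'' x + B x * m' x
      = 2 * (\<mu> - l) * m x + 2 * \<epsilon> * a x * ((p' x)\<^sup>2 + (r' x)\<^sup>2)" for x
  proof -
    have "\<epsilon> * a x * m'' x + B x * m' x = 2 * p x * (\<epsilon> * a x * p'' x + B x * p' x)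
       + 2 * r x * (\<epsilon> * a x * r'' x + B x * r' x) + 2 * \<epsilon> * a x * ((p' x)\<^sup>2 + (r' x)\<^sup>2)"
      unfolding m'_def m''_def by (simp add: algebra_simps)
    then show ?thesis unfolding eqp eqr m_def by (simp add: algebra_simps power2_eq_square)
  qed
  have mper: "m (x + 1) = m x" for x by (simp add: m_def p_def r_def per \<phi>per)
  obtain x0 where x0: "\<And>x. m x \<le> m x0"
    using periodic_attains_max[OF mper DERIV_continuous_on_UNIV[OF Dm]] by blast
  have "m z > 0" using nz \<phi>0[of z] unfolding m_def p_def r_def
    by (auto simp: sum_power2_gt_zero_iff)
  then have mx0: "m x0 > 0" using x0[of z] by linarith
  have max: "m' x0 = 0" "m'' x0 \<le> 0"
    using local_max_second_derivative[OF Dm Dm', of 1] x0 by auto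
  have "\<epsilon> * a x0 * m'' x0 \<le> 0" using a[of x0] \<open>\<epsilon> > 0\<close> max by (simp add: mult_nonneg_nonpos)
  moreover have "2 * \<epsilon> * a x0 * ((p' x0)\<^sup>2 + (r' x0)\<^sup>2) \<ge> 0" using a[of x0] \<open>\<epsilon> > 0\<close> by simp
  ultimately have "(\<mu> - l) * m x0 \<le> 0"
    using eqm[of x0] unfolding max(1) mult_zero_right mult.assoc by linarith
  then show "\<mu> \<le> l" using mx0 by (simp add: mult_le_0_iff)
  \<comment> \<open>Strong maximum principle in one dimension. With the integrating factor exp E the
    equation becomes (exp E m')' \<ge> 0. Since m' vanishes at x0 and, by periodicity, at x0 + 1, it
    vanishes in between, so that p and r are constant there and their equations reduce to \<eta> p =
    \<eta> r = 0.\<close>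
  show "\<eta> = 0" if "\<mu> = l"
  proof -
    have a0: "a x \<noteq> 0" for x using a[of x] by simp
    have "continuous_on UNIV (\<lambda>x. B x / (\<epsilon> * a x))"
      unfolding B_def using a0 \<phi>0 \<open>\<epsilon> > 0\<close>
      by (intro continuous_intros ac bc DERIV_continuous_on_UNIV[OF \<phi>(1)] DERIV_continuous_on_UNIV[OF \<phi>(2)]) auto
    then obtain E where E: "\<And>x. (E has_real_derivative B x / (\<epsilon> * a x)) (at x)"
      using exists_antiderivative by blast
    define J where "J x = exp (E x) * m' x" for x
    define J' where "J' x = exp (E x) * (2 * ((p' x)\<^sup>2 + (r' x)\<^sup>2))" for x
    have DJ: "(J has_real_derivative J' x) (at x)" for x
    proof -
      have ea: "\<epsilon> * a x \<noteq> 0" using a0[of x] \<open>\<epsilon> > 0\<close> by simp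
      have "(\<epsilon> * a x) * (m'' x + B x / (\<epsilon> * a x) * m' x) = \<epsilon> * a x * m'' x + B x * m' x"
        using ea by (simp add: distrib_left)
      also have "\<dots> = (\<epsilon> * a x) * (2 * ((p' x)\<^sup>2 + (r' x)\<^sup>2))"
        unfolding eqm that by simp
      finally have *: "m'' x + B x / (\<epsilon> * a x) * m' x = 2 * ((p' x)\<^sup>2 + (r' x)\<^sup>2)"
        unfolding mult_left_cancel[OF ea] .
      have "exp (E x) * (B x / (\<epsilon> * a x)) * m' x + m'' x * exp (E x) = J' x"
        unfolding J'_def *[symmetric] by (simp only: distrib_left mult_ac add.commute)
      then show ?thesis unfolding J_def[abs_def] using DERIV_mult[OF DERIV_fun_exp[OF E] Dm', of x] by simp
    qed
    have J'nn: "J' x \<ge> 0" for x by (simp add: J'_def)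
    have mono: "J x \<le> J y" if "x \<le> y" for x y
      by (rule DERIV_nonneg_imp_nondecreasing[OF that]) (use DJ J'nn in blast)
    have Jends: "J x0 = 0" "J (x0 + 1) = 0"
      using max(1) periodic_deriv[OF mper Dm, of x0] by (simp_all add: J_def)
    have J0: "J x = 0" if "x \<in> {x0..x0+1}" for x
      using mono[of x0 x] mono[of x "x0 + 1"] Jends that by auto
    have zero_deriv: "g' = 0" if "(g has_real_derivative g') (at x)" "x \<in> {x0<..<x0+1}"
      "\<And>y. y \<in> {x0<..<x0+1} \<Longrightarrow> g y = 0" for g :: "real \<Rightarrow> real" and g' x
    proof -
      have "((\<lambda>_. 0) has_real_derivative g') (at x)"
        using that by (subst DERIV_cong_ev[OF refl _ refl, of _ g])
          (auto intro: eventually_nhds_in_open[of "{x0<..<x0+1}", THEN eventually_mono])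
      then show ?thesis using DERIV_const DERIV_unique by blast
    qed
    have J'0: "J' x = 0" if "x \<in> {x0<..<x0+1}" for x
      by (rule zero_deriv[OF DJ that]) (use J0 in auto)
    have pr: "p' x = 0" "r' x = 0" if "x \<in> {x0<..<x0+1}" for x
    proof -
      have "(p' x)\<^sup>2 + (r' x)\<^sup>2 = 0"
        using J'0[OF that] unfolding J'_def mult_eq_0_iff by simp
      then show "p' x = 0" "r' x = 0" by (simp_all add: sum_power2_eq_zero_iff)
    qed
    define x1 where "x1 = x0 + 1 / 2"
    have x1: "x1 \<in> {x0<..<x0+1}" by (simp add: x1_def)
    have "p'' x1 = 0" "r'' x1 = 0"
      by (rule zero_deriv[OF p(2) x1 pr(1)], assumption) (rule zero_deriv[OF r(2) x1 pr(2)], assumption)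
    then have "\<eta> * p x1 = 0" "\<eta> * r x1 = 0" using eqp[of x1] eqr[of x1] pr[OF x1] that by simp_all
    moreover have "m x1 = m x0"
    proof -
      have "m x0 \<le> m x1"
      proof (rule DERIV_nonneg_imp_nondecreasing[where f = m])
        fix x assume "x0 \<le> x" "x \<le> x1"
        then have "J x = 0" by (intro J0) (auto simp: x1_def)
        then show "\<exists>y. (m has_real_derivative y) (at x) \<and> 0 \<le> y"
          using Dm[of x] by (auto simp: J_def)
      qed (simp add: x1_def)
      with x0[of x1] show ?thesis by simp
    qed
    moreover have "p x1 \<noteq> 0 \<or> r x1 \<noteq> 0" using mx0 calculation unfolding m_def by auto
    ultimately show "\<eta> = 0" by auto
  qed
qed

lemma C_k_circleD:
  fixes f :: "real \<Rightarrow> 'a::real_normed_vector"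
  assumes "C_k_circle k f"
  shows "f (x + 1) = f x" "continuous_on UNIV (nth_derivative k f)"
    and "j < k \<Longrightarrow> (nth_derivative j f has_vector_derivative nth_derivative (Suc j) f x) (at x)"
proof -
  from assms have p: "periodic_fun_simple' f" and *: "\<And>j x. j < k \<Longrightarrow> nth_derivative j f differentiable at x"
    and c: "continuous_on UNIV (nth_derivative k f)"
    unfolding C_k_circle_def C_k_on_def by auto
  show "f (x + 1) = f x" using p by (simp add: periodic_fun_simple'_def)
  show "continuous_on UNIV (nth_derivative k f)" by fact
  show "(nth_derivative j f has_vector_derivative nth_derivative (Suc j) f x) (at x)" if "j < k"
    using *[OF that, of x] unfolding nth_derivative_def by (simp add: vector_derivative_works)
qed

lemma C_2_circleI:
  fixes f :: "real \<Rightarrow> 'a::real_normed_vector"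
  assumes "\<And>x. f (x + 1) = f x" "\<And>x. (f has_vector_derivative f' x) (at x)"
    "\<And>x. (f' has_vector_derivative f'' x) (at x)" "continuous_on UNIV f''"
  shows "C_k_circle 2 f" "nth_derivative 1 f = f'" "nth_derivative 2 f = f''"
proof -
  have 0: "nth_derivative 0 f = f" by (simp add: nth_derivative_def)
  show 1: "nth_derivative 1 f = f'"
    by (auto simp: nth_derivative_def fun_eq_iff vector_derivative_at[OF assms(2)])
  show 2: "nth_derivative 2 f = f''"
    by (auto simp: nth_derivative_def numeral_2_eq_2 fun_eq_iff vector_derivative_at[OF assms(2)]
      vector_derivative_at[OF assms(3)])
  have "nth_derivative j f differentiable at x" if "j < 2" for j x
  proof -
    from that consider "j = 0" | "j = 1" by linarith
    then show ?thesis using 0 1 assms(2,3) by cases (auto intro: differentiableI_vector)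
  qed
  moreover have "periodic_fun_simple' f" by standard (rule assms)
  ultimately show "C_k_circle 2 f" unfolding C_k_circle_def C_k_on_def 2 using assms(4) by blast
qed

text \<open>The definite description needs a unique maximiser among complex eigenvalues. A
  competitor with real part l is real by the equality case of
  \<open>positive_eigenpair_dominates\<close>; without that case a conjugate pair could share the
  maximal real part.\<close>

lemma principal_eigenvalue_eq:
  assumes ep: "positive_eigenpair a b c \<epsilon> l \<phi> \<phi>' \<phi>''"
    and ac: "continuous_on UNIV a" and bc: "continuous_on UNIV b"
    and a: "\<And>x. a x > 0" and "\<epsilon> > 0"
  shows "principal_eigenvalue a b c \<epsilon> = complex_of_real l"
proof -
  have \<phi>: "\<And>x. (\<phi> has_real_derivative \<phi>' x) (at x)" "\<And>x. (\<phi>' has_real_derivative \<phi>'' x) (at x)"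
    and \<phi>per: "\<And>x. \<phi> (x + 1) = \<phi> x" and pos: "\<And>x. \<phi> x > 0"
    and eq: "\<And>x. \<epsilon> * a x * \<phi>'' x + b x * \<phi>' x + c x * \<phi> x = l * \<phi> x"
    and \<phi>''c: "continuous_on UNIV \<phi>''"
    using ep unfolding positive_eigenpair_def by auto
  have ev: "is_eigenvalue a b c \<epsilon> (complex_of_real l)"
  proof -
    define u where "u x = complex_of_real (\<phi> x)" for x
    have u: "C_k_circle 2 u" "nth_derivative 1 u = (\<lambda>x. complex_of_real (\<phi>' x))"
      "nth_derivative 2 u = (\<lambda>x. complex_of_real (\<phi>'' x))"
      unfolding u_def[abs_def]
      by (rule C_2_circleI[where f' = "\<lambda>x. complex_of_real (\<phi>' x)" and f'' = "\<lambda>x. complex_of_real (\<phi>'' x)"]; use \<phi> \<phi>per \<phi>''c in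
        \<open>auto simp: has_real_derivative_iff_has_vector_derivative intro!: has_vector_derivative_of_real continuous_intros\<close>)+
    have "L_op a b c \<epsilon> u x = complex_of_real l * u x" for x
      unfolding L_op_def u(2,3) u_def scaleR_conv_of_real of_real_mult[symmetric] of_real_add[symmetric] eq ..
    moreover have "u 0 \<noteq> 0" using pos[of 0] by (simp add: u_def)
    ultimately show ?thesis unfolding is_eigenvalue_def using u(1) by blast
  qed
  have dom: "Re \<nu> \<le> l \<and> (Re \<nu> = l \<longrightarrow> Im \<nu> = 0)" if "is_eigenvalue a b c \<epsilon> \<nu>" for \<nu>
  proof -
    from that obtain u z where u: "C_k_circle 2 u" "u z \<noteq> 0" "\<And>x. L_op a b c \<epsilon> u x = \<nu> * u x"
      unfolding is_eigenvalue_def by blast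
    define u' where "u' = nth_derivative 1 u"
    define u'' where "u'' = nth_derivative 2 u"
    have Du: "(u has_vector_derivative u' x) (at x)" for x
      using C_k_circleD(3)[OF u(1), of 0 x] by (simp add: u'_def nth_derivative_def)
    have Du': "(u' has_vector_derivative u'' x) (at x)" for x
      using C_k_circleD(3)[OF u(1), of 1 x] by (simp add: u'_def u''_def numeral_2_eq_2)
    have re: "((\<lambda>x. Re (f x)) has_real_derivative Re v) (at x)"
      and im: "((\<lambda>x. Im (f x)) has_real_derivative Im v) (at x)"
      if "(f has_vector_derivative v) (at x)" for f v x
      using bounded_linear.has_vector_derivative[OF bounded_linear_Re that]
        bounded_linear.has_vector_derivative[OF bounded_linear_Im that]
      by (simp_all add: has_real_derivative_iff_has_vector_derivative)
    have L: "(\<epsilon> * a x) *\<^sub>R u'' x + b x *\<^sub>R u' x + c x *\<^sub>R u x = \<nu> * u x" for x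
      using u(3)[of x] by (simp add: L_op_def u'_def u''_def)
    note dominates = positive_eigenpair_dominates[OF ep ac bc a \<open>\<epsilon> > 0\<close>,
        where P = "\<lambda>x. Re (u x)" and P' = "\<lambda>x. Re (u' x)" and P'' = "\<lambda>x. Re (u'' x)"
        and R = "\<lambda>x. Im (u x)" and R' = "\<lambda>x. Im (u' x)" and R'' = "\<lambda>x. Im (u'' x)"
        and z = z and \<mu> = "Re \<nu>" and \<eta> = "Im \<nu>",
        OF re[OF Du] re[OF Du'] im[OF Du] im[OF Du']]
    have "\<epsilon> * a x * Re (u'' x) + b x * Re (u' x) + c x * Re (u x) = Re \<nu> * Re (u x) - Im \<nu> * Im (u x)" for x
      using arg_cong[OF L[of x], of Re] by simp
    moreover have "\<epsilon> * a x * Im (u'' x) + b x * Im (u' x) + c x * Im (u x) = Re \<nu> * Im (u x) + Im \<nu> * Re (u x)" for x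
      using arg_cong[OF L[of x], of Im] by simp
    moreover have "Re (u z) \<noteq> 0 \<or> Im (u z) \<noteq> 0" using u(2) by (simp add: complex_eq_iff)
    ultimately show ?thesis
      using dominates C_k_circleD(1)[OF u(1)] by auto
  qed
  show ?thesis unfolding principal_eigenvalue_def
  proof (rule the_equality)
    show "is_eigenvalue a b c \<epsilon> (complex_of_real l) \<and>
      (\<forall>\<nu>. is_eigenvalue a b c \<epsilon> \<nu> \<longrightarrow> Re \<nu> \<le> Re (complex_of_real l))"
      using ev dom by auto
    fix \<mu> assume \<mu>: "is_eigenvalue a b c \<epsilon> \<mu> \<and> (\<forall>\<nu>. is_eigenvalue a b c \<epsilon> \<nu> \<longrightarrow> Re \<nu> \<le> Re \<mu>)"
    with ev have "l \<le> Re \<mu>" by force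
    with dom[of \<mu>] \<mu> show "\<mu> = complex_of_real l" by (simp add: complex_eq_iff)
  qed
qed

section \<open>Comparison with super- and subsolutions\<close>

lemma positive_eigenpairD:
  assumes "positive_eigenpair a b c \<epsilon> l \<phi> \<phi>' \<phi>''"
  shows "(\<phi> has_real_derivative \<phi>' x) (at x)" "(\<phi>' has_real_derivative \<phi>'' x) (at x)"
    "\<phi> (x + 1) = \<phi> x" "\<phi> x > 0" "\<epsilon> * a x * \<phi>'' x + b x * \<phi>' x + c x * \<phi> x = l * \<phi> x"
  using assms unfolding positive_eigenpair_def by auto

text \<open>The left-hand side of the last assumption is \<open>L(exp h) / exp h\<close>.\<close>

lemma positive_eigenpair_le:
  assumes ep: "positive_eigenpair a b c \<epsilon> l \<phi> \<phi>' \<phi>''"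
    and "\<And>x. a x > 0" "\<epsilon> > 0"
    and h: "\<And>x. (h has_real_derivative h' x) (at x)" "\<And>x. (h' has_real_derivative h'' x) (at x)"
    and per: "\<And>x. h (x + 1) = h x"
    and K: "\<And>x. \<epsilon> * a x * (h'' x + (h' x)\<^sup>2) + b x * h' x + c x \<le> K"
  shows "l \<le> K"
proof -
  note \<phi> = positive_eigenpairD[OF ep]
  \<comment> \<open>At a maximum of the quotient of \<phi> and exp h, a multiple of exp h touches
    \<phi> from above. First derivatives then agree up to that multiple, second derivatives are
    ordered, and the eigenvalue equation is evaluated at this point.\<close>
  define f where "f x = \<phi> x * exp (- h x)" for x
  define f' where "f' x = (\<phi>' x - h' x * \<phi> x) * exp (- h x)" for x
  define f'' where "f'' x = (\<phi>'' x - h'' x * \<phi> x - h' x * \<phi>' x - h' x * (\<phi>' x - h' x * \<phi> x)) * exp (- h x)" for x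
  have f: "(f has_real_derivative f' x) (at x)" for x
    unfolding f_def[abs_def] f'_def by (auto intro!: derivative_eq_intros \<phi> h simp: algebra_simps)
  have f': "(f' has_real_derivative f'' x) (at x)" for x
    unfolding f'_def[abs_def] f''_def by (auto intro!: derivative_eq_intros \<phi> h simp: algebra_simps)
  obtain x0 where x0: "\<And>x. f x \<le> f x0"
    using periodic_attains_max[of f] DERIV_continuous_on_UNIV[OF f] by (auto simp: f_def per \<phi>)
  have "f' x0 = 0" "f'' x0 \<le> 0" using local_max_second_derivative[OF f f', of 1] x0 by auto
  then have 1: "\<phi>' x0 = h' x0 * \<phi> x0"
    and "\<phi>'' x0 - h'' x0 * \<phi> x0 - h' x0 * \<phi>' x0 - h' x0 * (\<phi>' x0 - h' x0 * \<phi> x0) \<le> 0"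
    by (auto simp: f'_def f''_def mult_le_0_iff)
  then have 2: "\<phi>'' x0 \<le> (h'' x0 + (h' x0)\<^sup>2) * \<phi> x0"
    by (simp add: algebra_simps power2_eq_square)
  have "l * \<phi> x0 \<le> \<epsilon> * a x0 * ((h'' x0 + (h' x0)\<^sup>2) * \<phi> x0) + b x0 * (h' x0 * \<phi> x0) + c x0 * \<phi> x0"
    unfolding \<phi>(5)[of x0, symmetric] 1 using 2 assms(2)[of x0] \<open>\<epsilon> > 0\<close> by (auto intro!: mult_left_mono)
  also have "\<dots> = (\<epsilon> * a x0 * (h'' x0 + (h' x0)\<^sup>2) + b x0 * h' x0 + c x0) * \<phi> x0"
    by (simp add: algebra_simps)
  also have "\<dots> \<le> K * \<phi> x0" using K[of x0] \<phi>(4)[of x0] by (intro mult_right_mono) auto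
  finally show ?thesis using \<phi>(4)[of x0] by simp
qed

text \<open>Since v vanishes at both ends, v / \<phi> attains its maximum T > 0 inside the interval.
  There T \<phi> touches v from above, and inserting the touching point into both equations compares
  K with l. A local bump can thus be tested against the global eigenfunction.\<close>

lemma positive_eigenpair_ge:
  assumes ep: "positive_eigenpair a b c \<epsilon> l \<phi> \<phi>' \<phi>''"
    and "\<And>x. a x > 0" "\<epsilon> > 0"
    and v: "\<And>x. (v has_real_derivative v' x) (at x)" "\<And>x. (v' has_real_derivative v'' x) (at x)"
    and "s < t" "v s = 0" "v t = 0" "\<And>x. s < x \<Longrightarrow> x < t \<Longrightarrow> v x > 0"
    and K: "\<And>x. s < x \<Longrightarrow> x < t \<Longrightarrow> K * v x \<le> \<epsilon> * a x * v'' x + b x * v' x + c x * v x"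
  shows "K \<le> l"
proof -
  note \<phi> = positive_eigenpairD[OF ep]
  have "continuous_on {s..t} (\<lambda>x. v x / \<phi> x)"
    using DERIV_continuous_on_UNIV[OF v(1)] DERIV_continuous_on_UNIV[OF \<phi>(1)] \<phi>(4)
    by (auto intro!: continuous_intros intro: continuous_on_subset simp: less_imp_neq[symmetric])
  then have "\<exists>x0\<in>{s..t}. \<forall>x\<in>{s..t}. v x / \<phi> x \<le> v x0 / \<phi> x0"
    using \<open>s < t\<close> by (intro continuous_attains_sup) auto
  then obtain x0 where x0: "x0 \<in> {s..t}" "\<And>x. x \<in> {s..t} \<Longrightarrow> v x / \<phi> x \<le> v x0 / \<phi> x0" by blast
  define m where "m = (s + t) / 2"
  have m: "s < m" "m < t" using \<open>s < t\<close> by (auto simp: m_def)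
  have "0 < v m / \<phi> m" using assms(9)[OF m] \<phi>(4)[of m] by simp
  also have "\<dots> \<le> v x0 / \<phi> x0" using m by (intro x0) auto
  finally have pos: "v x0 / \<phi> x0 > 0" .
  then have "x0 \<noteq> s" "x0 \<noteq> t" using assms(7,8) by auto
  then have ins: "s < x0" "x0 < t" using x0(1) by auto
  define T where "T = v x0 / \<phi> x0"
  have vx0: "v x0 = T * \<phi> x0" using \<phi>(4)[of x0] by (simp add: T_def)
  define f where "f x = v x - T * \<phi> x" for x
  define f' where "f' x = v' x - T * \<phi>' x" for x
  have f: "(f has_real_derivative f' x) (at x)" for x
    unfolding f_def[abs_def] f'_def by (auto intro!: derivative_eq_intros \<phi> v)
  have f': "(f' has_real_derivative v'' x - T * \<phi>'' x) (at x)" for x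
    unfolding f'_def[abs_def] by (auto intro!: derivative_eq_intros \<phi> v)
  have "f y \<le> f x0" if "\<bar>x0 - y\<bar> < min (x0 - s) (t - x0)" for y
  proof -
    have "v y / \<phi> y \<le> T" unfolding T_def using that by (intro x0) (auto simp: abs_less_iff)
    then show ?thesis using \<phi>(4)[of y] by (simp add: f_def vx0 field_simps)
  qed
  with local_max_second_derivative[OF f f', of "min (x0 - s) (t - x0)"] ins
  have "f' x0 = 0" "v'' x0 - T * \<phi>'' x0 \<le> 0" by simp_all
  then have 1: "v' x0 = T * \<phi>' x0" and 2: "v'' x0 \<le> T * \<phi>'' x0" by (simp_all add: f'_def)
  have "K * v x0 \<le> \<epsilon> * a x0 * v'' x0 + b x0 * v' x0 + c x0 * v x0" by (rule K[OF ins])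
  also have "\<dots> \<le> \<epsilon> * a x0 * (T * \<phi>'' x0) + b x0 * (T * \<phi>' x0) + c x0 * (T * \<phi> x0)"
    unfolding 1 vx0 using 2 assms(2)[of x0] \<open>\<epsilon> > 0\<close> by (auto intro!: mult_left_mono)
  also have "\<dots> = T * (\<epsilon> * a x0 * \<phi>'' x0 + b x0 * \<phi>' x0 + c x0 * \<phi> x0)" by (simp add: algebra_simps)
  also have "\<dots> = l * v x0" unfolding \<phi>(5) vx0 by simp
  finally show ?thesis using assms(9)[OF ins] by simp
qed

section \<open>The lower bound from a bump at one zero\<close>

text \<open>
  The right-hand side is \<open>L v\<close> for \<open>v = exp (- g y\<^sup>2 / \<epsilon>) s\<^sup>2\<close>, divided by the Gaussian factor.
\<close>

lemma bump_subsolution_bound: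
  fixes A b c y \<epsilon> \<beta> a0 c0 \<mu> \<delta> :: real
  defines "B \<equiv> max 0 \<beta>" and "g \<equiv> max 0 \<beta> / (2 * a0)" and "N \<equiv> 100 * a0 / \<mu>"
  defines "s \<equiv> N * \<epsilon> - y\<^sup>2"
  assumes "a0 > 0" "\<mu> > 0" "\<epsilon> > 0" "\<delta> > 0" "s > 0"
    and A: "\<bar>A - a0\<bar> \<le> \<delta>" and b: "\<bar>b - \<beta> * y\<bar> \<le> \<delta> * \<bar>y\<bar>" and c: "\<bar>c - c0\<bar> \<le> \<delta>"
    and \<delta>: "\<delta> \<le> a0 / 2" "\<delta> * (2 * g * (2 * g + 1) * N + 2 * g + 1) \<le> \<mu> / 2"
      "\<delta> * (4 * (1 + 4 * g) * N) \<le> a0"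
  shows "(c0 - B - \<mu>) * s\<^sup>2 \<le> \<epsilon> * A * (8 * y\<^sup>2 - 4 * s + 16 * g * y\<^sup>2 * s / \<epsilon>
      + (4 * g\<^sup>2 * y\<^sup>2 / \<epsilon>\<^sup>2 - 2 * g / \<epsilon>) * s\<^sup>2)
      + b * (- 4 * y * s - 2 * g * y / \<epsilon> * s\<^sup>2) + c * s\<^sup>2"
proof -
  have g0: "g \<ge> 0" using \<open>a0 > 0\<close> by (simp add: g_def)
  \<comment> \<open>The Gaussian u = exp (- g y^2 / \<epsilon>) solves the model equation \<epsilon>
    a0 u'' + \<beta> y u' = - B u exactly, for \<beta> > 0 as well as for \<beta> \<le> 0, where g =
    0.\<close>
  have gB: "2 * a0 * g = B" using \<open>a0 > 0\<close> by (simp add: g_def B_def)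
  have B: "B \<ge> 0" "B \<ge> \<beta>" by (auto simp: B_def)
  have N0: "N > 0" using \<open>a0 > 0\<close> \<open>\<mu> > 0\<close> by (simp add: N_def)
  have yN: "y\<^sup>2 \<le> N * \<epsilon>" using \<open>s > 0\<close> by (simp add: s_def)
  have yb: "y * b \<le> (\<beta> + \<delta>) * y\<^sup>2"
  proof -
    have "y * (b - \<beta> * y) \<le> \<bar>y\<bar> * \<bar>b - \<beta> * y\<bar>" by (metis abs_ge_self abs_mult)
    also have "\<dots> \<le> \<bar>y\<bar> * (\<delta> * \<bar>y\<bar>)" by (intro mult_left_mono b) auto
    also have "\<dots> = \<delta> * y\<^sup>2" by (simp add: power2_eq_square abs_mult_self_eq mult.left_commute)
    finally show ?thesis by (simp add: algebra_simps power2_eq_square)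
  qed
  have Ag: "2 * (A * g) \<ge> B - 2 * \<delta> * g"
  proof -
    have "(a0 - \<delta>) * g \<le> A * g" using A g0 by (intro mult_right_mono) auto
    then show ?thesis unfolding gB[symmetric] by (simp add: algebra_simps)
  qed
  have Ag': "2 * (A * g) \<le> B + 2 * \<delta> * g"
  proof -
    have "A * g \<le> (a0 + \<delta>) * g" using A g0 by (intro mult_right_mono) auto
    then show ?thesis unfolding gB[symmetric] by (simp add: algebra_simps)
  qed
  have Agy: "2 * (A * g) * y\<^sup>2 \<ge> (B - 2 * \<delta> * g) * y\<^sup>2" by (intro mult_right_mono Ag) auto
  \<comment> \<open>Terms linear in s, from the cut-off factor. Apart from the \<delta>-errors the
    coefficient of y^2 is 4 (2 B - \<beta>), nonnegative for either sign of \<beta>; the errors cost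
    at most \<open>a0 * \<epsilon>\<close>.\<close>
  have first: "16 * g * A * y\<^sup>2 - 4 * (y * b) \<ge> - (a0 * \<epsilon>)"
  proof -
    have "16 * g * A * y\<^sup>2 - 4 * (y * b) \<ge> 8 * ((B - 2 * \<delta> * g) * y\<^sup>2) - 4 * ((\<beta> + \<delta>) * y\<^sup>2)"
      using Agy yb by (simp add: mult_ac)
    also have "8 * ((B - 2 * \<delta> * g) * y\<^sup>2) - 4 * ((\<beta> + \<delta>) * y\<^sup>2)
        = 4 * ((2 * B - \<beta>) * y\<^sup>2) - (\<delta> * (4 * (1 + 4 * g))) * y\<^sup>2" by (simp add: algebra_simps)
    moreover have "(2 * B - \<beta>) * y\<^sup>2 \<ge> 0" using B by (intro mult_nonneg_nonneg) auto
    moreover have "(\<delta> * (4 * (1 + 4 * g))) * y\<^sup>2 \<le> (\<delta> * (4 * (1 + 4 * g))) * (N * \<epsilon>)"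
      using yN g0 \<open>\<delta> > 0\<close> by (intro mult_left_mono) auto
    moreover have "(\<delta> * (4 * (1 + 4 * g))) * (N * \<epsilon>) \<le> a0 * \<epsilon>"
      using mult_right_mono[OF \<delta>(3), of \<epsilon>] \<open>\<epsilon> > 0\<close> by (simp add: mult_ac)
    ultimately show ?thesis by linarith
  qed
  \<comment> \<open>Here the model Gaussian contributes - B, and the errors take half of \<mu>. The
    other half is kept for \<open>quad\<close>.\<close>
  have zeroth: "4 * A * g\<^sup>2 * y\<^sup>2 / \<epsilon> - 2 * A * g - 2 * g * (y * b) / \<epsilon> + c \<ge> c0 - B - \<mu> / 2"
  proof -
    have "2 * (A * g) * y\<^sup>2 - y * b \<ge> (B - 2 * \<delta> * g) * y\<^sup>2 - (\<beta> + \<delta>) * y\<^sup>2"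
      using Agy yb by linarith
    also have "(B - 2 * \<delta> * g) * y\<^sup>2 - (\<beta> + \<delta>) * y\<^sup>2 = (B - \<beta>) * y\<^sup>2 - (\<delta> * (2 * g + 1)) * y\<^sup>2"
      by (simp add: algebra_simps)
    moreover have "(B - \<beta>) * y\<^sup>2 \<ge> 0" using B by (intro mult_nonneg_nonneg) auto
    moreover have "(\<delta> * (2 * g + 1)) * y\<^sup>2 \<le> (\<delta> * (2 * g + 1)) * (N * \<epsilon>)"
      using yN g0 \<open>\<delta> > 0\<close> by (intro mult_left_mono) auto
    ultimately have "2 * (A * g) * y\<^sup>2 - y * b \<ge> - ((\<delta> * (2 * g + 1)) * (N * \<epsilon>))" by linarith
    then have "2 * g / \<epsilon> * (2 * (A * g) * y\<^sup>2 - y * b) \<ge> 2 * g / \<epsilon> * (- ((\<delta> * (2 * g + 1)) * (N * \<epsilon>)))"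
      using g0 \<open>\<epsilon> > 0\<close> by (intro mult_left_mono) auto
    then have "4 * A * g\<^sup>2 * y\<^sup>2 / \<epsilon> - 2 * g * (y * b) / \<epsilon> \<ge> - (\<delta> * (2 * g * (2 * g + 1) * N))"
      using \<open>\<epsilon> > 0\<close> by (simp add: algebra_simps power2_eq_square diff_divide_distrib)
    moreover have "\<delta> * (2 * g * (2 * g + 1) * N + 2 * g + 1) = \<delta> * (2 * g * (2 * g + 1) * N) + 2 * \<delta> * g + \<delta>"
      by (simp add: algebra_simps)
    ultimately show ?thesis using Ag' c \<delta>(2) by (simp add: mult.assoc abs_le_iff)
  qed
  have A2: "A \<ge> a0 / 2" "A \<le> 3 / 2 * a0" using A \<delta>(1) by (auto simp: abs_le_iff)
  \<comment> \<open>Near the ends of the support s is small and the constant term is decisive. It is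
    positive because s^2 is convex there, which is the reason for squaring the cut-off. Further
    inside, \<mu> / 2 * s^2 compensates the linear term. The factor 100 in N leaves a margin in
    completing the square: 439 = 800 - 19^2.\<close>
  have quad: "8 * \<epsilon>\<^sup>2 * A * N - (12 * A + a0) * \<epsilon> * s + \<mu> / 2 * s\<^sup>2 \<ge> 0"
  proof -
    have "8 * \<epsilon>\<^sup>2 * A * N \<ge> 8 * \<epsilon>\<^sup>2 * (a0 / 2) * N" using A2 N0 by (intro mult_right_mono mult_left_mono) auto
    moreover have "(12 * A + a0) * (\<epsilon> * s) \<le> (19 * a0) * (\<epsilon> * s)"
      using A2 \<open>\<epsilon> > 0\<close> \<open>s > 0\<close> by (intro mult_right_mono) auto
    moreover have "8 * \<epsilon>\<^sup>2 * (a0 / 2) * N - (19 * a0) * (\<epsilon> * s) + \<mu> / 2 * s\<^sup>2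
        = ((\<mu> * s - 19 * a0 * \<epsilon>)\<^sup>2 + 439 * (a0 * \<epsilon>)\<^sup>2) / (2 * \<mu>)"
      using \<open>\<mu> > 0\<close> unfolding N_def by (simp add: field_simps power2_eq_square)
    moreover have "((\<mu> * s - 19 * a0 * \<epsilon>)\<^sup>2 + 439 * (a0 * \<epsilon>)\<^sup>2) / (2 * \<mu>) \<ge> 0"
      using \<open>\<mu> > 0\<close> by (intro divide_nonneg_pos add_nonneg_nonneg) auto
    ultimately have "8 * \<epsilon>\<^sup>2 * A * N - (12 * A + a0) * (\<epsilon> * s) + \<mu> / 2 * s\<^sup>2 \<ge> 0" by linarith
    then show ?thesis by (simp add: mult.assoc)
  qed
  have "\<epsilon> * A * (8 * y\<^sup>2 - 4 * s + 16 * g * y\<^sup>2 * s / \<epsilon> + (4 * g\<^sup>2 * y\<^sup>2 / \<epsilon>\<^sup>2 - 2 * g / \<epsilon>) * s\<^sup>2)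
      + b * (- 4 * y * s - 2 * g * y / \<epsilon> * s\<^sup>2) + c * s\<^sup>2
    = \<epsilon> * A * (8 * y\<^sup>2 - 4 * s) + s * (16 * g * A * y\<^sup>2 - 4 * (y * b))
      + s\<^sup>2 * (4 * A * g\<^sup>2 * y\<^sup>2 / \<epsilon> - 2 * A * g - 2 * g * (y * b) / \<epsilon> + c)"
    using \<open>\<epsilon> > 0\<close> by (simp add: field_simps power2_eq_square)
  moreover have "s * (16 * g * A * y\<^sup>2 - 4 * (y * b)) \<ge> s * (- (a0 * \<epsilon>))"
    using first \<open>s > 0\<close> by (intro mult_left_mono) auto
  moreover have "s\<^sup>2 * (4 * A * g\<^sup>2 * y\<^sup>2 / \<epsilon> - 2 * A * g - 2 * g * (y * b) / \<epsilon> + c) \<ge> s\<^sup>2 * (c0 - B - \<mu> / 2)"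
    using zeroth by (intro mult_left_mono) auto
  moreover have "\<epsilon> * A * (8 * y\<^sup>2 - 4 * s) = 8 * \<epsilon>\<^sup>2 * A * N - 12 * A * \<epsilon> * s"
  proof -
    have "y\<^sup>2 = N * \<epsilon> - s" by (simp add: s_def)
    then show ?thesis unfolding \<open>y\<^sup>2 = _\<close> by (simp add: algebra_simps power2_eq_square)
  qed
  moreover have "s * (- (a0 * \<epsilon>)) + s\<^sup>2 * (c0 - B - \<mu> / 2) + (8 * \<epsilon>\<^sup>2 * A * N - 12 * A * \<epsilon> * s)
     = (c0 - B - \<mu>) * s\<^sup>2 + (8 * \<epsilon>\<^sup>2 * A * N - (12 * A + a0) * \<epsilon> * s + \<mu> / 2 * s\<^sup>2)"
    by (simp add: algebra_simps)
  ultimately show ?thesis using quad by linarith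
qed

text \<open>The support of the bump has radius sqrt (N \<epsilon>). For small \<epsilon> it lies
  where a and c differ from their values at x0, and b from its linear part relative to the distance,
  by at most a fixed \<delta>.\<close>

lemma eigenvalue_lower_bound:
  assumes "\<And>x. a x > 0" and "isCont a x0" "isCont c x0"
    and Db: "(b has_real_derivative \<beta>) (at x0)" and "b x0 = 0" and "\<mu> > 0"
  shows "\<forall>\<^sub>F \<epsilon> in at_right 0. \<forall>l \<phi> \<phi>' \<phi>''. positive_eigenpair a b c \<epsilon> l \<phi> \<phi>' \<phi>'' \<longrightarrow>
     c x0 - max 0 \<beta> - \<mu> \<le> l"
proof -
  define a0 where "a0 = a x0"
  define g where "g = max 0 \<beta> / (2 * a0)"
  define N where "N = 100 * a0 / \<mu>"
  have a0: "a0 > 0" using assms(1) by (simp add: a0_def)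
  have g0: "g \<ge> 0" using a0 by (simp add: g_def)
  have N0: "N > 0" using a0 \<open>\<mu> > 0\<close> by (simp add: N_def)
  \<comment> \<open>\<open>D1\<close> and \<open>D2\<close> are the factors of \<delta> in the last
    two smallness conditions of \<open>bump_subsolution_bound\<close>. They do not involve
    \<epsilon>, so \<delta> can be fixed first.\<close>
  define D1 where "D1 = 2 * g * (2 * g + 1) * N + 2 * g + 1"
  define D2 where "D2 = 4 * (1 + 4 * g) * N"
  have D: "D1 > 0" "D2 > 0" using g0 N0 by (auto simp: D1_def D2_def intro!: add_nonneg_pos)
  define \<delta> where "\<delta> = min (a0 / 2) (min (\<mu> / 2 / D1) (a0 / D2))"
  have \<delta>0: "\<delta> > 0" using a0 D \<open>\<mu> > 0\<close> by (simp add: \<delta>_def)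
  have \<delta>: "\<delta> \<le> a0 / 2" "\<delta> * D1 \<le> \<mu> / 2" "\<delta> * D2 \<le> a0"
  proof -
    show "\<delta> \<le> a0 / 2" unfolding \<delta>_def by (rule min.cobounded1)
    have "\<delta> \<le> \<mu> / 2 / D1" "\<delta> \<le> a0 / D2" by (auto simp: \<delta>_def)
    then show "\<delta> * D1 \<le> \<mu> / 2" "\<delta> * D2 \<le> a0" using D by (simp_all only: pos_le_divide_eq)
  qed
  obtain r1 where r1: "r1 > 0" "\<And>x. \<bar>x - x0\<bar> < r1 \<Longrightarrow> \<bar>a x - a0\<bar> < \<delta>"
    using assms(2) \<delta>0 unfolding continuous_at_eps_delta a0_def dist_real_def by blast
  obtain r2 where r2: "r2 > 0" "\<And>x. \<bar>x - x0\<bar> < r2 \<Longrightarrow> \<bar>c x - c x0\<bar> < \<delta>"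
    using assms(3) \<delta>0 unfolding continuous_at_eps_delta dist_real_def by blast
  obtain r3 where r3: "r3 > 0" "\<And>x. \<bar>x - x0\<bar> < r3 \<Longrightarrow> \<bar>b x - \<beta> * (x - x0)\<bar> \<le> \<delta> * \<bar>x - x0\<bar>"
    using Db \<delta>0 unfolding has_field_derivative_def has_derivative_at_alt by (auto simp: \<open>b x0 = 0\<close>)
  define r where "r = min r1 (min r2 r3)"
  have r: "r > 0" using r1 r2 r3 by (simp add: r_def)
  have "\<forall>\<^sub>F \<epsilon> in at_right 0. \<epsilon> < r\<^sup>2 / N" 
    using r N0 by (intro eventually_at_right_real[of 0 "r\<^sup>2 / N", THEN eventually_mono]) auto
  moreover have "\<forall>\<^sub>F \<epsilon> in at_right (0::real). \<epsilon> > 0" by (rule eventually_at_right_less)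
  ultimately show ?thesis
  proof eventually_elim
    case (elim \<epsilon>)
    show ?case
    proof (intro allI impI)
      fix l \<phi> \<phi>' \<phi>'' assume ep: "positive_eigenpair a b c \<epsilon> l \<phi> \<phi>' \<phi>''"
      define R where "R = sqrt (N * \<epsilon>)"
      have R2: "R\<^sup>2 = N * \<epsilon>" using N0 elim by (simp add: R_def)
      have R0: "R > 0" using N0 elim by (simp add: R_def)
      have "R\<^sup>2 < r\<^sup>2" unfolding R2 using elim N0 by (simp add: field_simps)
      then have Rr: "R < r" using r by (simp add: power2_less_imp_less)
      define e where "e x = exp (- g * (x - x0)\<^sup>2 / \<epsilon>)" for x
      define s where "s x = N * \<epsilon> - (x - x0)\<^sup>2" for x
      define v where "v x = e x * (s x)\<^sup>2" for x
      define p where "p x = - 4 * (x - x0) * s x - 2 * g * (x - x0) / \<epsilon> * (s x)\<^sup>2" for x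
      define q where "q x = 8 * (x - x0)\<^sup>2 - 4 * s x + 16 * g * (x - x0)\<^sup>2 * s x / \<epsilon>
          + (4 * g\<^sup>2 * (x - x0)\<^sup>2 / \<epsilon>\<^sup>2 - 2 * g / \<epsilon>) * (s x)\<^sup>2" for x
      define v' where "v' x = e x * p x" for x
      define v'' where "v'' x = e x * q x" for x
      have De: "(e has_real_derivative e x * (- 2 * g * (x - x0) / \<epsilon>)) (at x)" for x
        unfolding e_def[abs_def] using elim by (auto intro!: derivative_eq_intros)
      have Ds: "(s has_real_derivative - 2 * (x - x0)) (at x)" for x
        unfolding s_def[abs_def] by (auto intro!: derivative_eq_intros)
      have Dv: "(v has_real_derivative v' x) (at x)" for x
        unfolding v_def[abs_def] v'_def p_def using elim
        by (auto intro!: derivative_eq_intros De Ds simp: field_simps power2_eq_square)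
      have Dv': "(v' has_real_derivative v'' x) (at x)" for x
        unfolding v'_def[abs_def] v''_def p_def q_def using elim
        by (auto intro!: derivative_eq_intros De Ds simp: field_simps power2_eq_square)
      show "c x0 - max 0 \<beta> - \<mu> \<le> l"
      proof (rule positive_eigenpair_ge[OF ep assms(1) elim(2) Dv Dv'])
        show "x0 - R < x0 + R" using R0 by simp
        show "v (x0 - R) = 0" "v (x0 + R) = 0" using R2 by (simp_all add: v_def s_def)
        fix x assume "x0 - R < x" "x < x0 + R"
        then have x: "\<bar>x - x0\<bar> < R" by (simp add: abs_less_iff)
        then have "(x - x0)\<^sup>2 < R\<^sup>2" using power_strict_mono[OF x, of 2] by simp
        then have s: "N * \<epsilon> - (x - x0)\<^sup>2 > 0" using R2 by simp
        then show "v x > 0" by (simp add: v_def s_def e_def)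
        have xr: "\<bar>x - x0\<bar> < r1" "\<bar>x - x0\<bar> < r2" "\<bar>x - x0\<bar> < r3" using x Rr by (auto simp: r_def)
        have "(c x0 - max 0 \<beta> - \<mu>) * (s x)\<^sup>2 \<le> \<epsilon> * a x * q x + b x * p x + c x * (s x)\<^sup>2"
          unfolding s_def g_def N_def p_def q_def
          by (rule bump_subsolution_bound[OF a0 \<open>\<mu> > 0\<close> elim(2) \<delta>0 s[unfolded N_def]
            less_imp_le[OF r1(2)[OF xr(1)]] r3(2)[OF xr(3)] less_imp_le[OF r2(2)[OF xr(2)]]
            \<delta>(1) \<delta>(2)[unfolded D1_def g_def N_def] \<delta>(3)[unfolded D2_def g_def N_def]])
        then have "e x * ((c x0 - max 0 \<beta> - \<mu>) * (s x)\<^sup>2) \<le> e x * (\<epsilon> * a x * q x + b x * p x + c x * (s x)\<^sup>2)"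
          by (intro mult_left_mono) (simp_all add: e_def)
        then show "(c x0 - max 0 \<beta> - \<mu>) * v x \<le> \<epsilon> * a x * v'' x + b x * v' x + c x * v x"
          unfolding v_def v'_def v''_def by (simp only: distrib_left mult_ac)
      qed
    qed
  qed
qed

section \<open>The supersolution\<close>

definition periodic_C2 :: "(real \<Rightarrow> real) \<Rightarrow> (real \<Rightarrow> real) \<Rightarrow> (real \<Rightarrow> real) \<Rightarrow> bool" where
  "periodic_C2 f f' f'' \<longleftrightarrow>
     (\<forall>x. (f has_real_derivative f' x) (at x)) \<and> (\<forall>x. (f' has_real_derivative f'' x) (at x)) \<and>
     continuous_on UNIV f'' \<and> (\<forall>x. f (x + 1) = f x)"

lemma periodic_C2D:
  assumes "periodic_C2 f f' f''"
  shows "(f has_real_derivative f' x) (at x)" "(f' has_real_derivative f'' x) (at x)"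
    "continuous_on UNIV f" "continuous_on UNIV f'" "continuous_on UNIV f''"
    "f (x + 1) = f x" "f' (x + 1) = f' x" "f'' (x + 1) = f'' x"
proof -
  have f: "\<And>x. (f has_real_derivative f' x) (at x)" "\<And>x. (f' has_real_derivative f'' x) (at x)"
    and per: "\<And>x. f (x + 1) = f x"
    using assms by (auto simp: periodic_C2_def)
  show "(f has_real_derivative f' x) (at x)" "(f' has_real_derivative f'' x) (at x)" by (fact f)+
  show "continuous_on UNIV f" "continuous_on UNIV f'" by (fact f[THEN DERIV_continuous_on_UNIV])+
  show "continuous_on UNIV f''" using assms by (simp add: periodic_C2_def)
  show "f (x + 1) = f x" by (fact per)
  show p: "f' (x + 1) = f' x" for x by (rule periodic_deriv[OF per f(1)])
  show "f'' (x + 1) = f'' x" by (rule periodic_deriv[OF p f(2)])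
qed

lemma periodic_C2_const: "periodic_C2 (\<lambda>x. k) (\<lambda>x. 0) (\<lambda>x. 0)"
  by (auto simp: periodic_C2_def)

lemma periodic_C2_lincomb:
  assumes f: "periodic_C2 f f' f''" and g: "periodic_C2 g g' g''"
  shows "periodic_C2 (\<lambda>x. r * f x + s * g x) (\<lambda>x. r * f' x + s * g' x) (\<lambda>x. r * f'' x + s * g'' x)"
  unfolding periodic_C2_def
  by (auto intro!: derivative_eq_intros continuous_intros periodic_C2D[OF f] periodic_C2D[OF g]
    simp: periodic_C2D(6)[OF f] periodic_C2D(6)[OF g])

lemma periodic_C2_mult:
  assumes f: "periodic_C2 f f' f''" and g: "periodic_C2 g g' g''"
  shows "periodic_C2 (\<lambda>x. f x * g x) (\<lambda>x. f' x * g x + f x * g' x)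
    (\<lambda>x. f'' x * g x + 2 * f' x * g' x + f x * g'' x)"
  unfolding periodic_C2_def
  by (auto intro!: derivative_eq_intros continuous_intros periodic_C2D[OF f] periodic_C2D[OF g]
    simp: periodic_C2D(6)[OF f] periodic_C2D(6)[OF g])

lemma periodic_C2_exp:
  assumes f: "periodic_C2 f f' f''"
  shows "periodic_C2 (\<lambda>x. exp (f x)) (\<lambda>x. f' x * exp (f x)) (\<lambda>x. (f'' x + (f' x)\<^sup>2) * exp (f x))"
  unfolding periodic_C2_def
  by (auto intro!: derivative_eq_intros continuous_intros periodic_C2D[OF f]
    simp: periodic_C2D(6)[OF f] algebra_simps power2_eq_square)

section \<open>Wells with prescribed zeros and curvature\<close>

lemma periodic_C2_one_minus_cos:
  "periodic_C2 (\<lambda>x. 1 - cos (2 * pi * (x - z))) (\<lambda>x. 2 * pi * sin (2 * pi * (x - z)))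
     (\<lambda>x. 4 * pi\<^sup>2 * cos (2 * pi * (x - z)))"
proof -
  have "cos (2 * pi * (x + 1 - z)) = cos (2 * pi * (x - z))" for x
  proof -
    have "2 * pi * (x + 1 - z) = 2 * pi * (x - z) + 2 * pi" by (simp add: algebra_simps)
    then show ?thesis by (simp only: cos_periodic)
  qed
  then show ?thesis unfolding periodic_C2_def
    by (auto intro!: derivative_eq_intros continuous_intros simp: power2_eq_square)
qed

lemma one_minus_cos_zero:
  assumes "z \<in> {0..<1}"
  shows "1 - cos (2 * pi * (x - z)) = 0 \<longleftrightarrow> frac x = z"
proof -
  have "1 - cos (2 * pi * (x - z)) = 0 \<longleftrightarrow> (\<exists>n::int. 2 * pi * (x - z) = real_of_int n * 2 * pi)"
    using cos_one_2pi_int[of "2 * pi * (x - z)"] by auto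
  also have "\<dots> \<longleftrightarrow> x - z \<in> \<int>" by (auto elim!: Ints_cases)
  also have "\<dots> \<longleftrightarrow> frac x = z" using assms by (auto simp: frac_unique_iff)
  finally show ?thesis .
qed

lemma nonneg_zero_deriv:
  fixes D :: "real \<Rightarrow> real"
  assumes "\<And>x. (D has_real_derivative D' x) (at x)" "\<And>x. D x \<ge> 0" "D z = 0"
  shows "D' z = 0"
  by (rule DERIV_local_min[OF assms(1), of 1]) (use assms in auto)

text \<open>The product of the functions 1 - cos (2 pi (x - z)). At a point of Z one factor has a
  nondegenerate double zero and the others are positive, so only one term of the product rule for
  the second derivative survives, and it is positive.\<close>

lemma exists_well:
  assumes "finite Z" "Z \<subseteq> {0..<1}"
  shows "\<exists>D D' D''. periodic_C2 D D' D'' \<and> (\<forall>x. D x \<ge> 0) \<and> (\<forall>x. D x = 0 \<longleftrightarrow> frac x \<in> Z) \<and>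
    (\<forall>z\<in>Z. D'' z > 0)"
  using assms
proof (induction Z rule: finite_induct)
  case empty
  then show ?case using periodic_C2_const[of 1] by (intro exI[of _ "\<lambda>x. 1"] exI) auto
next
  case (insert z Z)
  then obtain D D' D'' where D: "periodic_C2 D D' D''" "\<And>x. D x \<ge> 0" "\<And>x. D x = 0 \<longleftrightarrow> frac x \<in> Z"
    "\<And>z. z \<in> Z \<Longrightarrow> D'' z > 0" by auto
  have z: "z \<in> {0..<1}" using insert by simp
  define s where "s x = 1 - cos (2 * pi * (x - z))" for x
  define s' where "s' x = 2 * pi * sin (2 * pi * (x - z))" for x
  define s'' where "s'' x = 4 * pi\<^sup>2 * cos (2 * pi * (x - z))" for x
  have s: "periodic_C2 s s' s''"
    unfolding s_def[abs_def] s'_def[abs_def] s''_def[abs_def] by (rule periodic_C2_one_minus_cos)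
  have s0: "s x = 0 \<longleftrightarrow> frac x = z" for x unfolding s_def by (rule one_minus_cos_zero[OF z])
  have snn: "s x \<ge> 0" for x by (simp add: s_def)
  have fr: "frac j = j" if "j \<in> insert z Z" for j
    using that insert.prems by (intro frac_eq[THEN iffD2]) auto
  have pos: "D'' j * s j + 2 * D' j * s' j + D j * s'' j > 0" if j: "j \<in> insert z Z" for j
  proof (cases "j = z")
    case True
    have "D z > 0" using D(2)[of z] D(3)[of z] fr[of z] \<open>z \<notin> Z\<close> by (simp add: order_less_le)
    then show ?thesis using True by (simp add: s_def s'_def s''_def)
  next
    case False
    then have "D j = 0" using D(3)[of j] fr[OF j] j by simp
    moreover have "D' j = 0" using nonneg_zero_deriv[OF periodic_C2D(1)[OF D(1)] D(2) \<open>D j = 0\<close>] .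
    moreover have "s j > 0" using s0[of j] snn[of j] fr[OF j] False by (simp add: order_less_le)
    ultimately show ?thesis using D(4)[of j] j False by simp
  qed
  show ?case
    by (rule exI[of _ "\<lambda>x. D x * s x"], rule exI, rule exI, rule conjI[OF periodic_C2_mult[OF D(1) s]])
      (use D(2,3) s0 snn pos in auto)
qed

text \<open>Newton interpolation: a new node is served by adding a multiple of the well of the
  earlier nodes, which vanishes at all of them.\<close>

lemma exists_periodic_C2_interpolation:
  assumes "finite Z" "Z \<subseteq> {0..<1}"
  shows "\<exists>f f' f''. periodic_C2 f f' f'' \<and> (\<forall>z\<in>Z. f z = v z)"
  using assms
proof (induction Z rule: finite_induct)
  case empty
  then show ?case using periodic_C2_const[of 1] by (intro exI[of _ "\<lambda>x. 1"] exI) auto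
next
  case (insert z Z)
  then obtain f f' f'' where f: "periodic_C2 f f' f''" "\<And>z. z \<in> Z \<Longrightarrow> f z = v z" by auto
  from insert exists_well[of Z] obtain D D' D'' where D: "periodic_C2 D D' D''"
    "\<And>x. D x = 0 \<longleftrightarrow> frac x \<in> Z" by auto
  have fr: "frac j = j" if "j \<in> insert z Z" for j
    using that insert.prems by (intro frac_eq[THEN iffD2]) auto
  have "D z \<noteq> 0" using D(2)[of z] fr[of z] insert.hyps by simp
  moreover have "D j = 0" if "j \<in> Z" for j using D(2)[of j] fr[of j] that by simp
  ultimately show ?case
    using f(2) by - (rule exI, rule exI, rule exI,
      rule conjI[OF periodic_C2_lincomb[OF f(1) D(1), of 1 "(v z - f z) / D z"]], auto)
qed

text \<open>Multiplying a well D by exp f keeps its sign and zeros. Where D = D' = 0, the second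
  derivative of the product is D'' exp f, so f has to interpolate ln (w / D'').\<close>

lemma exists_well_prescribed:
  assumes "finite Z" "Z \<subseteq> {0..<1}" and w: "\<And>z. z \<in> Z \<Longrightarrow> w z > 0"
  shows "\<exists>Q Q' Q''. periodic_C2 Q Q' Q'' \<and> (\<forall>x. Q x \<ge> 0) \<and> (\<forall>x. Q x = 0 \<longleftrightarrow> frac x \<in> Z) \<and>
    (\<forall>z\<in>Z. Q'' z = w z)"
proof -
  obtain D D' D'' where D: "periodic_C2 D D' D''" "\<And>x. D x \<ge> 0" "\<And>x. D x = 0 \<longleftrightarrow> frac x \<in> Z"
    "\<And>z. z \<in> Z \<Longrightarrow> D'' z > 0" using exists_well[OF assms(1,2)] by auto
  obtain f f' f'' where f: "periodic_C2 f f' f''" "\<And>z. z \<in> Z \<Longrightarrow> f z = ln (w z / D'' z)"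
    using exists_periodic_C2_interpolation[OF assms(1,2), of "\<lambda>z. ln (w z / D'' z)"] by auto
  have eq: "D'' z * exp (f z) + 2 * D' z * (f' z * exp (f z)) + D z * ((f'' z + (f' z)\<^sup>2) * exp (f z)) = w z"
    if "z \<in> Z" for z
  proof -
    have "frac z = z" using that assms(2) by (intro frac_eq[THEN iffD2]) auto
    then have "D z = 0" using D(3)[of z] that by simp
    moreover have "D' z = 0" using nonneg_zero_deriv[OF periodic_C2D(1)[OF D(1)] D(2) \<open>D z = 0\<close>] .
    moreover have "exp (f z) = w z / D'' z" using D(4)[OF that] w[OF that] by (simp add: f(2)[OF that])
    ultimately show ?thesis using D(4)[OF that] by simp
  qed
  show ?thesis
    by (rule exI, rule exI, rule exI, rule conjI[OF periodic_C2_mult[OF D(1) periodic_C2_exp[OF f(1)]]])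
      (use D(2,3) eq in auto)
qed

lemma taylor2:
  fixes Q :: "real \<Rightarrow> real"
  assumes "\<And>x. (Q has_real_derivative Q' x) (at x)" "\<And>x. (Q' has_real_derivative Q'' x) (at x)"
  shows "\<exists>t. \<bar>t - x\<bar> \<le> \<bar>y - x\<bar> \<and> Q y = Q x + Q' x * (y - x) + Q'' t / 2 * (y - x)\<^sup>2"
proof (cases "y = x")
  case False
  define d where "d m = (if m = 0 then Q else if m = 1 then Q' else Q'')" for m :: nat
  have "\<exists>t. (if y < x then y < t \<and> t < x else x < t \<and> t < y) \<and>
     Q y = (\<Sum>m<2. d m x / fact m * (y - x) ^ m) + d 2 t / fact 2 * (y - x) ^ 2"
    by (rule Taylor[of 2 d Q "min x y" "max x y"])
      (use assms False in \<open>auto simp: d_def less_2_cases_iff\<close>)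
  then obtain t where t: "if y < x then y < t \<and> t < x else x < t \<and> t < y"
    "Q y = (\<Sum>m<2. d m x / fact m * (y - x) ^ m) + d 2 t / fact 2 * (y - x) ^ 2" by blast
  show ?thesis
    by (rule exI[of _ t]) (use t in \<open>auto simp: d_def numeral_2_eq_2 split: if_splits\<close>)
qed (auto intro: exI[of _ x])

text \<open>Glaeser's inequality: the Taylor parabola with curvature M lies above Q, so its minimum,
  attained at x - Q' x / M, is nonnegative. It will control the logarithmic derivative of the
  barrier close to the wells.\<close>

lemma nonneg_deriv_square_le:
  fixes Q :: "real \<Rightarrow> real"
  assumes Q: "\<And>x. (Q has_real_derivative Q' x) (at x)" "\<And>x. (Q' has_real_derivative Q'' x) (at x)"
    and "\<And>x. Q x \<ge> 0" and M: "\<And>x. \<bar>Q'' x\<bar> \<le> M" "M > 0"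
  shows "(Q' x)\<^sup>2 \<le> 2 * M * Q x"
proof -
  define y where "y = x - Q' x / M"
  obtain t where t: "Q y = Q x + Q' x * (y - x) + Q'' t / 2 * (y - x)\<^sup>2" using taylor2[OF Q] by blast
  have "Q'' t / 2 * (y - x)\<^sup>2 \<le> M / 2 * (y - x)\<^sup>2" using M(1)[of t] by (intro mult_right_mono) auto
  then have "0 \<le> Q x + Q' x * (y - x) + M / 2 * (y - x)\<^sup>2" using t assms(3)[of y] by linarith
  also have "\<dots> = Q x - (Q' x)\<^sup>2 / (2 * M)" using \<open>M > 0\<close> by (simp add: y_def field_simps power2_eq_square)
  finally show ?thesis using \<open>M > 0\<close> by (simp add: field_simps)
qed

section \<open>A periodic function increasing along the drift\<close>

text \<open>The square makes the positive part continuously differentiable, as needed for the weight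
  by which b is multiplied in \<open>exists_periodic_potential\<close>.\<close>

lemma DERIV_pos_part_square:
  "((\<lambda>u::real. (max 0 u)\<^sup>2) has_real_derivative 2 * max 0 u) (at u)"
proof -
  consider "u > 0" | "u < 0" | "u = 0" by linarith
  then show ?thesis
  proof cases
    case 1
    have "((\<lambda>u::real. u\<^sup>2) has_real_derivative 2 * max 0 u) (at u)"
      using 1 by (auto intro!: derivative_eq_intros)
    then show ?thesis
      by (rule has_field_derivative_transform_within_open[of _ _ _ "{0<..}"]) (use 1 in auto)
  next
    case 2
    have "((\<lambda>u::real. 0) has_real_derivative 2 * max 0 u) (at u)" using 2 by simp
    then show ?thesis
      by (rule has_field_derivative_transform_within_open[of _ _ _ "{..<0}"]) (use 2 in auto)
  next
    case 3
    have "\<forall>\<^sub>F h in at (0::real). norm (((max 0 h)\<^sup>2 - 0) / h) \<le> \<bar>h\<bar>"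
      by (rule always_eventually) (auto simp: max_def power2_eq_square)
    moreover have "((\<lambda>h::real. \<bar>h\<bar>) \<longlongrightarrow> 0) (at 0)" by (rule tendsto_eq_intros refl | simp)+
    ultimately have "((\<lambda>h::real. ((max 0 h)\<^sup>2 - 0) / h) \<longlongrightarrow> 0) (at 0)" by (rule Lim_null_comparison)
    then show ?thesis using 3 by (simp add: DERIV_def)
  qed
qed

text \<open>A primitive of b has the right sign of derivative but is periodic only if b has mean
  zero. If the mean is nonpositive, b is multiplied by 1 + k (max 0 b)^2, which enlarges it only
  where it is positive, with k \<ge> 0 chosen to make the mean zero. If the mean is positive, the
  same is done for - b, and the sign of H is reversed.\<close>

lemma exists_periodic_potential:
  assumes Db: "\<And>x. (b has_real_derivative b' x) (at x)" and b': "continuous_on UNIV b'"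
    and per: "\<And>x. b (x + 1) = b x" and "b x1 > 0" "b x2 < 0"
  shows "\<exists>H H' H''. periodic_C2 H H' H'' \<and> (\<forall>x. b x \<noteq> 0 \<longrightarrow> b x * H' x > 0)"
proof -
  have main: "\<exists>H H' H''. periodic_C2 H H' H'' \<and> (\<forall>x. b x \<noteq> 0 \<longrightarrow> b x * H' x > 0)"
    if Db: "\<And>x. (b has_real_derivative b' x) (at x)" and b': "continuous_on UNIV b'"
    and per: "\<And>x. b (x + 1) = b x" and "b x1 > 0"
    and V: "V 0 = 0" "\<And>x. (V has_real_derivative b x) (at x)" "V 1 \<le> 0" for b b' V x1
  proof -
    define f where "f x = b x * (max 0 (b x))\<^sup>2" for x
    note bc = DERIV_continuous_on_UNIV[OF Db]
    have fc: "continuous_on UNIV f" unfolding f_def[abs_def] by (intro continuous_intros bc)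
    have fper: "f (x + 1) = f x" for x by (simp add: f_def per)
    have fnn: "f x \<ge> 0" for x by (simp add: f_def max_def)
    obtain T where T: "T 0 = 0" "\<And>x. (T has_real_derivative f x) (at x)"
      using exists_antiderivative[OF fc] by blast
    have Tinc: "T x \<le> T y" if "x \<le> y" for x y
      by (rule DERIV_nonneg_imp_nondecreasing[OF that]) (use T fnn in blast)
    have Tper: "T (x + 1) = T x + T 1" for x by (rule antiderivative_periodic_increment[OF T fper])
    have Vper: "V (x + 1) = V x + V 1" for x by (rule antiderivative_periodic_increment[OF V(1,2) per])
    have T1: "T 1 > 0"
    proof -
      have "f x1 > 0" using \<open>b x1 > 0\<close> by (simp add: f_def)
      then obtain d where d: "d > 0" "\<And>h. 0 < h \<Longrightarrow> h < d \<Longrightarrow> T x1 < T (x1 + h)"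
        using DERIV_pos_inc_right[OF T(2)] by blast
      define h where "h = min 1 (d / 2)"
      have "0 < h" "h < d" "h \<le> 1" using \<open>d > 0\<close> by (auto simp: h_def)
      then have "T x1 < T (x1 + 1)" using d(2)[of h] Tinc[of "x1 + h" "x1 + 1"] by linarith
      then show ?thesis using Tper by simp
    qed
    define k where "k = - V 1 / T 1"
    have k: "k \<ge> 0" using T1 V(3) by (simp add: k_def divide_nonpos_pos)
    define H where "H x = V x + k * T x" for x
    define H' where "H' x = b x * (1 + k * (max 0 (b x))\<^sup>2)" for x
    define H'' where "H'' x = b' x * (1 + k * (max 0 (b x))\<^sup>2) + b x * (k * (2 * max 0 (b x) * b' x))" for x
    have Dm: "((\<lambda>x. (max 0 (b x))\<^sup>2) has_real_derivative 2 * max 0 (b x) * b' x) (at x)" for x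
      by (rule DERIV_chain2[OF DERIV_pos_part_square Db])
    have "(H has_real_derivative H' x) (at x)" for x
      unfolding H_def[abs_def] H'_def
      by (auto intro!: derivative_eq_intros T V simp: f_def algebra_simps)
    moreover have "(H' has_real_derivative H'' x) (at x)" for x
      unfolding H'_def[abs_def] H''_def
      by (rule derivative_eq_intros Dm Db refl | simp)+
    moreover have "continuous_on UNIV H''"
      unfolding H''_def[abs_def] by (intro continuous_intros bc b')
    moreover have "H (x + 1) = H x" for x using T1 unfolding H_def Tper Vper k_def by (simp add: field_simps)
    moreover have "b x * H' x > 0" if "b x \<noteq> 0" for x
    proof -
      have "b x * b x > 0" using that by (simp add: zero_less_mult_iff) linarith
      moreover have "1 + k * (max 0 (b x))\<^sup>2 > 0" using k by (intro add_pos_nonneg) auto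
      ultimately show ?thesis unfolding H'_def by (simp add: mult.assoc[symmetric])
    qed
    ultimately show ?thesis unfolding periodic_C2_def by blast
  qed
  obtain V where V: "V 0 = 0" "\<And>x. (V has_real_derivative b x) (at x)"
    using exists_antiderivative[OF DERIV_continuous_on_UNIV[OF Db]] by blast
  show ?thesis
  proof (cases "V 1 \<le> 0")
    case True
    then show ?thesis by (intro main[OF Db b' per \<open>b x1 > 0\<close> V])
  next
    case False
    have "\<exists>H H' H''. periodic_C2 H H' H'' \<and> (\<forall>x. - b x \<noteq> 0 \<longrightarrow> - b x * H' x > 0)"
      by (rule main[where b' = "\<lambda>x. - b' x" and V = "\<lambda>x. - V x" and ?x1.0 = x2])
        (use False V \<open>b x2 < 0\<close> per b' in \<open>auto intro!: derivative_eq_intros Db V continuous_intros\<close>)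
    then obtain H H' H'' where H: "periodic_C2 H H' H''" "\<And>x. b x \<noteq> 0 \<Longrightarrow> - b x * H' x > 0" by auto
    show ?thesis
      by (rule exI, rule exI, rule exI, rule conjI[OF periodic_C2_lincomb[OF H(1) H(1), of "-1" 0]]) (use H(2) in auto)
  qed
qed

section \<open>The residual of the logarithmic barrier\<close>

text \<open>
  With \<open>w = \<beta> / a0\<close>, which makes \<open>A1\<close> to \<open>A3\<close> hold for small \<open>\<delta>\<close>, the barrier terms become
  \<open>- \<beta> + \<beta> \<tau> (3 - 2 (1 + \<kappa>) \<tau>)\<close> in the limit \<open>\<delta>, \<eta> \<rightarrow> 0\<close>, where \<open>\<tau> = Q / (\<kappa> \<epsilon> + Q)\<close>.
\<close>

lemma well_barrier_bound:
  fixes A b c t Q Q1 Q2 \<epsilon> \<kappa> \<delta> a0 \<beta> w c0 \<eta> \<mu> :: real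
  assumes "a0 > 0" "\<beta> > 0" "0 < \<delta>" "\<delta> < w" "\<delta> < \<beta>" "\<delta> < a0" "\<epsilon> > 0" "\<kappa> > 0" "\<eta> \<ge> 0" "\<mu> > 0"
    and A: "\<bar>A - a0\<bar> \<le> \<delta>" and b: "\<bar>b - \<beta> * t\<bar> \<le> \<delta> * \<bar>t\<bar>" and c: "c \<le> c0 + \<delta>"
    and Q2: "\<bar>Q2 - w\<bar> \<le> \<delta>" and Q1: "\<bar>Q1 - w * t\<bar> \<le> \<delta> * \<bar>t\<bar>"
    and Q: "(w - \<delta>) * t\<^sup>2 \<le> 2 * Q" "2 * Q \<le> (w + \<delta>) * t\<^sup>2"
    and A1: "(a0 - \<delta>) * (w - \<delta>) \<ge> \<beta> - \<eta>"
    and A2: "(a0 + \<delta>) * (1 + \<kappa>) * (2 * (w + \<delta>)\<^sup>2 / (w - \<delta>)) \<le> 2 * (1 + \<kappa>) * \<beta> + \<eta>"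
    and A3: "2 * \<kappa> * (\<beta> - \<delta>) * (w - \<delta>) / (w + \<delta>) \<ge> 2 * \<kappa> * \<beta> - \<eta>"
    and \<kappa>: "2 * \<kappa> * \<mu> \<ge> 9 * \<beta>"
  shows "c - \<kappa> * b * Q1 / (\<kappa> * \<epsilon> + Q) + \<epsilon> * A * (- \<kappa> * Q2 / (\<kappa> * \<epsilon> + Q)
      + \<kappa> * (1 + \<kappa>) * Q1\<^sup>2 / (\<kappa> * \<epsilon> + Q)\<^sup>2) \<le> c0 - \<beta> + \<delta> + 3 * \<eta> + \<mu> / 4"
proof -
  have Q0: "Q \<ge> 0"
  proof -
    have "(w - \<delta>) * t\<^sup>2 \<ge> 0" using assms(4) by simp
    with Q(1) show ?thesis by linarith
  qed
  define E where "E = \<kappa> * \<epsilon> + Q"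
  have E: "E > 0" using Q0 \<open>\<kappa> > 0\<close> \<open>\<epsilon> > 0\<close> by (simp add: E_def add_pos_nonneg)
  \<comment> \<open>As \<sigma> + \<tau> = 1, the estimate becomes a quadratic inequality in \<tau>
    \<in> [0, 1], uniform in \<epsilon> and in the distance t from the well.\<close>
  define \<sigma> where "\<sigma> = \<kappa> * \<epsilon> / E"
  define \<tau> where "\<tau> = Q / E"
  have \<sigma>: "\<sigma> \<ge> 0" using E \<open>\<kappa> > 0\<close> \<open>\<epsilon> > 0\<close> by (simp add: \<sigma>_def)
  have \<tau>: "\<tau> \<ge> 0" using E Q0 by (simp add: \<tau>_def)
  have \<sigma>\<tau>: "\<sigma> + \<tau> = 1" using E by (simp add: \<sigma>_def \<tau>_def E_def add_divide_distrib[symmetric])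
  have T1: "A * Q2 * \<sigma> \<ge> (\<beta> - \<eta>) * \<sigma>"
  proof -
    have "(a0 - \<delta>) * (w - \<delta>) \<le> A * Q2" using A Q2 assms(4,6) by (intro mult_mono) auto
    then show ?thesis using A1 \<sigma> by (intro mult_right_mono) auto
  qed
  \<comment> \<open>Q is close to w t^2 / 2 and Q1 to w t, so Q1^2 is close to 2 w Q.\<close>
  have Q1sq: "Q1\<^sup>2 \<le> 2 * (w + \<delta>)\<^sup>2 / (w - \<delta>) * Q"
  proof -
    have "\<bar>Q1\<bar> \<le> (w + \<delta>) * \<bar>t\<bar>"
    proof -
      have "\<bar>Q1\<bar> \<le> \<bar>w * t\<bar> + \<delta> * \<bar>t\<bar>" using Q1 by linarith
      also have "\<bar>w * t\<bar> = w * \<bar>t\<bar>" using assms(3,4) by (simp add: abs_mult)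
      finally show ?thesis by (simp add: distrib_right)
    qed
    from power_mono[OF this abs_ge_zero, of 2] have "Q1\<^sup>2 \<le> (w + \<delta>)\<^sup>2 * t\<^sup>2" by (simp add: power_mult_distrib)
    also have "\<dots> \<le> (w + \<delta>)\<^sup>2 * (2 * Q / (w - \<delta>))"
      using Q(1) assms(4) by (intro mult_left_mono) (auto simp: field_simps)
    finally show ?thesis by (simp add: mult_ac)
  qed
  have T2: "A * (1 + \<kappa>) * \<sigma> * (Q1\<^sup>2 / E) \<le> (2 * (1 + \<kappa>) * \<beta> + \<eta>) * (\<sigma> * \<tau>)"
  proof -
    let ?C = "2 * (w + \<delta>)\<^sup>2 / (w - \<delta>)"
    have "Q1\<^sup>2 / E \<le> ?C * Q / E" using Q1sq E by (intro divide_right_mono) auto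
    then have 1: "Q1\<^sup>2 / E \<le> ?C * \<tau>" by (simp add: \<tau>_def)
    have 2: "A * (1 + \<kappa>) * \<sigma> \<le> (a0 + \<delta>) * (1 + \<kappa>) * \<sigma>" using A \<open>\<kappa> > 0\<close> \<sigma> by (intro mult_right_mono) auto
    have "A * (1 + \<kappa>) * \<sigma> * (Q1\<^sup>2 / E) \<le> (a0 + \<delta>) * (1 + \<kappa>) * \<sigma> * (?C * \<tau>)"
      using \<sigma> E \<open>\<kappa> > 0\<close> \<open>a0 > 0\<close> \<open>\<delta> > 0\<close> by (intro mult_mono[OF 2 1]) auto
    also have "\<dots> = ((a0 + \<delta>) * (1 + \<kappa>) * ?C) * (\<sigma> * \<tau>)" by (simp only: mult_ac)
    also have "\<dots> \<le> (2 * (1 + \<kappa>) * \<beta> + \<eta>) * (\<sigma> * \<tau>)"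
      using A2 \<sigma> \<tau> by (intro mult_right_mono) auto
    finally show ?thesis .
  qed
  have T3: "\<kappa> * b * Q1 / E \<ge> (2 * \<kappa> * \<beta> - \<eta>) * \<tau>"
  proof -
    have prod: "(\<beta> - \<delta>) * (w - \<delta>) * s\<^sup>2 \<le> u * v"
      if "s \<ge> 0" "\<bar>u - \<beta> * s\<bar> \<le> \<delta> * s" "\<bar>v - w * s\<bar> \<le> \<delta> * s" for s u v
    proof -
      have 1: "(\<beta> - \<delta>) * s \<le> u" "(w - \<delta>) * s \<le> v"
        using that by (simp_all add: left_diff_distrib abs_le_iff)
      have 2: "0 \<le> (\<beta> - \<delta>) * s" "0 \<le> (w - \<delta>) * s" using that(1) assms(4,5) by simp_all
      have "((\<beta> - \<delta>) * s) * ((w - \<delta>) * s) \<le> u * v"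
        using 1 2 by (intro mult_mono) linarith+
      then show ?thesis by (simp add: power2_eq_square mult_ac)
    qed
    have "b * Q1 \<ge> (\<beta> - \<delta>) * (w - \<delta>) * t\<^sup>2"
    proof (cases "t \<ge> 0")
      case True
      then show ?thesis using prod[of t b Q1] b Q1 by simp
    next
      case False
      then show ?thesis using prod[of "- t" "- b" "- Q1"] b Q1 by (simp add: abs_minus_commute)
    qed
    moreover have "(\<beta> - \<delta>) * (w - \<delta>) * t\<^sup>2 \<ge> (\<beta> - \<delta>) * (w - \<delta>) * (2 * Q / (w + \<delta>))"
    proof (rule mult_left_mono)
      show "2 * Q / (w + \<delta>) \<le> t\<^sup>2" using Q(2) assms(3,4) by (simp add: field_simps)
      show "0 \<le> (\<beta> - \<delta>) * (w - \<delta>)" using assms(4,5) by (intro mult_nonneg_nonneg) auto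
    qed
    ultimately have "b * Q1 \<ge> (\<beta> - \<delta>) * (w - \<delta>) * (2 * Q / (w + \<delta>))" by linarith
    then have "\<kappa> / E * (b * Q1) \<ge> \<kappa> / E * ((\<beta> - \<delta>) * (w - \<delta>) * (2 * Q / (w + \<delta>)))"
      using E \<open>\<kappa> > 0\<close> by (intro mult_left_mono) auto
    also have "\<kappa> / E * ((\<beta> - \<delta>) * (w - \<delta>) * (2 * Q / (w + \<delta>))) = (2 * \<kappa> * (\<beta> - \<delta>) * (w - \<delta>) / (w + \<delta>)) * \<tau>"
      by (simp add: \<tau>_def mult_ac) (simp add: algebra_simps)
    finally have "\<kappa> / E * (b * Q1) \<ge> (2 * \<kappa> * (\<beta> - \<delta>) * (w - \<delta>) / (w + \<delta>)) * \<tau>" .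
    moreover have "(2 * \<kappa> * (\<beta> - \<delta>) * (w - \<delta>) / (w + \<delta>)) * \<tau> \<ge> (2 * \<kappa> * \<beta> - \<eta>) * \<tau>"
      using A3 \<tau> by (intro mult_right_mono) auto
    ultimately show ?thesis by (simp add: mult.assoc)
  qed
  \<comment> \<open>The maximum over \<tau> is 9 \<beta> / (8 (1 + \<kappa>)), which the condition
    on \<kappa> makes at most \<mu> / 4. The proof completes the square.\<close>
  have quad: "3 * \<beta> * \<tau> - 2 * (1 + \<kappa>) * \<beta> * \<tau>\<^sup>2 \<le> \<mu> / 4"
  proof -
    have "0 \<le> (4 * (1 + \<kappa>) * \<beta> * \<tau> - 3 * \<beta>)\<^sup>2 + \<beta> * (2 * \<kappa> * \<mu> - 9 * \<beta> + 2 * \<mu>)"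
      using \<kappa> \<open>\<mu> > 0\<close> \<open>\<beta> > 0\<close> by (intro add_nonneg_nonneg mult_nonneg_nonneg) auto
    also have "\<dots> = 8 * (1 + \<kappa>) * \<beta> * (\<mu> / 4 - (3 * \<beta> * \<tau> - 2 * (1 + \<kappa>) * \<beta> * \<tau>\<^sup>2))"
      by (simp add: algebra_simps power2_eq_square)
    finally have nn: "0 \<le> 8 * (1 + \<kappa>) * \<beta> * (\<mu> / 4 - (3 * \<beta> * \<tau> - 2 * (1 + \<kappa>) * \<beta> * \<tau>\<^sup>2))" .
    have p: "8 * (1 + \<kappa>) * \<beta> > 0" using \<open>\<beta> > 0\<close> \<open>\<kappa> > 0\<close> by simp
    show ?thesis
    proof (rule ccontr)
      assume "\<not> ?thesis"
      then have "\<mu> / 4 - (3 * \<beta> * \<tau> - 2 * (1 + \<kappa>) * \<beta> * \<tau>\<^sup>2) < 0" by linarith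
      from mult_pos_neg[OF p this] nn show False by linarith
    qed
  qed
  have main: "- ((\<beta> - \<eta>) * \<sigma>) + (2 * (1 + \<kappa>) * \<beta> + \<eta>) * (\<sigma> * \<tau>) - (2 * \<kappa> * \<beta> - \<eta>) * \<tau> \<le> - \<beta> + 3 * \<eta> + \<mu> / 4"
  proof -
    have s: "\<sigma> = 1 - \<tau>" using \<sigma>\<tau> by simp
    have "- ((\<beta> - \<eta>) * \<sigma>) + (2 * (1 + \<kappa>) * \<beta> + \<eta>) * (\<sigma> * \<tau>) - (2 * \<kappa> * \<beta> - \<eta>) * \<tau>
       = - \<beta> + (3 * \<beta> * \<tau> - 2 * (1 + \<kappa>) * \<beta> * \<tau>\<^sup>2) + \<eta> * (\<sigma> + \<sigma> * \<tau> + \<tau>)"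
      unfolding s by (simp add: algebra_simps power2_eq_square)
    moreover have "\<eta> * (\<sigma> + \<sigma> * \<tau> + \<tau>) \<le> \<eta> * 3"
    proof (rule mult_left_mono[OF _ \<open>\<eta> \<ge> 0\<close>])
      have "\<sigma> * \<tau> \<le> 1 * 1" using \<sigma> \<tau> \<sigma>\<tau> by (intro mult_mono) auto
      then show "\<sigma> + \<sigma> * \<tau> + \<tau> \<le> 3" using \<sigma> \<tau> \<sigma>\<tau> by linarith
    qed
    ultimately show ?thesis using quad by linarith
  qed
  have "c - \<kappa> * b * Q1 / E + \<epsilon> * A * (- \<kappa> * Q2 / E + \<kappa> * (1 + \<kappa>) * Q1\<^sup>2 / E\<^sup>2)
     = c - A * Q2 * \<sigma> + A * (1 + \<kappa>) * \<sigma> * (Q1\<^sup>2 / E) - \<kappa> * b * Q1 / E"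
    using E by (simp add: \<sigma>_def field_simps power2_eq_square)
  also have "\<dots> \<le> (c0 + \<delta>) + (- ((\<beta> - \<eta>) * \<sigma>) + (2 * (1 + \<kappa>) * \<beta> + \<eta>) * (\<sigma> * \<tau>) - (2 * \<kappa> * \<beta> - \<eta>) * \<tau>)"
    using c T1 T2 T3 by linarith
  finally show ?thesis using main unfolding E_def by linarith
qed

text \<open>This is \<open>L(exp h) / exp h\<close> for \<open>h = - \<kappa> ln (\<kappa> \<epsilon> + Q)\<close>.\<close>

definition barrier_residual ::
  "(real \<Rightarrow> real) \<Rightarrow> (real \<Rightarrow> real) \<Rightarrow> (real \<Rightarrow> real) \<Rightarrow> (real \<Rightarrow> real) \<Rightarrow> (real \<Rightarrow> real) \<Rightarrow> (real \<Rightarrow> real) \<Rightarrow>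
   real \<Rightarrow> real \<Rightarrow> real \<Rightarrow> real"
where
  "barrier_residual a b c Q Q' Q'' \<kappa> \<epsilon> x = c x - \<kappa> * b x * Q' x / (\<kappa> * \<epsilon> + Q x)
     + \<epsilon> * a x * (- \<kappa> * Q'' x / (\<kappa> * \<epsilon> + Q x) + \<kappa> * (1 + \<kappa>) * (Q' x)\<^sup>2 / (\<kappa> * \<epsilon> + Q x)\<^sup>2)"

text \<open>The radius can be chosen before \<epsilon> because the smallness conditions of
  \<open>well_barrier_bound\<close> constrain only the position. Its conditions A1 to A3 hold for
  small \<delta> since they become equalities up to \<eta> at \<delta> = 0, thanks to a0 w =
  \<beta>.\<close>

lemma barrier_residual_near_well:
  assumes "a z > 0" "isCont a z" "isCont c z"
    and Db: "(b has_real_derivative \<beta>) (at z)" "b z = 0" "\<beta> > 0"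
    and Q: "periodic_C2 Q Q' Q''" "\<And>x. Q x \<ge> 0" "Q z = 0" "Q'' z = \<beta> / a z"
    and "\<mu> > 0" "\<kappa> > 0" "2 * \<kappa> * \<mu> \<ge> 9 * \<beta>"
  shows "\<exists>r>0. \<forall>y \<epsilon>. \<bar>y - z\<bar> < r \<longrightarrow> \<epsilon> > 0 \<longrightarrow>
     barrier_residual a b c Q Q' Q'' \<kappa> \<epsilon> y \<le> c z - \<beta> + \<mu>"
proof -
  define a0 where "a0 = a z"
  define w where "w = \<beta> / a0"
  \<comment> \<open>Error budget: with \<delta> < \<eta>, the sum \<delta> + 3 \<eta> + \<mu> / 4 is
    below 3 \<mu> / 4.\<close>
  define \<eta> where "\<eta> = \<mu> / 8"
  have a0: "a0 > 0" using assms(1) by (simp add: a0_def)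
  have w0: "w > 0" using a0 \<open>\<beta> > 0\<close> by (simp add: w_def)
  have aw: "a0 * w = \<beta>" using a0 by (simp add: w_def)
  have \<eta>0: "\<eta> > 0" using \<open>\<mu> > 0\<close> by (simp add: \<eta>_def)
  have small: "\<forall>\<^sub>F \<delta> in at_right (0::real). \<delta> < B" if "B > 0" for B
    using that by (intro eventually_at_right_real[of 0 B, THEN eventually_mono]) auto
  have "((\<lambda>\<delta>. (a0 - \<delta>) * (w - \<delta>)) \<longlongrightarrow> (a0 - 0) * (w - 0)) (at_right 0)" by (intro tendsto_intros)
  then have A1: "\<forall>\<^sub>F \<delta> in at_right 0. (a0 - \<delta>) * (w - \<delta>) > \<beta> - \<eta>"
    by (rule order_tendstoD) (use \<eta>0 aw in auto)
  have "((\<lambda>\<delta>. (a0 + \<delta>) * (1 + \<kappa>) * (2 * (w + \<delta>)\<^sup>2 / (w - \<delta>))) \<longlongrightarrow>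
     (a0 + 0) * (1 + \<kappa>) * (2 * (w + 0)\<^sup>2 / (w - 0))) (at_right 0)"
    using w0 by (intro tendsto_intros) auto
  moreover have "(a0 + 0) * (1 + \<kappa>) * (2 * (w + 0)\<^sup>2 / (w - 0)) = 2 * (1 + \<kappa>) * \<beta>"
    using w0 by (simp add: aw[symmetric] power2_eq_square)
  ultimately have A2: "\<forall>\<^sub>F \<delta> in at_right 0.
      (a0 + \<delta>) * (1 + \<kappa>) * (2 * (w + \<delta>)\<^sup>2 / (w - \<delta>)) < 2 * (1 + \<kappa>) * \<beta> + \<eta>"
    using \<eta>0 by (intro order_tendstoD(2)) auto
  have "((\<lambda>\<delta>. 2 * \<kappa> * (\<beta> - \<delta>) * (w - \<delta>) / (w + \<delta>)) \<longlongrightarrow> 2 * \<kappa> * (\<beta> - 0) * (w - 0) / (w + 0)) (at_right 0)"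
    using w0 by (intro tendsto_intros) auto
  then have A3: "\<forall>\<^sub>F \<delta> in at_right 0. 2 * \<kappa> * (\<beta> - \<delta>) * (w - \<delta>) / (w + \<delta>) > 2 * \<kappa> * \<beta> - \<eta>"
    by (rule order_tendstoD) (use \<eta>0 w0 in auto)
  have "\<forall>\<^sub>F \<delta> in at_right (0::real). \<delta> > 0" by (rule eventually_at_right_less)
  with A1 A2 A3 small[OF a0] small[OF w0] small[OF \<open>\<beta> > 0\<close>] small[OF \<eta>0]
  have "\<forall>\<^sub>F \<delta> in at_right 0. (a0 - \<delta>) * (w - \<delta>) > \<beta> - \<eta> \<and>
      (a0 + \<delta>) * (1 + \<kappa>) * (2 * (w + \<delta>)\<^sup>2 / (w - \<delta>)) < 2 * (1 + \<kappa>) * \<beta> + \<eta> \<and>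
      2 * \<kappa> * (\<beta> - \<delta>) * (w - \<delta>) / (w + \<delta>) > 2 * \<kappa> * \<beta> - \<eta> \<and>
      \<delta> < a0 \<and> \<delta> < w \<and> \<delta> < \<beta> \<and> \<delta> < \<eta> \<and> \<delta> > 0"
    by eventually_elim simp
  then obtain \<delta> where \<delta>: "(a0 - \<delta>) * (w - \<delta>) > \<beta> - \<eta>"
      "(a0 + \<delta>) * (1 + \<kappa>) * (2 * (w + \<delta>)\<^sup>2 / (w - \<delta>)) < 2 * (1 + \<kappa>) * \<beta> + \<eta>"
      "2 * \<kappa> * (\<beta> - \<delta>) * (w - \<delta>) / (w + \<delta>) > 2 * \<kappa> * \<beta> - \<eta>"
      "\<delta> < a0" "\<delta> < w" "\<delta> < \<beta>" "\<delta> < \<eta>" "\<delta> > 0"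
    using eventually_happens' trivial_limit_at_right_real by blast
  note DQ = periodic_C2D(1,2)[OF Q(1)]
  have Q''c: "isCont Q'' z" using periodic_C2D(5)[OF Q(1)] by (simp add: continuous_on_eq_continuous_at)
  have Q'z: "Q' z = 0" by (rule nonneg_zero_deriv[OF DQ(1) Q(2,3)])
  obtain r1 where r1: "r1 > 0" "\<And>x. \<bar>x - z\<bar> < r1 \<Longrightarrow> \<bar>a x - a0\<bar> < \<delta>"
    using assms(2) \<delta>(8) unfolding continuous_at_eps_delta a0_def dist_real_def by blast
  obtain r2 where r2: "r2 > 0" "\<And>x. \<bar>x - z\<bar> < r2 \<Longrightarrow> \<bar>c x - c z\<bar> < \<delta>"
    using assms(3) \<delta>(8) unfolding continuous_at_eps_delta dist_real_def by blast
  obtain r3 where r3: "r3 > 0" "\<And>x. \<bar>x - z\<bar> < r3 \<Longrightarrow> \<bar>b x - \<beta> * (x - z)\<bar> \<le> \<delta> * \<bar>x - z\<bar>"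
    using Db(1) \<delta>(8) unfolding has_field_derivative_def has_derivative_at_alt by (auto simp: \<open>b z = 0\<close>)
  obtain r4 where r4: "r4 > 0" "\<And>x. \<bar>x - z\<bar> < r4 \<Longrightarrow> \<bar>Q'' x - w\<bar> < \<delta>"
    using Q''c \<delta>(8) unfolding continuous_at_eps_delta dist_real_def Q(4) w_def a0_def by blast
  obtain r5 where r5: "r5 > 0" "\<And>x. \<bar>x - z\<bar> < r5 \<Longrightarrow> \<bar>Q' x - w * (x - z)\<bar> \<le> \<delta> * \<bar>x - z\<bar>"
    using DQ(2)[of z] \<delta>(8) unfolding has_field_derivative_def has_derivative_at_alt
    by (auto simp: Q'z Q(4) w_def a0_def)
  define r where "r = min (min r1 r2) (min r3 (min r4 r5))"
  show ?thesis
  proof (intro exI[of _ r] conjI allI impI)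
    show "r > 0" using r1 r2 r3 r4 r5 by (simp add: r_def)
    fix y \<epsilon> :: real assume y: "\<bar>y - z\<bar> < r" and "\<epsilon> > 0"
    obtain t where t: "\<bar>t - z\<bar> \<le> \<bar>y - z\<bar>" "Q y = Q z + Q' z * (y - z) + Q'' t / 2 * (y - z)\<^sup>2"
      using taylor2[OF DQ] by blast
    have Qy: "2 * Q y = Q'' t * (y - z)\<^sup>2" using t(2) Q(3) Q'z by simp
    have Q''t: "\<bar>Q'' t - w\<bar> < \<delta>" using t(1) y by (intro r4) (simp add: r_def)
    have Q1: "(w - \<delta>) * (y - z)\<^sup>2 \<le> 2 * Q y" unfolding Qy using Q''t by (intro mult_right_mono) auto
    have Q2: "2 * Q y \<le> (w + \<delta>) * (y - z)\<^sup>2" unfolding Qy using Q''t by (intro mult_right_mono) auto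
    have c: "c y \<le> c z + \<delta>" using r2(2)[of y] y by (simp add: r_def abs_less_iff)
    have yr: "\<bar>y - z\<bar> < r1" "\<bar>y - z\<bar> < r3" "\<bar>y - z\<bar> < r4" "\<bar>y - z\<bar> < r5" using y by (auto simp: r_def)
    have "barrier_residual a b c Q Q' Q'' \<kappa> \<epsilon> y \<le> c z - \<beta> + \<delta> + 3 * \<eta> + \<mu> / 4"
      unfolding barrier_residual_def
      by (rule well_barrier_bound[OF a0 \<open>\<beta> > 0\<close> \<delta>(8) \<delta>(5) \<delta>(6) \<delta>(4) \<open>\<epsilon> > 0\<close> \<open>\<kappa> > 0\<close>
        less_imp_le[OF \<eta>0] \<open>\<mu> > 0\<close> less_imp_le[OF r1(2)[OF yr(1)]] r3(2)[OF yr(2)] c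
        less_imp_le[OF r4(2)[OF yr(3)]] r5(2)[OF yr(4)] Q1 Q2 less_imp_le[OF \<delta>(1)]
        less_imp_le[OF \<delta>(2)] less_imp_le[OF \<delta>(3)] assms(13)])
    also have "\<dots> \<le> c z - \<beta> + \<mu>" using \<delta>(7) \<open>\<mu> > 0\<close> by (simp add: \<eta>_def)
    finally show "barrier_residual a b c Q Q' Q'' \<kappa> \<epsilon> y \<le> c z - \<beta> + \<mu>" .
  qed
qed

text \<open>Where Q > 0 the residual is jointly continuous in \<epsilon> and y up to \<epsilon> = 0,
  where the diffusion term disappears. A strict inequality at (0, x) therefore persists
  nearby.\<close>

lemma barrier_residual_off_well:
  assumes ac: "continuous_on UNIV a" and bc: "continuous_on UNIV b" and cc: "continuous_on UNIV c"
    and Q: "periodic_C2 Q Q' Q''" "Q x > 0" and H: "continuous_on UNIV H'"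
    and M: "c x - \<kappa> * b x * Q' x / Q x - K * (b x * H' x) < M"
  shows "\<exists>r>0. \<exists>e>0. \<forall>y \<epsilon>. \<bar>y - x\<bar> < r \<longrightarrow> 0 < \<epsilon> \<longrightarrow> \<epsilon> < e \<longrightarrow>
     barrier_residual a b c Q Q' Q'' \<kappa> \<epsilon> y - K * (b y * H' y) \<le> M"
proof -
  have T: "((\<lambda>p. f (snd p)) \<longlongrightarrow> f x) (nhds (0::real, x))" if "continuous_on UNIV f" for f :: "real \<Rightarrow> real"
  proof (rule isCont_tendsto_compose[of x f])
    show "isCont f x" using that by (simp add: continuous_on_eq_continuous_at)
    show "(snd \<longlongrightarrow> x) (nhds (0, x))"
      using tendsto_snd[OF tendsto_ident_at, of "(0, x)" UNIV] by (simp add: tendsto_at_iff_tendsto_nhds[of snd "(0, x)", simplified])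
  qed
  have F: "(fst \<longlongrightarrow> 0) (nhds (0::real, x))"
    using tendsto_fst[OF tendsto_ident_at, of "(0, x)" UNIV] by (simp add: tendsto_at_iff_tendsto_nhds[of fst "(0, x)", simplified])
  define G where "G p = barrier_residual a b c Q Q' Q'' \<kappa> (fst p) (snd p) - K * (b (snd p) * H' (snd p))" for p
  have "(G \<longlongrightarrow> c x - \<kappa> * b x * Q' x / (\<kappa> * 0 + Q x)
     + 0 * a x * (- \<kappa> * Q'' x / (\<kappa> * 0 + Q x) + \<kappa> * (1 + \<kappa>) * (Q' x)\<^sup>2 / (\<kappa> * 0 + Q x)\<^sup>2)
     - K * (b x * H' x)) (nhds (0, x))"
    unfolding G_def barrier_residual_def
    by (intro tendsto_intros T F ac bc cc H periodic_C2D[OF Q(1)]) (use Q(2) in auto)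
  then have "\<forall>\<^sub>F p in nhds (0, x). G p < M"
    by (rule order_tendstoD) (use M in simp)
  then obtain d where d: "d > 0" "\<And>p. dist p (0, x) < d \<Longrightarrow> G p < M"
    unfolding eventually_nhds_metric by blast
  show ?thesis
  proof (intro exI[of _ "d / 2"] conjI allI impI)
    fix y \<epsilon> assume "\<bar>y - x\<bar> < d / 2" "0 < \<epsilon>" "\<epsilon> < d / 2"
    then have "dist (\<epsilon>, y) (0, x) < d"
      using sqrt_sum_squares_le_sum_abs[of \<epsilon> "y - x"] by (simp add: dist_Pair_Pair dist_real_def)
    from d(2)[OF this] show "barrier_residual a b c Q Q' Q'' \<kappa> \<epsilon> y - K * (b y * H' y) \<le> M"
      by (simp add: G_def)
  qed (use d in auto)
qed

section \<open>The upper bound from the global supersolution\<close>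

text \<open>Each point has a neighbourhood with its own K, and compactness of a period leaves
  finitely many. They merge into one K because b H' \<ge> 0, so that increasing K only lowers the
  drift term. With K fixed, what K H adds to the diffusion term vanishes as \<epsilon> tends to
  0.\<close>

lemma eigenvalue_upper_bound:
  assumes Db: "\<And>x. (b has_real_derivative b' x) (at x)" and b'c: "continuous_on UNIV b'"
    and ac: "continuous_on UNIV a" and cc: "continuous_on UNIV c"
    and per: "\<And>x. a (x + 1) = a x" "\<And>x. b (x + 1) = b x" "\<And>x. c (x + 1) = c x"
    and a: "\<And>x. a x > 0" and signs: "b x1 > 0" "b x2 < 0"
    and fin: "finite (circle_zeros b)"
    and M: "\<And>z. z \<in> circle_zeros b \<Longrightarrow> c z - max 0 (b' z) \<le> M" and "\<mu> > 0"
  shows "\<forall>\<^sub>F \<epsilon> in at_right 0. \<forall>l \<phi> \<phi>' \<phi>''. positive_eigenpair a b c \<epsilon> l \<phi> \<phi>' \<phi>'' \<longrightarrow> l \<le> M + \<mu>"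
proof -
  note bc = DERIV_continuous_on_UNIV[OF Db]
  have b'per: "b' (x + 1) = b' x" for x by (rule periodic_deriv[OF per(2) Db])
  \<comment> \<open>One half of \<mu> is for the residual, the other for the diffusion terms
    produced by K H.\<close>
  define \<nu> where "\<nu> = \<mu> / 2"
  have \<nu>: "\<nu> > 0" using \<open>\<mu> > 0\<close> by (simp add: \<nu>_def)
  define Z where "Z = {z \<in> circle_zeros b. b' z > 0}"
  have Z: "finite Z" "Z \<subseteq> {0..<1}"
    unfolding Z_def by (auto intro: finite_subset[OF _ fin]) (auto simp: circle_zeros_def)
  obtain Q Q' Q'' where Q: "periodic_C2 Q Q' Q''" "\<And>x. Q x \<ge> 0" "\<And>x. Q x = 0 \<longleftrightarrow> frac x \<in> Z"
    "\<And>z. z \<in> Z \<Longrightarrow> Q'' z = b' z / a z"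
    using exists_well_prescribed[OF Z, of "\<lambda>z. b' z / a z"] a by (auto simp: Z_def)
  obtain H H' H'' where H: "periodic_C2 H H' H''" "\<And>x. b x \<noteq> 0 \<Longrightarrow> b x * H' x > 0"
    using exists_periodic_potential[OF Db b'c per(2) signs] by blast
  have bH: "b x * H' x \<ge> 0" for x using H(2)[of x] by (cases "b x = 0") auto
  obtain B where B: "B > 0" "\<And>x. \<bar>b' x\<bar> \<le> B" using periodic_bounded[OF b'per b'c] by metis
  \<comment> \<open>Then \<open>2 * \<kappa> * \<nu> = 9 * B\<close>, so that the condition of
    \<open>barrier_residual_near_well\<close> holds at all wells with the same \<kappa>.\<close>
  define \<kappa> where "\<kappa> = 9 * B / (2 * \<nu>)"
  have \<kappa>: "\<kappa> > 0" using B \<nu> by (simp add: \<kappa>_def)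
  let ?R = "barrier_residual a b c Q Q' Q'' \<kappa>"
  have loc: "\<exists>r>0. \<exists>e>0. \<exists>K\<ge>0. \<forall>y \<epsilon>. \<bar>y - x\<bar> < r \<longrightarrow> 0 < \<epsilon> \<longrightarrow> \<epsilon> < e \<longrightarrow> ?R \<epsilon> y - K * (b y * H' y) \<le> M + \<nu>"
    for x
  proof (cases "Q x = 0")
    case True
    then have z: "frac x \<in> Z" using Q(3) by simp
    have eqs: "b x = b (frac x)" "b' x = b' (frac x)" "a x = a (frac x)" "c x = c (frac x)" "Q'' x = Q'' (frac x)"
      by (simp_all add: periodic_frac[of b, OF per(2)] periodic_frac[of b', OF b'per] periodic_frac[of a, OF per(1)]
        periodic_frac[of c, OF per(3)] periodic_frac[of Q'', OF periodic_C2D(8)[OF Q(1)]])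
    have bx: "b x = 0" "b' x > 0" using z unfolding eqs by (auto simp: Z_def circle_zeros_def)
    have cM: "c x - b' x \<le> M" using M[of "frac x"] z bx(2) unfolding eqs by (simp add: Z_def)
    have "9 * b' x \<le> 2 * \<kappa> * \<nu>" using B(2)[of x] \<nu> by (simp add: \<kappa>_def)
    then have "\<exists>r>0. \<forall>y \<epsilon>. \<bar>y - x\<bar> < r \<longrightarrow> \<epsilon> > 0 \<longrightarrow> ?R \<epsilon> y \<le> c x - b' x + \<nu>"
      using ac cc Q(4)[OF z]
      by (intro barrier_residual_near_well a Db bx Q(1,2) True \<nu> \<kappa>)
        (simp_all add: continuous_on_eq_continuous_at eqs)
    then obtain r where r: "r > 0" "\<And>y \<epsilon>. \<bar>y - x\<bar> < r \<Longrightarrow> \<epsilon> > 0 \<Longrightarrow> ?R \<epsilon> y \<le> c x - b' x + \<nu>" by blast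
    \<comment> \<open>At a well the barrier alone suffices, hence K = 0; the threshold 1 for
      \<epsilon> is arbitrary.\<close>
    have "\<forall>y \<epsilon>. \<bar>y - x\<bar> < r \<longrightarrow> 0 < \<epsilon> \<longrightarrow> \<epsilon> < 1 \<longrightarrow> ?R \<epsilon> y - 0 * (b y * H' y) \<le> M + \<nu>"
    proof (intro allI impI)
      fix y \<epsilon> :: real assume "\<bar>y - x\<bar> < r" "0 < \<epsilon>"
      then have "?R \<epsilon> y \<le> c x - b' x + \<nu>" by (rule r(2))
      then show "?R \<epsilon> y - 0 * (b y * H' y) \<le> M + \<nu>" using cM by simp
    qed
    then show ?thesis using r(1) zero_less_one order_refl by blast
  next
    case False
    then have Qx: "Q x > 0" using Q(2)[of x] by (simp add: order_less_le)
    \<comment> \<open>At a zero of b outside Z all drift terms vanish, and c x \<le> M because b'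
      \<le> 0 there. Where b is nonzero, a large K outweighs everything else.\<close>
    have "\<exists>K\<ge>0. c x - \<kappa> * b x * Q' x / Q x - K * (b x * H' x) < M + \<nu>"
    proof (cases "b x = 0")
      case True
      have eqs: "b x = b (frac x)" "b' x = b' (frac x)" "c x = c (frac x)"
        by (simp_all add: periodic_frac[of b, OF per(2)] periodic_frac[of b', OF b'per] periodic_frac[of c, OF per(3)])
      have fz: "frac x \<in> circle_zeros b"
        using True eqs(1) frac_lt_1[of x] by (simp add: circle_zeros_def)
      moreover have "frac x \<notin> Z" using Q(3) False by blast
      ultimately have "b' (frac x) \<le> 0" by (simp add: Z_def)
      then have "c x \<le> M" using M[OF fz] eqs(3) by simp
      then show ?thesis using True \<nu> by (intro exI[of _ 0]) simp
    next
      case b0: False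
      define T where "T = c x - \<kappa> * b x * Q' x / Q x - M"
      have "T - max 0 (T / (b x * H' x)) * (b x * H' x) \<le> 0"
      proof -
        have "T = T / (b x * H' x) * (b x * H' x)" using H(2)[OF b0] by (metis less_irrefl nonzero_eq_divide_eq)
        also have "\<dots> \<le> max 0 (T / (b x * H' x)) * (b x * H' x)" using bH by (intro mult_right_mono) auto
        finally show ?thesis by simp
      qed
      then show ?thesis using \<nu> by (intro exI[of _ "max 0 (T / (b x * H' x))"]) (auto simp: T_def)
    qed
    then obtain K where K: "K \<ge> 0" "c x - \<kappa> * b x * Q' x / Q x - K * (b x * H' x) < M + \<nu>" by blast
    from barrier_residual_off_well[OF ac bc cc Q(1) Qx periodic_C2D(4)[OF H(1)] K(2)] K(1)
    show ?thesis by blast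
  qed
  then obtain r e k where rek: "\<And>x. r x > 0" "\<And>x. e x > 0" "\<And>x. k x \<ge> 0"
    "\<And>x y \<epsilon>. \<bar>y - x\<bar> < r x \<Longrightarrow> 0 < \<epsilon> \<Longrightarrow> \<epsilon> < e x \<Longrightarrow> ?R \<epsilon> y - k x * (b y * H' y) \<le> M + \<nu>"
    by metis
  have "{0..1::real} \<subseteq> (\<Union>x\<in>{0..1}. ball x (r x))" using rek(1) by force
  then obtain C where C: "C \<subseteq> {0..1}" "finite C" "{0..1} \<subseteq> (\<Union>x\<in>C. ball x (r x))"
    by (rule compactE_image[OF compact_Icc, rotated]) auto
  define K where "K = (\<Sum>x\<in>C. k x)"
  define e0 where "e0 = Min (insert 1 (e ` C))"
  have e0: "e0 > 0" using C(2) rek(2) by (simp add: e0_def)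
  have K0: "K \<ge> 0" unfolding K_def by (intro sum_nonneg rek)
  have res01: "?R \<epsilon> y - K * (b y * H' y) \<le> M + \<nu>" if "y \<in> {0..1}" "0 < \<epsilon>" "\<epsilon> < e0" for y \<epsilon>
  proof -
    have "y \<in> (\<Union>x\<in>C. ball x (r x))" using C(3) that(1) by blast
    then obtain x where x: "x \<in> C" "\<bar>y - x\<bar> < r x" by (auto simp: dist_real_def abs_minus_commute)
    have "e0 \<le> e x" unfolding e0_def using C(2) x(1) by (intro Min_le) auto
    then have "?R \<epsilon> y - k x * (b y * H' y) \<le> M + \<nu>" using x that by (intro rek(4)) auto
    moreover have "k x \<le> K" unfolding K_def using C(2) x(1) rek(3) by (intro member_le_sum) auto
    then have "k x * (b y * H' y) \<le> K * (b y * H' y)" by (rule mult_right_mono[OF _ bH])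
    ultimately show ?thesis by linarith
  qed
  have res: "?R \<epsilon> x - K * (b x * H' x) \<le> M + \<nu>" if "0 < \<epsilon>" "\<epsilon> < e0" for x \<epsilon>
  proof -
    have "?R \<epsilon> (frac x) - K * (b (frac x) * H' (frac x)) \<le> M + \<nu>"
      using that frac_ge_0[of x] frac_lt_1[of x] by (intro res01) auto
    then show ?thesis unfolding barrier_residual_def
      periodic_frac[of b, OF per(2)] periodic_frac[of a, OF per(1)] periodic_frac[of c, OF per(3)]
      periodic_frac[of Q, OF periodic_C2D(6)[OF Q(1)]] periodic_frac[of Q', OF periodic_C2D(7)[OF Q(1)]]
      periodic_frac[of Q'', OF periodic_C2D(8)[OF Q(1)]] periodic_frac[of H', OF periodic_C2D(7)[OF H(1)]] .
  qed
  obtain A where A: "A > 0" "\<And>x. \<bar>a x\<bar> \<le> A" using periodic_bounded[OF per(1) ac] by metis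
  obtain C1 where C1: "C1 > 0" "\<And>x. \<bar>H' x\<bar> \<le> C1"
    using periodic_bounded[OF periodic_C2D(7)[OF H(1)] periodic_C2D(4)[OF H(1)]] by metis
  obtain C2 where C2: "C2 > 0" "\<And>x. \<bar>H'' x\<bar> \<le> C2"
    using periodic_bounded[OF periodic_C2D(8)[OF H(1)] periodic_C2D(5)[OF H(1)]] by metis
  obtain M2 where M2: "M2 > 0" "\<And>x. \<bar>Q'' x\<bar> \<le> M2"
    using periodic_bounded[OF periodic_C2D(8)[OF Q(1)] periodic_C2D(5)[OF Q(1)]] by metis
  \<comment> \<open>Bounds for the three contributions of K H to the diffusion term. The delicate
    one is the mixed term: p can be as large as a multiple of 1 / sqrt \<epsilon>, so it decays only
    like sqrt \<epsilon>.\<close>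
  define err where "err \<epsilon> = A * (\<epsilon> * (K * C2) + 2 * K * (sqrt (2 * M2 * \<kappa> * \<epsilon>) * C1) + \<epsilon> * (K * C1)\<^sup>2)" for \<epsilon>
  have "(err \<longlongrightarrow> A * (0 * (K * C2) + 2 * K * (sqrt (2 * M2 * \<kappa> * 0) * C1) + 0 * (K * C1)\<^sup>2)) (at_right 0)"
    unfolding err_def[abs_def] by (intro tendsto_intros)
  then have "\<forall>\<^sub>F \<epsilon> in at_right 0. err \<epsilon> < \<nu>" by (rule order_tendstoD) (use \<nu> in simp)
  moreover have "\<forall>\<^sub>F \<epsilon> in at_right 0. \<epsilon> < e0"
    using e0 by (intro eventually_at_right_real[of 0 e0, THEN eventually_mono]) auto
  moreover have "\<forall>\<^sub>F \<epsilon> in at_right (0::real). \<epsilon> > 0" by (rule eventually_at_right_less)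
  ultimately show ?thesis
  proof eventually_elim
    case (elim \<epsilon>)
    define E where "E x = \<kappa> * \<epsilon> + Q x" for x
    have E: "E x > 0" for x using \<kappa> elim(3) Q(2)[of x] by (simp add: E_def add_pos_nonneg)
    define p where "p x = - \<kappa> * Q' x / E x" for x
    define p' where "p' x = - \<kappa> * Q'' x / E x + \<kappa> * (Q' x)\<^sup>2 / (E x)\<^sup>2" for x
    define h where "h x = - \<kappa> * ln (E x) - K * H x" for x
    define h' where "h' x = p x - K * H' x" for x
    define h'' where "h'' x = p' x - K * H'' x" for x
    have DE: "(E has_real_derivative Q' x) (at x)" for x
      unfolding E_def[abs_def] by (auto intro!: derivative_eq_intros periodic_C2D[OF Q(1)])
    have Dp: "(p has_real_derivative p' x) (at x)" for x
      unfolding p_def[abs_def] p'_def using E[of x]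
      by (auto intro!: derivative_eq_intros DE periodic_C2D[OF Q(1)] simp: field_simps power2_eq_square)
    have Dh: "(h has_real_derivative h' x) (at x)" for x
      unfolding h_def[abs_def] h'_def p_def using E[of x]
      by (auto intro!: derivative_eq_intros DE periodic_C2D[OF H(1)])
    have Dh': "(h' has_real_derivative h'' x) (at x)" for x
      unfolding h'_def[abs_def] h''_def by (auto intro!: derivative_eq_intros Dp periodic_C2D[OF H(1)])
    have hper: "h (x + 1) = h x" for x
      by (simp add: h_def E_def periodic_C2D(6)[OF H(1)] periodic_C2D(6)[OF Q(1)])
    \<comment> \<open>Glaeser's inequality gives (Q')^2 \<le> 2 M2 E, which cancels one power of E
      in the denominator; \<kappa> \<epsilon> \<le> E absorbs the other.\<close>
    have ep: "\<bar>\<epsilon> * p x\<bar> \<le> sqrt (2 * M2 * \<kappa> * \<epsilon>)" for x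
    proof (rule real_le_rsqrt, simp only: power2_abs)
      have "(\<epsilon> * p x)\<^sup>2 = \<epsilon>\<^sup>2 * \<kappa>\<^sup>2 * (Q' x)\<^sup>2 / (E x)\<^sup>2" by (simp add: p_def power_mult_distrib power_divide)
      also have "\<dots> \<le> \<epsilon>\<^sup>2 * \<kappa>\<^sup>2 * (2 * M2 * E x) / (E x)\<^sup>2"
      proof (intro divide_right_mono mult_left_mono)
        have "(Q' x)\<^sup>2 \<le> 2 * M2 * Q x"
          by (rule nonneg_deriv_square_le[OF periodic_C2D(1,2)[OF Q(1)] Q(2) M2(2,1)])
        also have "\<dots> \<le> 2 * M2 * E x" using M2(1) \<kappa> elim(3) by (intro mult_left_mono) (auto simp: E_def)
        finally show "(Q' x)\<^sup>2 \<le> 2 * M2 * E x" .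
      qed auto
      also have "\<dots> = (2 * M2 * \<kappa> * \<epsilon>) * (\<kappa> * \<epsilon> / E x)" using E[of x] by (simp add: power2_eq_square)
      also have "\<dots> \<le> (2 * M2 * \<kappa> * \<epsilon>) * 1"
        using M2(1) \<kappa> elim(3) E[of x] Q(2)[of x] by (intro mult_left_mono) (auto simp: E_def)
      finally show "(\<epsilon> * p x)\<^sup>2 \<le> 2 * M2 * \<kappa> * \<epsilon>" by simp
    qed
    have bound: "\<epsilon> * a x * (h'' x + (h' x)\<^sup>2) + b x * h' x + c x \<le> M + \<mu>" for x
    proof -
      have "\<epsilon> * a x * (h'' x + (h' x)\<^sup>2) + b x * h' x + c x
        = (?R \<epsilon> x - K * (b x * H' x)) + a x * (- \<epsilon> * (K * H'' x) - 2 * K * ((\<epsilon> * p x) * H' x) + \<epsilon> * (K * H' x)\<^sup>2)"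
      proof -
        have R: "?R \<epsilon> x = c x + b x * p x + \<epsilon> * a x * (p' x + (p x)\<^sup>2)"
          unfolding barrier_residual_def p'_def p_def E_def[symmetric] using E[of x]
          by (simp add: field_simps power2_eq_square)
        show ?thesis unfolding R h''_def h'_def by (simp add: algebra_simps power2_eq_square)
      qed
      moreover have "a x * (- \<epsilon> * (K * H'' x) - 2 * K * ((\<epsilon> * p x) * H' x) + \<epsilon> * (K * H' x)\<^sup>2) \<le> err \<epsilon>"
      proof -
        have 1: "- \<epsilon> * (K * H'' x) \<le> \<epsilon> * (K * C2)"
        proof -
          have "\<epsilon> * (K * (- H'' x)) \<le> \<epsilon> * (K * C2)"
            using C2(2)[of x] K0 elim(3) by (intro mult_left_mono) auto
          then show ?thesis by simp
        qed
        have 2: "- 2 * K * ((\<epsilon> * p x) * H' x) \<le> 2 * K * (sqrt (2 * M2 * \<kappa> * \<epsilon>) * C1)"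
        proof -
          have "\<bar>(\<epsilon> * p x) * H' x\<bar> \<le> sqrt (2 * M2 * \<kappa> * \<epsilon>) * C1"
            unfolding abs_mult[of "\<epsilon> * p x"] using ep[of x] C1(2)[of x] M2(1) \<kappa> elim(3) by (intro mult_mono) auto
          then have "- ((\<epsilon> * p x) * H' x) \<le> sqrt (2 * M2 * \<kappa> * \<epsilon>) * C1" by linarith
          from mult_left_mono[OF this, of "2 * K"] K0 show ?thesis by simp
        qed
        have 3: "\<epsilon> * (K * H' x)\<^sup>2 \<le> \<epsilon> * (K * C1)\<^sup>2"
        proof (rule mult_left_mono)
          have "\<bar>K * H' x\<bar> \<le> K * C1" unfolding abs_mult using C1(2)[of x] K0 by (intro mult_mono) auto
          from power_mono[OF this abs_ge_zero, of 2] show "(K * H' x)\<^sup>2 \<le> (K * C1)\<^sup>2" by simp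
        qed (use elim(3) in simp)
        let ?X = "\<epsilon> * (K * C2) + 2 * K * (sqrt (2 * M2 * \<kappa> * \<epsilon>) * C1) + \<epsilon> * (K * C1)\<^sup>2"
        have "a x * (- \<epsilon> * (K * H'' x) - 2 * K * ((\<epsilon> * p x) * H' x) + \<epsilon> * (K * H' x)\<^sup>2) \<le> a x * ?X"
          using a[of x] 1 2 3 by (intro mult_left_mono) linarith+
        also have "\<dots> \<le> A * ?X"
          using A(2)[of x] K0 C1(1) C2(1) M2(1) \<kappa> elim(3)
          by (intro mult_right_mono add_nonneg_nonneg mult_nonneg_nonneg) auto
        finally show ?thesis by (simp add: err_def)
      qed
      ultimately show ?thesis using res[OF elim(3,2), of x] elim(1) by (simp add: \<nu>_def)
    qed
    show ?case using positive_eigenpair_le[OF _ a elim(3) Dh Dh' hper bound] by blast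
  qed
qed

section \<open>The limit\<close>

theorem theorem4p1:
  fixes a b c :: "real \<Rightarrow> real"
  assumes "C_k_circle 2 a" and "\<forall>x. a x > 0"
    and "C_k_circle 1 b" and "C_k_circle 0 c"
    and "\<exists>x. b x > 0" and "\<exists>x. b x < 0"
    and "finite (circle_zeros b)"
    and "\<forall>x\<in>circle_zeros b. (\<exists>m. finite_order_zero b x m) \<or> flat_zero b x"
  shows "((\<lambda>\<epsilon>. principal_eigenvalue a b c \<epsilon>) \<longlongrightarrow>
           complex_of_real (Max ((\<lambda>x. - max 0 (deriv b x) + c x) ` circle_zeros b))) (at_right 0)"
proof -
  have nd0: "nth_derivative 0 f = f" for f :: "real \<Rightarrow> real" by (simp add: nth_derivative_def)
  have a: "a x > 0" for x using assms(2) by blast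
  define a' where "a' = nth_derivative 1 a"
  define b' where "b' = nth_derivative 1 b"
  have Da: "(a has_real_derivative a' x) (at x)" for x
    using C_k_circleD(3)[OF assms(1), of 0 x]
    by (simp add: a'_def nd0 has_real_derivative_iff_has_vector_derivative)
  have "(a' has_real_derivative nth_derivative 2 a x) (at x)" for x
    using C_k_circleD(3)[OF assms(1), of 1 x]
    by (simp add: a'_def numeral_2_eq_2 has_real_derivative_iff_has_vector_derivative)
  then have a'c: "continuous_on UNIV a'" by (rule DERIV_continuous_on_UNIV)
  have Db: "(b has_real_derivative b' x) (at x)" for x
    using C_k_circleD(3)[OF assms(3), of 0 x]
    by (simp add: b'_def nd0 has_real_derivative_iff_has_vector_derivative)
  have b'c: "continuous_on UNIV b'" using C_k_circleD(2)[OF assms(3)] by (simp add: b'_def)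
  have db: "deriv b x = b' x" for x by (rule DERIV_imp_deriv[OF Db])
  have cc: "continuous_on UNIV c" using C_k_circleD(2)[OF assms(4)] by (simp add: nd0)
  note ac = DERIV_continuous_on_UNIV[OF Da] and bc = DERIV_continuous_on_UNIV[OF Db]
  note per = C_k_circleD(1)[OF assms(1)] C_k_circleD(1)[OF assms(3)] C_k_circleD(1)[OF assms(4)]
  obtain x1 x2 where signs: "b x1 > 0" "b x2 < 0" using assms(5,6) by blast
  \<comment> \<open>The maximum has to range over a nonempty set; the sign change supplies a zero by
    connectedness.\<close>
  obtain z0 where "b z0 = 0"
  proof -
    have "connected (range b)" by (intro connected_continuous_image bc) simp
    then have "0 \<in> range b" using connectedD_interval[of "range b" "b x2" "b x1" 0] signs by auto
    then show ?thesis using that by auto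
  qed
  then have "frac z0 \<in> circle_zeros b"
    using periodic_frac[of b, OF per(2)] frac_lt_1[of z0] by (simp add: circle_zeros_def)
  then have ne: "circle_zeros b \<noteq> {}" by blast
  define g where "g x = - max 0 (deriv b x) + c x" for x
  define M where "M = Max (g ` circle_zeros b)"
  have "M \<in> g ` circle_zeros b" unfolding M_def using assms(7) ne by (intro Max_in) auto
  then obtain z where z: "z \<in> circle_zeros b" "M = g z" by blast
  have bz: "b z = 0" using z(1) by (simp add: circle_zeros_def)
  have Mge: "c x - max 0 (b' x) \<le> M" if "x \<in> circle_zeros b" for x
  proof -
    have "g x \<le> M" unfolding M_def using assms(7) that by (intro Max_ge) auto
    then show ?thesis by (simp add: g_def db)
  qed
  have Meq: "M = c z - max 0 (b' z)" using z(2) by (simp add: g_def db)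
  have isC: "isCont a z" "isCont c z" using ac cc by (simp_all add: continuous_on_eq_continuous_at)
  have "((\<lambda>\<epsilon>. principal_eigenvalue a b c \<epsilon>) \<longlongrightarrow> complex_of_real M) (at_right 0)"
  proof (rule tendstoI)
    fix e :: real assume "e > 0"
    then have e2: "e / 2 > 0" by simp
    have "\<forall>\<^sub>F \<epsilon> in at_right (0::real). \<epsilon> > 0" by (rule eventually_at_right_less)
    \<comment> \<open>A bump at one zero attaining the maximum suffices from below, whereas the
      bound from above has to take all zeros into account.\<close>
    moreover note eigenvalue_lower_bound[OF a isC Db bz e2]
    moreover have "\<forall>\<^sub>F \<epsilon> in at_right 0. \<forall>l \<phi> \<phi>' \<phi>''.
        positive_eigenpair a b c \<epsilon> l \<phi> \<phi>' \<phi>'' \<longrightarrow> l \<le> M + e / 2"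
      by (rule eigenvalue_upper_bound[OF Db b'c ac cc per a signs assms(7) _ e2]) (rule Mge)
    ultimately show "\<forall>\<^sub>F \<epsilon> in at_right 0. dist (principal_eigenvalue a b c \<epsilon>) (complex_of_real M) < e"
    proof eventually_elim
      case (elim \<epsilon>)
      obtain l \<phi> \<phi>' \<phi>'' where ep: "positive_eigenpair a b c \<epsilon> l \<phi> \<phi>' \<phi>''"
        using positive_eigenpair_exists[OF Da a'c Db b'c cc per a elim(1)] by blast
      have "principal_eigenvalue a b c \<epsilon> = complex_of_real l"
        by (rule principal_eigenvalue_eq[OF ep ac bc a elim(1)])
      moreover have "M - e / 2 \<le> l" "l \<le> M + e / 2" using elim(2,3) ep unfolding Meq by blast+
      then have "\<bar>l - M\<bar> < e" using \<open>e > 0\<close> by (simp add: abs_less_iff)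
      ultimately show ?case by (simp add: dist_real_def)
    qed
  qed
  then show ?thesis by (simp only: M_def g_def[abs_def])
qed

end
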